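(* Let $W$ be a finite irreducible crystallographic Coxeter group of rank $n$, and let $p$ be a good prime for $W$. Then the measure $H_{W,p}$ is a special instance of the BHR walks, with face weights $$v_p(wW_K)=\frac{|W_K|\,\chi(L^{Fix(W_K)},p)}{p^n\,|N_W(W_K)|\,|\lambda(K)|};$$ that is, these weights are nonnegative and sum to $1$ over all faces of the arrangement $\mathcal{A}$ of root hyperplanes of $W$, and for the BHR walk on the chambers of $\mathcal{A}$ with these weights started at the chamber of the identity, the probability that the chamber after one step corresponds to $w$ is $H_{W,p}(w)$ for each $w\in W$. In particular, $H_{W,p}(w)\ge 0$ for all $w\in W$.
   Context: $W$ is the Weyl group of an irreducible crystallographic root system with base $\Pi$, acting on the $n$-dimensional real reflection representation $V$; $\mathcal{A}$ is the arrangement of root hyperplanes. $Des(w)$ is the set of simple roots $\alpha\in\Pi$ with $w(\alpha)$ negative. For $K\subseteq\Pi$, $W_K$ is the parabolic subgroup generated by the reflections in the roots of $K$, $Fix(W_K)$ its fixed space in $V$, $N_W(W_K)$ its normalizer in $W$, and $\lambda(K)$ the set of all subsets $J\subseteq \Pi$ with $w(K)=J$ for some $w\in W$. $L$ is the set of all intersections of hyperplanes of $\mathcal{A}$ (including $V$), partially ordered by reverse inclusion, with Möbius function $\mu$. For $X\in L$, $L^X=\{Y\in L: Y\ge X\}$ and $\chi(L^X,x)=\sum_{Y\ge X}\mu(X,Y)x^{\dim Y}$. For real $x\ne 0$, $$H_{W,x}(w)=\sum_{K\subseteq\Pi-Des(w)}\frac{|W_K|\chi(L^{Fix(W_K)},x)}{x^n|N_W(W_K)||\lambda(K)|}.$$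 A prime $p$ is bad for $W$ if it divides the coefficient of some simple root in the expression of some root as a linear combination of simple roots; otherwise it is good. Chambers of $\mathcal{A}$ are the components of the complement; the chamber corresponding to $w$ is $wC$, with $C=\{v:\langle v,\alpha\rangle>0\ \forall\alpha\in\Pi\}$. Faces of $\mathcal{A}$ are the nonempty intersections obtained by choosing for each hyperplane either itself or one of its open half-spaces; the left coset $wW_K$ corresponds to the face $w\{v:\langle v,\alpha\rangle=0\ (\alpha\in K),\ \langle v,\alpha\rangle>0\ (\alpha\in\Pi-K)\}$, and this is a bijection between left cosets of parabolic subgroups $W_K$ and faces. BHR walk: assign weights $v(F)\ge 0$ to the faces with $\sum_F v(F)=1$; at step $i$ pick a face $F_i$ with $P(F_i=F)=v(F)$, and let $C_i$ be the unique chamber whose closure contains $F_i$ and which among such chambers is separated from $C_{i-1}$ by the fewest hyperplanes. *)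

theory Defs
  imports
    "HOL-Analysis.Analysis"
    "HOL-Probability.Probability_Mass_Function"
    "HOL-Algebra.Generated_Groups"
    "HOL-Algebra.Group_Action"
begin

section \<open>Root systems and Weyl groups\<close>

definition reflection :: "'a::euclidean_space \<Rightarrow> 'a \<Rightarrow> 'a" where
  "reflection \<alpha> v = v - (2 * (v \<bullet> \<alpha>) / (\<alpha> \<bullet> \<alpha>)) *\<^sub>R \<alpha>"

text \<open>Reduced crystallographic root systems spanning the ambient space.\<close>

definition crystallographic_root_system :: "'a::euclidean_space set \<Rightarrow> bool" where
  "crystallographic_root_system \<Phi> \<longleftrightarrow>
     finite \<Phi> \<and> 0 \<notin> \<Phi> \<and> span \<Phi> = UNIV \<and>
     (\<forall>\<alpha>\<in>\<Phi>. \<forall>c. c *\<^sub>R \<alpha> \<in> \<Phi> \<longrightarrow> c = 1 \<or> c = -1) \<and>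
     (\<forall>\<alpha>\<in>\<Phi>. reflection \<alpha> ` \<Phi> = \<Phi>) \<and>
     (\<forall>\<alpha>\<in>\<Phi>. \<forall>\<beta>\<in>\<Phi>. 2 * (\<beta> \<bullet> \<alpha>) / (\<alpha> \<bullet> \<alpha>) \<in> \<int>)"

definition irreducible_root_system :: "'a::euclidean_space set \<Rightarrow> bool" where
  "irreducible_root_system \<Phi> \<longleftrightarrow>
     \<Phi> \<noteq> {} \<and>
     \<not> (\<exists>A B. A \<noteq> {} \<and> B \<noteq> {} \<and> A \<inter> B = {} \<and> A \<union> B = \<Phi> \<and> (\<forall>\<alpha>\<in>A. \<forall>\<beta>\<in>B. \<alpha> \<bullet> \<beta> = 0))"

definition root_base :: "'a::euclidean_space set \<Rightarrow> 'a set \<Rightarrow> bool" where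
  "root_base \<Phi> \<Delta> \<longleftrightarrow>
     \<Delta> \<subseteq> \<Phi> \<and> independent \<Delta> \<and> span \<Delta> = UNIV \<and>
     (\<forall>\<beta>\<in>\<Phi>. (\<forall>\<alpha>\<in>\<Delta>. representation \<Delta> \<beta> \<alpha> \<in> \<int>) \<and>
        ((\<forall>\<alpha>\<in>\<Delta>. 0 \<le> representation \<Delta> \<beta> \<alpha>) \<or> (\<forall>\<alpha>\<in>\<Delta>. representation \<Delta> \<beta> \<alpha> \<le> 0)))"

definition negative_roots :: "'a::euclidean_space set \<Rightarrow> 'a set \<Rightarrow> 'a set" where
  "negative_roots \<Phi> \<Delta> = {\<beta> \<in> \<Phi>. \<forall>\<alpha>\<in>\<Delta>. representation \<Delta> \<beta> \<alpha> \<le> 0}"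

text \<open>
  Every prime divides 0, so only coefficients of simple roots that actually occur in the
  expression of a root are taken into account.
\<close>

definition bad_prime :: "'a::euclidean_space set \<Rightarrow> 'a set \<Rightarrow> nat \<Rightarrow> bool" where
  "bad_prime \<Phi> \<Delta> p \<longleftrightarrow> prime p \<and>
     (\<exists>\<beta>\<in>\<Phi>. \<exists>\<alpha>\<in>\<Delta>. \<exists>k::int. representation \<Delta> \<beta> \<alpha> = of_int k \<and> k \<noteq> 0 \<and> int p dvd k)"

definition good_prime :: "'a::euclidean_space set \<Rightarrow> 'a set \<Rightarrow> nat \<Rightarrow> bool" where
  "good_prime \<Phi> \<Delta> p \<longleftrightarrow> prime p \<and> \<not> bad_prime \<Phi> \<Delta> p"

text \<open>
  The Weyl group as a group of functions under composition, so that its elements act on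
  vectors by application and on sets of vectors by taking images.
\<close>

definition weyl_group :: "'a::euclidean_space set \<Rightarrow> ('a \<Rightarrow> 'a) monoid" where
  "weyl_group \<Phi> = subgroup_generated (BijGroup UNIV) (reflection ` \<Phi>)"

definition parabolic :: "'a::euclidean_space set \<Rightarrow> 'a set \<Rightarrow> ('a \<Rightarrow> 'a) set" where
  "parabolic \<Phi> K = generate (weyl_group \<Phi>) (reflection ` K)"

definition fixed_space :: "('a \<Rightarrow> 'a) set \<Rightarrow> 'a set" where
  "fixed_space G = {v. \<forall>g\<in>G. g v = v}"

definition Des :: "'a::euclidean_space set \<Rightarrow> 'a set \<Rightarrow> ('a \<Rightarrow> 'a) \<Rightarrow> 'a set" where
  "Des \<Phi> \<Delta> w = {\<alpha> \<in> \<Delta>. w \<alpha> \<in> negative_roots \<Phi> \<Delta>}"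

definition conjugate_subsets :: "'a::euclidean_space set \<Rightarrow> 'a set \<Rightarrow> 'a set \<Rightarrow> 'a set set" where
  "conjugate_subsets \<Phi> \<Delta> K = {J. J \<subseteq> \<Delta> \<and> (\<exists>w\<in>carrier (weyl_group \<Phi>). w ` K = J)}"


section \<open>Hyperplane arrangements\<close>

definition root_arrangement :: "'a::euclidean_space set \<Rightarrow> 'a set set" where
  "root_arrangement \<Phi> = {{v. v \<bullet> \<alpha> = 0} | \<alpha>. \<alpha> \<in> \<Phi>}"

text \<open>The whole space is included, as the intersection of the empty family.\<close>

definition intersection_lattice :: "'a set set \<Rightarrow> 'a set set" where
  "intersection_lattice A = {\<Inter>B | B. B \<subseteq> A}"

text \<open>
  Moebius function of a finite family of sets ordered by reverse inclusion. It is set to 0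
  outside the order relation and for infinite families.
\<close>

function mobius :: "'a set set \<Rightarrow> 'a set \<Rightarrow> 'a set \<Rightarrow> int" where
  "mobius L X Y =
     (if \<not> finite L \<or> \<not> Y \<subseteq> X then 0
      else if Y = X then 1
      else - (\<Sum>Z\<in>{Z \<in> L. Y \<subset> Z \<and> Z \<subseteq> X}. mobius L X Z))"
  by pat_completeness auto
termination
proof (relation "Wellfounded.measure (\<lambda>(L, X, Y). card {Z \<in> L. Y \<subset> Z})", goal_cases)
  case 1
  show ?case by simp
next
  case (2 L X Y Z)
  then have "{Z' \<in> L. Z \<subset> Z'} \<subset> {Z' \<in> L. Y \<subset> Z'}" by auto
  moreover have "finite {Z' \<in> L. Y \<subset> Z'}" using 2 by auto
  ultimately show ?case by (simp add: psubset_card_mono)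
qed

declare mobius.simps [simp del]

definition upper_char_poly :: "'a::euclidean_space set set \<Rightarrow> 'a set \<Rightarrow> real \<Rightarrow> real" where
  "upper_char_poly L X x = (\<Sum>Y\<in>{Y \<in> L. Y \<subseteq> X}. of_int (mobius L X Y) * x ^ dim Y)"

definition open_half_spaces :: "'a::euclidean_space set \<Rightarrow> 'a set set" where
  "open_half_spaces H = {{v. v \<bullet> a > 0} | a. a \<noteq> 0 \<and> H = {v. v \<bullet> a = 0}}"

definition arrangement_faces :: "'a::euclidean_space set set \<Rightarrow> 'a set set" where
  "arrangement_faces A =
     {F. F \<noteq> {} \<and> (\<exists>\<sigma>. (\<forall>H\<in>A. \<sigma> H = H \<or> \<sigma> H \<in> open_half_spaces H) \<and> F = (\<Inter>H\<in>A. \<sigma> H))}"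

definition chambers :: "'a::euclidean_space set set \<Rightarrow> 'a set set" where
  "chambers A = components (- \<Union>A)"

definition separates :: "'a::euclidean_space set \<Rightarrow> 'a set \<Rightarrow> 'a set \<Rightarrow> bool" where
  "separates H C D \<longleftrightarrow>
     (\<exists>S\<in>open_half_spaces H. \<exists>T\<in>open_half_spaces H. S \<noteq> T \<and> C \<subseteq> S \<and> D \<subseteq> T)"


section \<open>BHR walks\<close>

definition nearest_chamber :: "'a::euclidean_space set set \<Rightarrow> 'a set \<Rightarrow> 'a set \<Rightarrow> 'a set" where
  "nearest_chamber A F C =
     (THE D. is_arg_min (\<lambda>D. card {H \<in> A. separates H C D})
               (\<lambda>D. D \<in> chambers A \<and> F \<subseteq> closure D) D)"

definition face_weights :: "'a::euclidean_space set set \<Rightarrow> ('a set \<Rightarrow> real) \<Rightarrow> bool" where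
  "face_weights A v \<longleftrightarrow>
     (\<forall>F\<in>arrangement_faces A. 0 \<le> v F) \<and> (\<Sum>F\<in>arrangement_faces A. v F) = 1"

text \<open>Both functions below are meaningful only if \<^term>\<open>face_weights A v\<close> holds.\<close>

definition face_pmf :: "'a::euclidean_space set set \<Rightarrow> ('a set \<Rightarrow> real) \<Rightarrow> 'a set pmf" where
  "face_pmf A v = embed_pmf (\<lambda>F. if F \<in> arrangement_faces A then v F else 0)"

primrec bhr_walk :: "'a::euclidean_space set set \<Rightarrow> ('a set \<Rightarrow> real) \<Rightarrow> 'a set \<Rightarrow> nat \<Rightarrow> 'a set pmf" where
  "bhr_walk A v C 0 = return_pmf C"
| "bhr_walk A v C (Suc i) =
     bind_pmf (bhr_walk A v C i) (\<lambda>D. map_pmf (\<lambda>F. nearest_chamber A F D) (face_pmf A v))"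


section \<open>The measure and the face weights\<close>

definition coset_weight :: "'a::euclidean_space set \<Rightarrow> 'a set \<Rightarrow> real \<Rightarrow> 'a set \<Rightarrow> real" where
  "coset_weight \<Phi> \<Delta> x K =
     (real (card (parabolic \<Phi> K)) *
        upper_char_poly (intersection_lattice (root_arrangement \<Phi>)) (fixed_space (parabolic \<Phi> K)) x) /
     (x ^ DIM('a) * real (card (normalizer (weyl_group \<Phi>) (parabolic \<Phi> K))) *
        real (card (conjugate_subsets \<Phi> \<Delta> K)))"

definition H_measure :: "'a::euclidean_space set \<Rightarrow> 'a set \<Rightarrow> real \<Rightarrow> ('a \<Rightarrow> 'a) \<Rightarrow> real" where
  "H_measure \<Phi> \<Delta> x w = (\<Sum>K\<in>Pow (\<Delta> - Des \<Phi> \<Delta> w). coset_weight \<Phi> \<Delta> x K)"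

definition standard_face :: "'a::euclidean_space set \<Rightarrow> 'a set \<Rightarrow> 'a set" where
  "standard_face \<Delta> K = {v. (\<forall>\<alpha>\<in>K. v \<bullet> \<alpha> = 0) \<and> (\<forall>\<alpha>\<in>\<Delta> - K. v \<bullet> \<alpha> > 0)}"

definition fundamental_chamber :: "'a::euclidean_space set \<Rightarrow> 'a set" where
  "fundamental_chamber \<Delta> = {v. \<forall>\<alpha>\<in>\<Delta>. v \<bullet> \<alpha> > 0}"

text \<open>
  The weight of a coset \<open>w W\<^sub>K\<close>, transported to faces: each face is \<open>w ` standard_face \<Delta> K\<close>
  for a unique \<open>K \<subseteq> \<Delta>\<close> and some \<open>w\<close>, unique up to right multiplication by \<open>W\<^sub>K\<close>.
\<close>

definition face_weight :: "'a::euclidean_space set \<Rightarrow> 'a set \<Rightarrow> real \<Rightarrow> 'a set \<Rightarrow> real" where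
  "face_weight \<Phi> \<Delta> x F = coset_weight \<Phi> \<Delta> x
     (THE K. K \<subseteq> \<Delta> \<and> (\<exists>w\<in>carrier (weyl_group \<Phi>). F = w ` standard_face \<Delta> K))"

end

theory Submission
  imports Defs
begin

text \<open>
  For a good prime \<open>p\<close> the number \<open>\<chi>(L\<^sup>X, p)\<close> counts points: reduce the coweight lattice modulo \<open>p\<close>
  and attach to each residue class the set \<open>Z\<close> of roots vanishing on it. If \<open>Z\<close> always equals
  \<open>\<Phi> \<inter> span Z\<close>, the residue classes are stratified by \<open>L\<close>, the classes in the closed stratum of \<open>X\<close>
  number \<open>p\<close> to the power \<open>dim X\<close>, and Moebius inversion shows that the open stratum of \<open>X\<close> has
  \<open>\<chi>(L\<^sup>X, p)\<close> elements. Hence the weights are nonnegative; since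
  \<open>|N\<^sub>W(W\<^sub>K)|\<close> is the order of the stabilizer of \<open>Fix(W\<^sub>K)\<close> and \<open>\<lambda>(K)\<close> counts the standard parabolics
  with the same orbit of fixed spaces, the total weight is the number of all residue classes divided
  by \<open>p\<^sup>n\<close>.

  That \<open>Z\<close> is closed under spans for good \<open>p\<close>: represent the class by a coweight \<open>y\<close> minimising
  \<open>\<Sum>\<^sub>\<beta> (y \<bullet> \<beta>)\<^sup>2\<close>, so that \<open>|y \<bullet> \<beta>| \<le> p\<close> for all roots, move it into the dominant chamber and compare
  a root in the span of \<open>Z\<close> with the highest root.

  For the walk, the chamber nearest to \<open>C\<close> among those adjacent to the face of \<open>wW\<^sub>K\<close> is \<open>uC\<close> with
  \<open>u\<close> the representative of \<open>wW\<^sub>K\<close> that keeps \<open>K\<close> positive, that is, \<open>K \<inter> Des u = {}\<close>.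
\<close>

text \<open>Goodness is needed because a coweight can vanish modulo p on roots whose span contains
  further roots. In type B2 with p = 2, the coweight with value 0 on the long and 1 on the short
  simple root vanishes modulo 2 exactly on the long roots. These span the plane, so this class and
  the zero class would both be attached to the flat 0, which must receive only one class. Coweights
  are reduced because their values on the simple roots can be prescribed freely; this gives closed
  strata exactly p^dim points. The energy argument replaces the passage to an alcove of the affine
  Weyl group dilated by p: translation by p times a coroot preserves the residue class, and while
  some value exceeds p such a translation lowers the energy. Once all values are at most p in
  absolute value, a root vanishing modulo p has value 0, p or -p. Irreducibility enters through the
  highest root, whose coefficients are all nonzero, so that goodness applies to each of them. In the
  total weight, |W_K| / |N_W(W_K)| converts the size |W| / |W_K| of an orbit of faces into the size
  |W| / |N_W(W_K)| of the orbit of flats spanned by these faces.\<close>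

section \<open>Reflections and the groups they generate\<close>

text \<open>HOL-Algebra claims the notation \<open>inv\<close> for group inverses.\<close>

abbreviation finv :: "('a \<Rightarrow> 'b) \<Rightarrow> 'b \<Rightarrow> 'a" where
  "finv \<equiv> inv_into UNIV"

lemma linear_reflection: "linear (reflection \<alpha>)"
  unfolding reflection_def
  by (rule linearI) (simp_all add: algebra_simps inner_add_left add_divide_distrib)

lemma reflection_self: "\<alpha> \<noteq> 0 \<Longrightarrow> reflection \<alpha> \<alpha> = - \<alpha>"
  unfolding reflection_def by (simp add: scaleR_2 flip: scaleR_left.diff)

lemma reflection_involution [simp]: "reflection \<alpha> (reflection \<alpha> v) = v"
proof (cases "\<alpha> = 0")
  case True then show ?thesis by (simp add: reflection_def)
next
  case False
  then have "v - (2 * (v \<bullet> \<alpha>) / (\<alpha> \<bullet> \<alpha>)) *\<^sub>R \<alpha> - (2 * ((v - (2 * (v \<bullet> \<alpha>) / (\<alpha> \<bullet> \<alpha>)) *\<^sub>R \<alpha>) \<bullet> \<alpha>) / (\<alpha> \<bullet> \<alpha>)) *\<^sub>R \<alpha> = v"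
    by (simp add: inner_diff_left diff_divide_distrib right_diff_distrib flip: scaleR_left.diff scaleR_left.add)
  then show ?thesis by (simp add: reflection_def)
qed

lemma reflection_adjoint: "reflection \<alpha> u \<bullet> v = u \<bullet> reflection \<alpha> v"
  by (simp add: reflection_def inner_diff_left inner_diff_right inner_commute)

lemma reflection_inner [simp]: "reflection \<alpha> u \<bullet> reflection \<alpha> v = u \<bullet> v"
  by (simp add: reflection_adjoint)

lemma reflection_comp_reflection [simp]: "reflection \<alpha> \<circ> reflection \<alpha> = id"
  by (simp add: fun_eq_iff)

lemma bij_reflection: "bij (reflection \<alpha>)"
  by (rule o_bij) (rule reflection_comp_reflection)+

lemma reflection_fixes: "v \<bullet> \<alpha> = 0 \<Longrightarrow> reflection \<alpha> v = v"
  by (simp add: reflection_def)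

lemma reflection_fixes_iff: "\<alpha> \<noteq> 0 \<Longrightarrow> reflection \<alpha> v = v \<longleftrightarrow> v \<bullet> \<alpha> = 0"
  by (simp add: reflection_def)

text \<open>Reflections are involutions, so words in them already form a group, with reversal as
  inversion. The word description gives plain list induction and supports the length argument behind
  the exchange condition.\<close>

primrec refls :: "'a::euclidean_space list \<Rightarrow> 'a \<Rightarrow> 'a" where
  "refls [] = id"
| "refls (\<alpha> # xs) = reflection \<alpha> \<circ> refls xs"

definition refl_group :: "'a::euclidean_space set \<Rightarrow> ('a \<Rightarrow> 'a) set" where
  "refl_group K = refls ` lists K"

lemma refls_append: "refls (xs @ ys) = refls xs \<circ> refls ys"
  by (induction xs) (auto simp: o_assoc)

lemma refls_inner [simp]: "refls xs u \<bullet> refls xs v = u \<bullet> v"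
  by (induction xs) auto

lemma linear_refls: "linear (refls xs)"
proof (induction xs)
  case Nil then show ?case by (simp only: refls.simps linear_id)
next
  case (Cons a xs) then show ?case by (simp only: refls.simps) (intro linear_compose linear_reflection)
qed

lemma refls_rev_refls [simp]: "refls (rev xs) (refls xs v) = v"
  by (induction xs arbitrary: v) (auto simp: refls_append)

lemma refls_refls_rev [simp]: "refls xs (refls (rev xs) v) = v"
  by (induction xs arbitrary: v) (auto simp: refls_append)

lemma refls_comp_rev [simp]: "refls (rev xs) \<circ> refls xs = id" "refls xs \<circ> refls (rev xs) = id"
  by (auto simp: fun_eq_iff)

lemma bij_refls: "bij (refls xs)"
  by (rule o_bij) (rule refls_comp_rev)+

lemma inv_refls: "finv (refls xs) = refls (rev xs)"
  by (rule inv_unique_comp) simp_all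

lemma refl_group_id: "id \<in> refl_group K"
  unfolding refl_group_def by (rule image_eqI[of _ _ "[]"]) auto

lemma refl_group_comp: "g \<in> refl_group K \<Longrightarrow> h \<in> refl_group K \<Longrightarrow> g \<circ> h \<in> refl_group K"
  unfolding refl_group_def by (auto simp flip: refls_append intro!: imageI)

lemma refl_group_inv: "g \<in> refl_group K \<Longrightarrow> finv g \<in> refl_group K"
  unfolding refl_group_def by (auto simp: inv_refls intro!: imageI)

lemma refl_group_reflection: "\<alpha> \<in> K \<Longrightarrow> reflection \<alpha> \<in> refl_group K"
  unfolding refl_group_def by (rule image_eqI[of _ _ "[\<alpha>]"]) auto

lemma refl_group_mono: "J \<subseteq> K \<Longrightarrow> refl_group J \<subseteq> refl_group K"
  unfolding refl_group_def by (simp add: image_mono lists_mono)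

lemma refl_group_linear: "g \<in> refl_group K \<Longrightarrow> linear g"
  by (auto simp: refl_group_def linear_refls)

lemma refl_group_bij: "g \<in> refl_group K \<Longrightarrow> bij g"
  by (auto simp: refl_group_def bij_refls)

lemma refl_group_inner: "g \<in> refl_group K \<Longrightarrow> g u \<bullet> g v = u \<bullet> v"
  by (auto simp: refl_group_def)

lemma refl_group_inverse [simp]:
  "g \<in> refl_group K \<Longrightarrow> g (finv g v) = v" "g \<in> refl_group K \<Longrightarrow> finv g (g v) = v"
  by (meson refl_group_bij bij_inv_eq_iff bij_is_inj inv_f_f)+

lemma refl_group_adjoint: "g \<in> refl_group K \<Longrightarrow> finv g u \<bullet> v = u \<bullet> g v"
  by (metis refl_group_inner refl_group_inverse(1))

lemma refl_group_adjoint': "g \<in> refl_group K \<Longrightarrow> g u \<bullet> v = u \<bullet> finv g v"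
  by (metis refl_group_inner refl_group_inverse(1))

lemma refl_group_induct [consumes 1, case_names id step]:
  assumes "g \<in> refl_group K" "P id"
    "\<And>\<alpha> h. \<alpha> \<in> K \<Longrightarrow> h \<in> refl_group K \<Longrightarrow> P h \<Longrightarrow> P (reflection \<alpha> \<circ> h)"
  shows "P g"
proof -
  obtain xs where "xs \<in> lists K" "g = refls xs" using assms(1) by (auto simp: refl_group_def)
  moreover from this(1) have "P (refls xs)"
  proof (induction xs)
    case Nil then show ?case using assms(2) by (simp only: refls.simps)
  next
    case (Cons a xs)
    then show ?case unfolding refls.simps by (intro assms(3)) (auto simp: refl_group_def)
  qed
  ultimately show ?thesis by simp
qed

lemma refl_group_subset:
  assumes "\<And>\<alpha>. \<alpha> \<in> K \<Longrightarrow> reflection \<alpha> \<in> refl_group J"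
  shows "refl_group K \<subseteq> refl_group J"
proof
  fix g assume "g \<in> refl_group K"
  then show "g \<in> refl_group J"
    by (induction rule: refl_group_induct) (blast intro: refl_group_id refl_group_comp assms)+
qed

lemma fixed_space_refl_group:
  assumes "0 \<notin> K"
  shows "fixed_space (refl_group K) = {v. \<forall>\<alpha>\<in>K. v \<bullet> \<alpha> = 0}"
proof (intro equalityI subsetI CollectI ballI)
  fix v \<alpha> assume "v \<in> fixed_space (refl_group K)" "\<alpha> \<in> K"
  then have "reflection \<alpha> v = v" "\<alpha> \<noteq> 0"
    using assms by (auto simp: fixed_space_def refl_group_reflection)
  then show "v \<bullet> \<alpha> = 0" by (simp add: reflection_fixes_iff)
next
  fix v assume v: "v \<in> {v. \<forall>\<alpha>\<in>K. v \<bullet> \<alpha> = 0}"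
  have "g v = v" if "g \<in> refl_group K" for g
    using that v by (induction rule: refl_group_induct) (auto simp: reflection_fixes)
  then show "v \<in> fixed_space (refl_group K)" by (simp add: fixed_space_def)
qed

text \<open>The monoid is kept abstract because two instances occur: \<open>BijGroup UNIV\<close>,
  in which the Weyl group is generated, and \<open>weyl_group \<Phi>\<close>, in which parabolic
  subgroups are generated.\<close>

lemma generate_eq_refl_group:
  fixes G :: "('a::euclidean_space \<Rightarrow> 'a) monoid"
  assumes one: "\<one>\<^bsub>G\<^esub> = id"
    and mult: "\<And>g h. g \<in> refl_group \<Phi> \<Longrightarrow> h \<in> refl_group \<Phi> \<Longrightarrow> g \<otimes>\<^bsub>G\<^esub> h = g \<circ> h"
    and inv: "\<And>\<alpha>. \<alpha> \<in> \<Phi> \<Longrightarrow> inv\<^bsub>G\<^esub> (reflection \<alpha>) = reflection \<alpha>"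
    and K: "K \<subseteq> \<Phi>"
  shows "generate G (reflection ` K) = refl_group K"
proof (intro equalityI subsetI)
  fix g assume "g \<in> generate G (reflection ` K)"
  then show "g \<in> refl_group K"
  proof (induction rule: generate.induct)
    case one then show ?case unfolding assms(1) by (rule refl_group_id)
  next
    case (incl h) then show ?case by (auto intro: refl_group_reflection)
  next
    case (inv h) then show ?case using K assms(3) by (metis imageE subsetD refl_group_reflection)
  next
    case (eng h1 h2)
    then show ?case using mult[of h1 h2] refl_group_mono[OF K] refl_group_comp[of h1 K h2] by (metis subsetD)
  qed
next
  fix g assume "g \<in> refl_group K"
  then show "g \<in> generate G (reflection ` K)"
  proof (induction rule: refl_group_induct)
    case id
    show ?case using generate.one[of G "reflection ` K"] unfolding one .
  next
    case (step \<alpha> h)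
    then have "reflection \<alpha> \<otimes>\<^bsub>G\<^esub> h \<in> generate G (reflection ` K)"
      by (intro generate.eng generate.incl[of "reflection \<alpha>"]) auto
    moreover have "reflection \<alpha> \<otimes>\<^bsub>G\<^esub> h = reflection \<alpha> \<circ> h"
      using step K refl_group_mono[OF K] by (intro mult refl_group_reflection) auto
    ultimately show ?case by (simp only:)
  qed
qed

section \<open>Identification with the Weyl group and its parabolic subgroups as algebraic
  structures\<close>

lemma Bij_UNIV: "Bij UNIV = {f. bij f}"
  by (simp add: Bij_def extensional_def)

lemma one_BijGroup_UNIV: "\<one>\<^bsub>BijGroup UNIV\<^esub> = id"
  by (simp add: BijGroup_def fun_eq_iff)

lemma mult_BijGroup_UNIV: "bij g \<Longrightarrow> bij h \<Longrightarrow> g \<otimes>\<^bsub>BijGroup UNIV\<^esub> h = g \<circ> h"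
  by (simp add: BijGroup_def Bij_UNIV compose_def fun_eq_iff)

lemma inv_BijGroup_UNIV:
  assumes "bij g"
  shows "inv\<^bsub>BijGroup UNIV\<^esub> g = finv g"
proof -
  interpret group "BijGroup UNIV" by (rule group_BijGroup)
  have "finv g \<otimes>\<^bsub>BijGroup UNIV\<^esub> g = \<one>\<^bsub>BijGroup UNIV\<^esub>"
    using assms by (simp add: mult_BijGroup_UNIV one_BijGroup_UNIV bij_imp_bij_inv inv_o_cancel bij_is_inj)
  moreover have "g \<in> carrier (BijGroup UNIV)" "finv g \<in> carrier (BijGroup UNIV)"
    using assms by (auto simp: BijGroup_def Bij_UNIV bij_imp_bij_inv)
  ultimately show ?thesis using inv_equality by blast
qed

lemma one_weyl_group: "\<one>\<^bsub>weyl_group \<Phi>\<^esub> = id"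
  by (simp add: weyl_group_def one_BijGroup_UNIV)

lemma carrier_weyl_group: "carrier (weyl_group \<Phi>) = refl_group \<Phi>"
proof -
  have "carrier (BijGroup UNIV) \<inter> reflection ` \<Phi> = reflection ` \<Phi>"
    by (auto simp: BijGroup_def Bij_UNIV bij_reflection)
  then have "carrier (weyl_group \<Phi>) = generate (BijGroup UNIV) (reflection ` \<Phi>)"
    by (simp add: weyl_group_def carrier_subgroup_generated)
  also have "\<dots> = refl_group \<Phi>"
  proof (rule generate_eq_refl_group[OF _ _ _ order_refl])
    show "inv\<^bsub>BijGroup UNIV\<^esub> reflection \<alpha> = reflection \<alpha>" for \<alpha> :: 'a
      by (metis bij_reflection inv_BijGroup_UNIV inv_unique_comp reflection_comp_reflection)
  qed (auto simp: one_BijGroup_UNIV mult_BijGroup_UNIV refl_group_bij)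
  finally show ?thesis .
qed

lemma mult_weyl_group:
  "g \<in> refl_group \<Phi> \<Longrightarrow> h \<in> refl_group \<Phi> \<Longrightarrow> g \<otimes>\<^bsub>weyl_group \<Phi>\<^esub> h = g \<circ> h"
  by (simp add: weyl_group_def mult_BijGroup_UNIV refl_group_bij)

lemma inv_weyl_group:
  assumes "g \<in> refl_group \<Phi>"
  shows "inv\<^bsub>weyl_group \<Phi>\<^esub> g = finv g"
proof -
  have "g \<in> carrier (subgroup_generated (BijGroup UNIV) (reflection ` \<Phi>))"
    using assms carrier_weyl_group[of \<Phi>] by (simp add: weyl_group_def)
  then show ?thesis
    unfolding weyl_group_def
    by (simp add: group.inv_subgroup_generated[OF group_BijGroup] inv_BijGroup_UNIV refl_group_bij[OF assms])
qed

lemma parabolic_eq: "K \<subseteq> \<Phi> \<Longrightarrow> parabolic \<Phi> K = refl_group K"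
  unfolding parabolic_def
  by (rule generate_eq_refl_group[where \<Phi> = \<Phi>])
    (auto simp: one_weyl_group mult_weyl_group inv_weyl_group refl_group_reflection
      intro!: inv_unique_comp)

lemma normalizer_weyl_group:
  assumes "H \<subseteq> refl_group \<Phi>"
  shows "normalizer (weyl_group \<Phi>) H = {g \<in> refl_group \<Phi>. (\<lambda>h. g \<circ> h \<circ> finv g) ` H = H}"
proof -
  have "g <#\<^bsub>weyl_group \<Phi>\<^esub> H #>\<^bsub>weyl_group \<Phi>\<^esub> inv\<^bsub>weyl_group \<Phi>\<^esub> g = (\<lambda>h. g \<circ> h \<circ> finv g) ` H"
    if g: "g \<in> refl_group \<Phi>" for g
  proof -
    have "g <#\<^bsub>weyl_group \<Phi>\<^esub> H = (\<lambda>h. g \<circ> h) ` H"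
      using g assms mult_weyl_group[of g \<Phi>] unfolding l_coset_def by blast
    moreover have "(g \<circ> h) \<otimes>\<^bsub>weyl_group \<Phi>\<^esub> finv g = g \<circ> h \<circ> finv g" if "h \<in> H" for h
      using g assms that by (intro mult_weyl_group refl_group_comp refl_group_inv) auto
    ultimately show ?thesis
      unfolding r_coset_def by (auto simp: inv_weyl_group[OF g])
  qed
  with assms show ?thesis
    unfolding normalizer_def stabilizer_def carrier_weyl_group by auto
qed

section \<open>Positive roots\<close>

locale based_root_system =
  fixes \<Phi> \<Delta> :: "'a::euclidean_space set"
  assumes root_system: "crystallographic_root_system \<Phi>"
    and base: "root_base \<Phi> \<Delta>"
begin

lemma finite_roots: "finite \<Phi>"
  and zero_not_root: "0 \<notin> \<Phi>"
  and span_roots: "span \<Phi> = UNIV"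
  and root_multiple: "\<alpha> \<in> \<Phi> \<Longrightarrow> c *\<^sub>R \<alpha> \<in> \<Phi> \<Longrightarrow> c = 1 \<or> c = -1"
  and reflection_image_roots: "\<alpha> \<in> \<Phi> \<Longrightarrow> reflection \<alpha> ` \<Phi> = \<Phi>"
  and cartan_int: "\<alpha> \<in> \<Phi> \<Longrightarrow> \<beta> \<in> \<Phi> \<Longrightarrow> 2 * (\<beta> \<bullet> \<alpha>) / (\<alpha> \<bullet> \<alpha>) \<in> \<int>"
  using root_system by (auto simp: crystallographic_root_system_def)

lemma base_roots: "\<Delta> \<subseteq> \<Phi>"
  and independent_base: "independent \<Delta>"
  and span_base: "span \<Delta> = UNIV"
  using base by (auto simp: root_base_def)

lemma finite_base: "finite \<Delta>"
  using base_roots finite_roots finite_subset by blast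

lemma finite_subbase: "K \<subseteq> \<Delta> \<Longrightarrow> finite K"
  using finite_base finite_subset by blast

lemma subbase_roots: "K \<subseteq> \<Delta> \<Longrightarrow> K \<subseteq> \<Phi>"
  using base_roots by blast

lemma root_neq_zero: "\<beta> \<in> \<Phi> \<Longrightarrow> \<beta> \<noteq> 0"
  using zero_not_root by auto

lemma root_reflection: "\<alpha> \<in> \<Phi> \<Longrightarrow> \<beta> \<in> \<Phi> \<Longrightarrow> reflection \<alpha> \<beta> \<in> \<Phi>"
  using reflection_image_roots by blast

lemma root_uminus: "\<beta> \<in> \<Phi> \<Longrightarrow> - \<beta> \<in> \<Phi>"
  using root_reflection[of \<beta> \<beta>] reflection_self root_neq_zero by metis

lemma root_uminus_iff [simp]: "- \<beta> \<in> \<Phi> \<longleftrightarrow> \<beta> \<in> \<Phi>"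
  using root_uminus by force

lemma card_base: "card \<Delta> = DIM('a)"
  using independent_base span_base by (metis dim_UNIV dim_eq_card_independent dim_span)

abbreviation W :: "('a \<Rightarrow> 'a) set" where "W \<equiv> refl_group \<Phi>"

lemma root_image: "w \<in> W \<Longrightarrow> \<beta> \<in> \<Phi> \<Longrightarrow> w \<beta> \<in> \<Phi>"
  by (induction rule: refl_group_induct) (auto simp: root_reflection)

lemma root_image_iff: "w \<in> W \<Longrightarrow> w \<beta> \<in> \<Phi> \<longleftrightarrow> \<beta> \<in> \<Phi>"
  by (metis root_image refl_group_inv refl_group_inverse(2))

lemma subgroup_W: "K \<subseteq> \<Delta> \<Longrightarrow> g \<in> refl_group K \<Longrightarrow> g \<in> W"
  using refl_group_mono[of K \<Phi>] base_roots by blast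

text \<open>An element is linear and the roots span, so it is determined by the permutation it
  induces on the finite set \<open>\<Phi>\<close>.\<close>

lemma finite_W: "finite W"
proof -
  have "inj_on (\<lambda>w. restrict w \<Phi>) W"
  proof (rule inj_onI)
    fix g h assume *: "g \<in> W" "h \<in> W" "restrict g \<Phi> = restrict h \<Phi>"
    have "g v = h v" for v
    proof (rule linear_eq_on[of g h v \<Phi>])
      show "g b = h b" if "b \<in> \<Phi>" for b
        using *(3) that by (metis restrict_apply')
    qed (use * span_roots in \<open>auto intro: refl_group_linear\<close>)
    then show "g = h" by auto
  qed
  moreover have "(\<lambda>w. restrict w \<Phi>) ` W \<subseteq> (\<Phi> \<rightarrow>\<^sub>E \<Phi>)"
    by (auto simp: root_image)
  moreover have "finite (\<Phi> \<rightarrow>\<^sub>E \<Phi>)" by (intro finite_PiE finite_roots)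
  ultimately show ?thesis using finite_imageD finite_subset by blast
qed

text \<open>The fundamental coweights. Writing the coefficient functionals as inner products lets
  coefficients and geometric pairings be handled by the same linear algebra.\<close>

definition dual_basis :: "'a \<Rightarrow> 'a" where
  "dual_basis \<alpha> = (\<Sum>b\<in>Basis. representation \<Delta> b \<alpha> *\<^sub>R b)"

lemma linear_rep: "linear (\<lambda>x. representation \<Delta> x \<alpha>)"
  by (rule linearI)
    (simp_all add: representation_add representation_scale independent_base span_base)

lemma inner_dual_basis: "x \<bullet> dual_basis \<alpha> = representation \<Delta> x \<alpha>"
proof -
  have "representation \<Delta> x \<alpha> = representation \<Delta> (\<Sum>b\<in>Basis. (x \<bullet> b) *\<^sub>R b) \<alpha>"
    by (simp add: euclidean_representation)
  also have "\<dots> = (\<Sum>b\<in>Basis. (x \<bullet> b) * representation \<Delta> b \<alpha>)"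
    using linear_sum[OF linear_rep[of \<alpha>], of "\<lambda>b. (x \<bullet> b) *\<^sub>R b" Basis]
    by (simp add: linear_scale[OF linear_rep])
  also have "\<dots> = x \<bullet> dual_basis \<alpha>"
    by (simp add: dual_basis_def inner_sum_right mult.commute)
  finally show ?thesis by simp
qed

lemma inner_base_dual_basis:
  "\<alpha> \<in> \<Delta> \<Longrightarrow> \<alpha> \<bullet> dual_basis \<gamma> = (if \<gamma> = \<alpha> then 1 else 0)"
  by (simp add: inner_dual_basis representation_basis independent_base)

lemma base_expansion: "(\<Sum>\<alpha>\<in>\<Delta>. (x \<bullet> dual_basis \<alpha>) *\<^sub>R \<alpha>) = x"
  unfolding inner_dual_basis
  by (intro sum_representation_eq) (auto simp: independent_base span_base finite_base)

lemma inner_expansion: "x \<bullet> y = (\<Sum>\<alpha>\<in>\<Delta>. (x \<bullet> dual_basis \<alpha>) * (\<alpha> \<bullet> y))"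
  by (subst base_expansion[of x, symmetric]) (simp add: inner_sum_left)

lemma coef_int: "\<beta> \<in> \<Phi> \<Longrightarrow> \<alpha> \<in> \<Delta> \<Longrightarrow> \<beta> \<bullet> dual_basis \<alpha> \<in> \<int>"
  using base by (auto simp: root_base_def inner_dual_basis)

text \<open>This is the sum of fundamental coweights, not of fundamental weights, so pairing with
  \<open>\<rho>\<close> is the height. The same vector serves as the reference point of the open
  fundamental chamber.\<close>

definition \<rho> :: 'a where "\<rho> = (\<Sum>\<alpha>\<in>\<Delta>. dual_basis \<alpha>)"

lemma inner_rho: "x \<bullet> \<rho> = (\<Sum>\<alpha>\<in>\<Delta>. x \<bullet> dual_basis \<alpha>)"
  by (simp add: \<rho>_def inner_sum_right)

lemma base_inner_rho: "\<alpha> \<in> \<Delta> \<Longrightarrow> \<alpha> \<bullet> \<rho> = 1"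
  by (simp add: inner_rho inner_base_dual_basis finite_base)

lemma height_int: "\<beta> \<in> \<Phi> \<Longrightarrow> \<beta> \<bullet> \<rho> \<in> \<int>"
  unfolding inner_rho by (intro Ints_sum coef_int)

text \<open>Positivity is a single inequality on the height; \<open>coef_cases\<close> shows that
  for roots it agrees with nonnegativity of all coefficients. Many sign arguments then reduce to
  showing that a height is nonnegative, since no root has height 0.\<close>

definition pos :: "'a set" where "pos = {\<beta> \<in> \<Phi>. 0 < \<beta> \<bullet> \<rho>}"

lemma pos_root: "\<beta> \<in> pos \<Longrightarrow> \<beta> \<in> \<Phi>"
  by (simp add: pos_def)

text \<open>Coefficients of one sign with sum zero all vanish, which would make the root
  zero.\<close>

lemma coef_cases:
  assumes "\<beta> \<in> \<Phi>"
  shows "(\<forall>\<alpha>\<in>\<Delta>. 0 \<le> \<beta> \<bullet> dual_basis \<alpha>) \<and> 0 < \<beta> \<bullet> \<rho> \<or>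
    (\<forall>\<alpha>\<in>\<Delta>. \<beta> \<bullet> dual_basis \<alpha> \<le> 0) \<and> \<beta> \<bullet> \<rho> < 0"
proof -
  have nz: "\<beta> \<bullet> \<rho> \<noteq> 0"
    if "(\<forall>\<alpha>\<in>\<Delta>. 0 \<le> \<beta> \<bullet> dual_basis \<alpha>) \<or> (\<forall>\<alpha>\<in>\<Delta>. \<beta> \<bullet> dual_basis \<alpha> \<le> 0)"
  proof
    assume "\<beta> \<bullet> \<rho> = 0"
    then have "(\<Sum>\<alpha>\<in>\<Delta>. \<beta> \<bullet> dual_basis \<alpha>) = 0" by (simp only: inner_rho)
    with that have "\<forall>\<alpha>\<in>\<Delta>. \<bar>\<beta> \<bullet> dual_basis \<alpha>\<bar> = 0"
      using finite_base by (subst sum_nonneg_eq_0_iff[symmetric]) (auto simp: sum_negf abs_of_nonneg abs_of_nonpos)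
    then have "\<beta> = 0" using base_expansion[of \<beta>] by simp
    then show False using assms zero_not_root by simp
  qed
  have *: "(\<forall>\<alpha>\<in>\<Delta>. 0 \<le> \<beta> \<bullet> dual_basis \<alpha>) \<or> (\<forall>\<alpha>\<in>\<Delta>. \<beta> \<bullet> dual_basis \<alpha> \<le> 0)"
    using base assms by (auto simp: root_base_def inner_dual_basis)
  moreover have "0 \<le> \<beta> \<bullet> \<rho>" if "\<forall>\<alpha>\<in>\<Delta>. 0 \<le> \<beta> \<bullet> dual_basis \<alpha>"
    using that by (simp add: inner_rho sum_nonneg)
  moreover have "\<beta> \<bullet> \<rho> \<le> 0" if "\<forall>\<alpha>\<in>\<Delta>. \<beta> \<bullet> dual_basis \<alpha> \<le> 0"
    using that by (simp add: inner_rho sum_nonpos)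
  ultimately show ?thesis using nz by force
qed

lemma root_height_neq_zero: "\<beta> \<in> \<Phi> \<Longrightarrow> \<beta> \<bullet> \<rho> \<noteq> 0"
  using coef_cases by force

lemma pos_coef: "\<beta> \<in> pos \<Longrightarrow> \<alpha> \<in> \<Delta> \<Longrightarrow> 0 \<le> \<beta> \<bullet> dual_basis \<alpha>"
  using coef_cases[of \<beta>] by (auto simp: pos_def)

lemma pos_if_coef:
  assumes "\<beta> \<in> \<Phi>" "\<alpha> \<in> \<Delta>" "0 < \<beta> \<bullet> dual_basis \<alpha>"
  shows "\<beta> \<in> pos"
  using coef_cases[of \<beta>] assms by (force simp: pos_def)

lemma base_pos: "\<Delta> \<subseteq> pos"
  using base_roots by (auto simp: pos_def base_inner_rho)

lemma not_pos_iff: "\<beta> \<in> \<Phi> \<Longrightarrow> \<beta> \<notin> pos \<longleftrightarrow> - \<beta> \<in> pos"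
  using root_height_neq_zero[of \<beta>] by (auto simp: pos_def)

lemma negative_roots_eq: "negative_roots \<Phi> \<Delta> = {\<beta> \<in> \<Phi>. \<beta> \<notin> pos}"
proof -
  have "(\<forall>\<alpha>\<in>\<Delta>. \<beta> \<bullet> dual_basis \<alpha> \<le> 0) \<longleftrightarrow> \<not> 0 < \<beta> \<bullet> \<rho>" if "\<beta> \<in> \<Phi>" for \<beta>
  proof -
    have "\<beta> \<bullet> \<rho> \<le> 0" if "\<forall>\<alpha>\<in>\<Delta>. \<beta> \<bullet> dual_basis \<alpha> \<le> 0"
      using that by (simp add: inner_rho sum_nonpos)
    then show ?thesis using coef_cases[OF that] by auto
  qed
  then show ?thesis by (auto simp: negative_roots_def pos_def inner_dual_basis)
qed

lemma pos_height: "\<beta> \<in> pos \<Longrightarrow> 1 \<le> \<beta> \<bullet> \<rho>"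
proof -
  assume "\<beta> \<in> pos"
  then have "\<beta> \<bullet> \<rho> \<in> \<int>" "0 < \<beta> \<bullet> \<rho>" using height_int by (auto simp: pos_def)
  then show ?thesis by (auto elim!: Ints_cases)
qed

text \<open>Reducedness excludes other positive multiples of \<open>\<alpha>\<close>, so
  \<open>\<beta>\<close> has a positive coefficient at some other simple root. The reflection alters
  only the coefficient at \<open>\<alpha>\<close>, and one positive coefficient fixes the sign of a
  root.\<close>

lemma simple_reflection_pos:
  assumes \<alpha>: "\<alpha> \<in> \<Delta>" and \<beta>: "\<beta> \<in> pos" "\<beta> \<noteq> \<alpha>"
  shows "reflection \<alpha> \<beta> \<in> pos"
proof -
  have "\<exists>\<gamma>\<in>\<Delta>. \<gamma> \<noteq> \<alpha> \<and> \<beta> \<bullet> dual_basis \<gamma> \<noteq> 0"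
  proof (rule ccontr)
    assume "\<not> ?thesis"
    then have "(\<Sum>\<gamma>\<in>\<Delta>. (\<beta> \<bullet> dual_basis \<gamma>) *\<^sub>R \<gamma>) = (\<beta> \<bullet> dual_basis \<alpha>) *\<^sub>R \<alpha>"
      using \<alpha> by (subst sum.remove[OF finite_base \<alpha>]) (auto intro!: sum.neutral)
    then have eq: "\<beta> = (\<beta> \<bullet> dual_basis \<alpha>) *\<^sub>R \<alpha>" by (simp add: base_expansion)
    then have "\<beta> \<bullet> dual_basis \<alpha> = 1 \<or> \<beta> \<bullet> dual_basis \<alpha> = -1"
      using root_multiple[of \<alpha> "\<beta> \<bullet> dual_basis \<alpha>"] \<alpha> \<beta> base_roots pos_root by auto
    then show False using eq \<beta> pos_coef[OF \<beta>(1) \<alpha>] by auto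
  qed
  then obtain \<gamma> where \<gamma>: "\<gamma> \<in> \<Delta>" "\<gamma> \<noteq> \<alpha>" "0 < \<beta> \<bullet> dual_basis \<gamma>"
    using pos_coef[OF \<beta>(1)] by force
  have "reflection \<alpha> \<beta> \<bullet> dual_basis \<gamma> = \<beta> \<bullet> dual_basis \<gamma>"
    using \<alpha> \<gamma> by (simp add: reflection_def inner_diff_left inner_base_dual_basis)
  then show ?thesis
    using pos_if_coef[of "reflection \<alpha> \<beta>" \<gamma>] \<gamma> \<alpha> \<beta> root_reflection pos_root base_roots by auto
qed

lemma simple_reflection_self: "\<alpha> \<in> \<Delta> \<Longrightarrow> reflection \<alpha> \<alpha> = - \<alpha>"
  using base_roots root_neq_zero reflection_self by blast

section \<open>Dominant vectors and orbits of simple roots\<close>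

definition dominant_for :: "'a set \<Rightarrow> 'a \<Rightarrow> bool" where
  "dominant_for K v \<longleftrightarrow> (\<forall>\<alpha>\<in>K. 0 \<le> v \<bullet> \<alpha>)"

text \<open>A point of the \<open>W\<^sub>K\<close>-orbit of \<open>v\<close> with maximal inner product with \<open>\<rho>\<close> is \<open>K\<close>-dominant.\<close>

lemma exists_dominant:
  assumes "K \<subseteq> \<Delta>"
  shows "\<exists>g\<in>refl_group K. dominant_for K (g v)"
proof -
  let ?S = "(\<lambda>g. g v \<bullet> \<rho>) ` refl_group K"
  have fin: "finite ?S"
    using finite_W subgroup_W[OF assms] by (meson finite_imageI finite_subset subsetI)
  have "?S \<noteq> {}" using refl_group_id by blast
  then obtain g where g: "g \<in> refl_group K" "g v \<bullet> \<rho> = Max ?S"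
    using Max_in[OF fin] by force
  have "0 \<le> g v \<bullet> \<alpha>" if "\<alpha> \<in> K" for \<alpha>
  proof (rule ccontr)
    assume neg: "\<not> 0 \<le> g v \<bullet> \<alpha>"
    have \<alpha>: "\<alpha> \<bullet> \<rho> = 1" "0 < \<alpha> \<bullet> \<alpha>"
      using that assms base_inner_rho base_roots root_neq_zero by (auto simp: subset_iff)
    have "reflection \<alpha> \<circ> g \<in> refl_group K"
      using that g by (intro refl_group_comp refl_group_reflection)
    then have "(reflection \<alpha> \<circ> g) v \<bullet> \<rho> \<le> Max ?S" by (intro Max_ge fin imageI)
    then have "reflection \<alpha> (g v) \<bullet> \<rho> \<le> g v \<bullet> \<rho>" using g by simp
    moreover have "reflection \<alpha> (g v) \<bullet> \<rho> = g v \<bullet> \<rho> - 2 * (g v \<bullet> \<alpha>) / (\<alpha> \<bullet> \<alpha>)"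
      by (simp add: reflection_def inner_diff_left \<alpha>)
    moreover have "2 * (g v \<bullet> \<alpha>) / (\<alpha> \<bullet> \<alpha>) < 0"
      using neg \<alpha> by (simp add: divide_neg_pos)
    ultimately show False by linarith
  qed
  then show ?thesis using g by (auto simp: dominant_for_def)
qed

text \<open>Induction on the height. Expanding \<open>\<beta> \<bullet> \<beta> > 0\<close> in
  simple roots yields a simple \<open>\<alpha>\<close> with
  \<open>\<beta> \<bullet> \<alpha> > 0\<close>; its reflection lowers the height and, unless
  \<open>\<beta>\<close> is simple, keeps the root positive.\<close>

lemma pos_root_orbit:
  assumes "\<beta> \<in> pos"
  shows "\<exists>g\<in>refl_group \<Delta>. \<exists>\<alpha>\<in>\<Delta>. \<beta> = g \<alpha>"
  using assms
proof (induction "nat \<lfloor>\<beta> \<bullet> \<rho>\<rfloor>" arbitrary: \<beta> rule: less_induct)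
  case less
  show ?case
  proof (cases "\<beta> \<in> \<Delta>")
    case True
    then show ?thesis by (intro bexI[of _ id] bexI[of _ \<beta>] refl_group_id) auto
  next
    case False
    have "0 < \<beta> \<bullet> \<beta>" using less.prems root_neq_zero pos_root by auto
    then have "\<not> (\<forall>\<alpha>\<in>\<Delta>. (\<beta> \<bullet> dual_basis \<alpha>) * (\<alpha> \<bullet> \<beta>) \<le> 0)"
      using inner_expansion[of \<beta> \<beta>] sum_nonpos[of \<Delta> "\<lambda>\<alpha>. (\<beta> \<bullet> dual_basis \<alpha>) * (\<alpha> \<bullet> \<beta>)"] by auto
    then obtain \<alpha> where \<alpha>: "\<alpha> \<in> \<Delta>" "0 < (\<beta> \<bullet> dual_basis \<alpha>) * (\<alpha> \<bullet> \<beta>)" by force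
    then have "0 < \<beta> \<bullet> \<alpha>"
      using pos_coef[OF less.prems \<alpha>(1)] by (auto simp: inner_commute zero_less_mult_iff)
    let ?\<gamma> = "reflection \<alpha> \<beta>"
    have \<gamma>: "?\<gamma> \<in> pos" using False \<alpha> less.prems by (intro simple_reflection_pos) auto
    have "0 < \<alpha> \<bullet> \<alpha>" using \<alpha> base_roots root_neq_zero by auto
    then have "?\<gamma> \<bullet> \<rho> < \<beta> \<bullet> \<rho>"
      using \<open>0 < \<beta> \<bullet> \<alpha>\<close> \<alpha> by (simp add: reflection_def inner_diff_left base_inner_rho)
    moreover obtain m n where "?\<gamma> \<bullet> \<rho> = of_int m" "\<beta> \<bullet> \<rho> = of_int n"
      using height_int[of ?\<gamma>] height_int[of \<beta>] \<gamma> less.prems pos_root by (auto elim!: Ints_cases)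
    moreover have "0 < ?\<gamma> \<bullet> \<rho>" using \<gamma> by (simp add: pos_def)
    ultimately have "nat \<lfloor>?\<gamma> \<bullet> \<rho>\<rfloor> < nat \<lfloor>\<beta> \<bullet> \<rho>\<rfloor>" by simp
    from less.hyps[OF this \<gamma>] obtain g \<delta> where "g \<in> refl_group \<Delta>" "\<delta> \<in> \<Delta>" "?\<gamma> = g \<delta>" by blast
    moreover from this have "\<beta> = (reflection \<alpha> \<circ> g) \<delta>" by (metis comp_apply reflection_involution)
    moreover have "reflection \<alpha> \<circ> g \<in> refl_group \<Delta>"
      using \<alpha> calculation by (intro refl_group_comp refl_group_reflection)
    ultimately show ?thesis by blast
  qed
qed

lemma root_orbit:
  assumes "\<beta> \<in> \<Phi>"
  shows "\<exists>g\<in>refl_group \<Delta>. \<exists>\<alpha>\<in>\<Delta>. \<beta> = g \<alpha>"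
proof (cases "\<beta> \<in> pos")
  case True then show ?thesis by (rule pos_root_orbit)
next
  case False
  then have "- \<beta> \<in> pos" using not_pos_iff[OF assms] by blast
  then obtain g \<alpha> where *: "g \<in> refl_group \<Delta>" "\<alpha> \<in> \<Delta>" "- \<beta> = g \<alpha>"
    using pos_root_orbit by blast
  then have "\<beta> = (g \<circ> reflection \<alpha>) \<alpha>"
    using linear_neg[OF refl_group_linear[OF *(1)], of \<alpha>] by (simp add: simple_reflection_self) (metis minus_equation_iff)
  moreover have "g \<circ> reflection \<alpha> \<in> refl_group \<Delta>"
    using * by (intro refl_group_comp refl_group_reflection)
  ultimately show ?thesis using * by blast
qed

section \<open>Simple generators, the exchange condition and inversions\<close>

lemma reflection_conj:
  assumes "g \<in> refl_group K"
  shows "reflection (g \<alpha>) = g \<circ> reflection \<alpha> \<circ> finv g"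
proof
  fix v
  show "reflection (g \<alpha>) v = (g \<circ> reflection \<alpha> \<circ> finv g) v"
    using assms linear_diff[OF refl_group_linear[OF assms]] linear_scale[OF refl_group_linear[OF assms]]
    by (simp add: reflection_def refl_group_inner refl_group_adjoint)
qed

lemma W_eq: "W = refl_group \<Delta>"
proof
  show "W \<subseteq> refl_group \<Delta>"
  proof (rule refl_group_subset)
    fix \<beta> assume "\<beta> \<in> \<Phi>"
    then obtain g \<alpha> where "g \<in> refl_group \<Delta>" "\<alpha> \<in> \<Delta>" "\<beta> = g \<alpha>" using root_orbit by blast
    then show "reflection \<beta> \<in> refl_group \<Delta>"
      by (metis reflection_conj refl_group_comp refl_group_inv refl_group_reflection)
  qed
qed (simp add: base_roots refl_group_mono)

text \<open>Reading the word from the right, some letter \<open>a\<close> first turns the image of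
  \<open>\<alpha>\<close> negative. A simple reflection negates only its own root among the positive
  ones, so that image was \<open>a\<close>; hence \<open>reflection a\<close> is the conjugate of
  \<open>reflection \<alpha>\<close> by the tail, and the letter cancels.\<close>

lemma exchange:
  assumes "set xs \<subseteq> \<Delta>" "\<alpha> \<in> \<Delta>" "refls xs \<alpha> \<notin> pos"
  shows "\<exists>ys. set ys \<subseteq> \<Delta> \<and> Suc (length ys) = length xs \<and> refls xs \<circ> reflection \<alpha> = refls ys"
  using assms
proof (induction xs)
  case Nil
  then show ?case using base_pos by auto
next
  case (Cons a as)
  show ?case
  proof (cases "refls as \<alpha> \<in> pos")
    case False
    moreover have "set as \<subseteq> \<Delta>" using Cons.prems by simp
    ultimately obtain ys where ys: "set ys \<subseteq> \<Delta>" "Suc (length ys) = length as"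
        "refls as \<circ> reflection \<alpha> = refls ys"
      using Cons.IH Cons.prems(2) by blast
    have "refls (a # as) \<circ> reflection \<alpha> = refls (a # ys)"
      using ys(3) by (simp add: o_assoc[symmetric])
    moreover have "set (a # ys) \<subseteq> \<Delta>" "Suc (length (a # ys)) = length (a # as)"
      using ys Cons.prems by auto
    ultimately show ?thesis by blast
  next
    case True
    then have eq: "refls as \<alpha> = a"
      using Cons.prems simple_reflection_pos[of a "refls as \<alpha>"] by auto
    have "refls as \<in> refl_group \<Delta>" using Cons.prems by (auto simp: refl_group_def)
    from reflection_conj[OF this, of \<alpha>] have "reflection a = refls as \<circ> reflection \<alpha> \<circ> refls (rev as)"
      by (simp only: eq inv_refls)
    then have "refls (a # as) \<circ> reflection \<alpha> = refls as"
      by (simp add: fun_eq_iff)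
    moreover have "set as \<subseteq> \<Delta>" "Suc (length as) = length (a # as)"
      using Cons.prems by auto
    ultimately show ?thesis by blast
  qed
qed

text \<open>Take a shortest word for \<open>w\<close> and let \<open>a\<close> be its last letter.
  If \<open>w a\<close> were positive, the word without \<open>a\<close> would send \<open>a\<close>
  to a negative root, and the exchange condition would give a shorter word for
  \<open>w\<close>.\<close>

lemma exists_simple_to_negative:
  assumes "w \<in> W" "w \<noteq> id"
  shows "\<exists>\<alpha>\<in>\<Delta>. w \<alpha> \<notin> pos"
proof (rule ccontr)
  assume *: "\<not> ?thesis"
  define P where "P n \<longleftrightarrow> (\<exists>xs. set xs \<subseteq> \<Delta> \<and> refls xs = w \<and> length xs = n)" for n
  have "\<exists>n. P n" using assms(1) W_eq by (auto simp: refl_group_def P_def)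
  then have "P (LEAST n. P n)" by (rule LeastI_ex)
  then obtain xs where xs: "set xs \<subseteq> \<Delta>" "refls xs = w" "length xs = (LEAST n. P n)"
    by (auto simp: P_def)
  have "xs \<noteq> []" using xs assms by auto
  then obtain zs a where zs: "xs = zs @ [a]" by (meson rev_exhaust)
  then have w: "w = refls zs \<circ> reflection a" and a: "a \<in> \<Delta>"
    using xs by (auto simp: refls_append)
  have "w a = - refls zs a"
    using a by (simp add: w simple_reflection_self linear_neg[OF linear_refls])
  moreover have "w a \<in> pos" using * a by blast
  ultimately have "refls zs a \<notin> pos" by (auto simp: pos_def)
  then obtain ys where "set ys \<subseteq> \<Delta>" "Suc (length ys) = length zs" "w = refls ys"
    using exchange[of zs a] xs zs a w by auto
  then have "P (length ys)" "length ys < (LEAST n. P n)" using xs zs by (auto simp: P_def)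
  then show False using not_less_Least by blast
qed

text \<open>The cardinality is the Coxeter length and serves as an induction measure. The inversions
  of the inverse of \<open>u\<close> will turn out to describe the hyperplanes between the
  fundamental chamber and its image under \<open>u\<close>.\<close>

definition inversions :: "('a \<Rightarrow> 'a) \<Rightarrow> 'a set" where
  "inversions w = {\<beta> \<in> pos. w \<beta> \<notin> pos}"

lemma finite_inversions: "finite (inversions w)"
  using finite_roots pos_root by (auto intro: finite_subset[of _ \<Phi>] simp: inversions_def)

text \<open>The simple reflection permutes the positive roots other than \<open>\<alpha>\<close>, so
  the inversions are carried over injectively while \<open>\<alpha>\<close> itself is lost.\<close>

lemma card_inversions_less:
  assumes w: "w \<in> W" and \<alpha>: "\<alpha> \<in> \<Delta>" "w \<alpha> \<notin> pos"
  shows "card (inversions (w \<circ> reflection \<alpha>)) < card (inversions w)"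
proof -
  have "reflection \<alpha> ` inversions (w \<circ> reflection \<alpha>) \<subseteq> inversions w - {\<alpha>}"
  proof
    fix \<gamma> assume "\<gamma> \<in> reflection \<alpha> ` inversions (w \<circ> reflection \<alpha>)"
    then obtain \<beta> where \<beta>: "\<beta> \<in> pos" "w (reflection \<alpha> \<beta>) \<notin> pos" "\<gamma> = reflection \<alpha> \<beta>"
      by (auto simp: inversions_def)
    have "\<beta> \<noteq> \<alpha>"
    proof
      assume "\<beta> = \<alpha>"
      then have "w (reflection \<alpha> \<beta>) = - w \<alpha>"
        using \<alpha> linear_neg[OF refl_group_linear[OF w]] by (simp add: simple_reflection_self)
      moreover have "w \<alpha> \<in> \<Phi>" using w \<alpha> base_roots root_image by blast
      ultimately show False using \<beta> \<alpha> not_pos_iff by simp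
    qed
    moreover have "\<gamma> \<noteq> \<alpha>"
    proof
      assume "\<gamma> = \<alpha>"
      then have "\<beta> = - \<alpha>" using \<beta> \<alpha> by (metis reflection_involution simple_reflection_self)
      then show False using \<beta> \<alpha> base_pos by (auto simp: pos_def base_inner_rho)
    qed
    ultimately show "\<gamma> \<in> inversions w - {\<alpha>}"
      using \<beta> \<alpha> simple_reflection_pos by (auto simp: inversions_def)
  qed
  then have "card (reflection \<alpha> ` inversions (w \<circ> reflection \<alpha>)) \<le> card (inversions w - {\<alpha>})"
    by (intro card_mono) (auto simp: finite_inversions)
  moreover have "inj (reflection \<alpha>)" using bij_reflection bij_is_inj by blast
  moreover have "card (inversions w - {\<alpha>}) < card (inversions w)"
    using \<alpha> base_pos by (intro card_Diff1_less finite_inversions) (auto simp: inversions_def)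
  ultimately show ?thesis by (simp add: card_image inj_on_subset)
qed

lemma dominant_pos: "dominant_for \<Delta> v \<Longrightarrow> \<beta> \<in> pos \<Longrightarrow> 0 \<le> \<beta> \<bullet> v"
  by (subst inner_expansion) (auto simp: dominant_for_def inner_commute intro!: sum_nonneg mult_nonneg_nonneg pos_coef)

text \<open>The closed dominant chamber meets each orbit once, with stabilizers generated by simple
  reflections. If \<open>w \<alpha>\<close> is negative, dominance of \<open>w v\<close> gives
  \<open>v \<bullet> \<alpha> \<le> 0\<close> and dominance of \<open>v\<close> the converse; so
  \<open>reflection \<alpha>\<close> fixes \<open>v\<close> and can be stripped from
  \<open>w\<close>.\<close>

theorem dominant_unique:
  assumes "w \<in> W" "dominant_for \<Delta> v" "dominant_for \<Delta> (w v)"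
  shows "w v = v \<and> w \<in> refl_group {\<alpha> \<in> \<Delta>. v \<bullet> \<alpha> = 0}"
  using assms
proof (induction "card (inversions w)" arbitrary: w rule: less_induct)
  case less
  show ?case
  proof (cases "w = id")
    case True then show ?thesis using refl_group_id by simp
  next
    case False
    then obtain \<alpha> where \<alpha>: "\<alpha> \<in> \<Delta>" "w \<alpha> \<notin> pos" using exists_simple_to_negative less.prems by blast
    let ?u = "w \<circ> reflection \<alpha>"
    have "- w \<alpha> \<in> pos" using \<alpha> less.prems not_pos_iff root_image base_roots by blast
    then have "0 \<le> - w \<alpha> \<bullet> w v" using less.prems dominant_pos by blast
    moreover have "w \<alpha> \<bullet> w v = \<alpha> \<bullet> v" using less.prems refl_group_inner by blast
    moreover have "0 \<le> v \<bullet> \<alpha>" using less.prems \<alpha> by (auto simp: dominant_for_def)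
    ultimately have v: "v \<bullet> \<alpha> = 0" by (simp add: inner_commute)
    then have uv: "?u v = w v" by (simp add: reflection_fixes)
    have u: "?u \<in> W" using less.prems \<alpha> base_roots by (intro refl_group_comp refl_group_reflection) auto
    have "?u v = v \<and> ?u \<in> refl_group {\<alpha> \<in> \<Delta>. v \<bullet> \<alpha> = 0}"
      by (rule less.hyps[OF card_inversions_less[OF less.prems(1) \<alpha>] u less.prems(2)])
        (simp only: uv less.prems(3))
    moreover have "reflection \<alpha> \<in> refl_group {\<alpha> \<in> \<Delta>. v \<bullet> \<alpha> = 0}"
      using \<alpha> v by (intro refl_group_reflection) auto
    ultimately have "?u v = v \<and> ?u \<circ> reflection \<alpha> \<in> refl_group {\<alpha> \<in> \<Delta>. v \<bullet> \<alpha> = 0}"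
      by (metis refl_group_comp)
    moreover have "?u \<circ> reflection \<alpha> = w" by (simp add: fun_eq_iff)
    ultimately show ?thesis unfolding uv by metis
  qed
qed

end

section \<open>Parabolic subgroups and the intersection lattice\<close>

definition perp :: "'a::euclidean_space set \<Rightarrow> 'a set" where
  "perp R = {v. \<forall>\<beta>\<in>R. v \<bullet> \<beta> = 0}"

lemma subspace_perp: "subspace (perp R)"
  by (auto simp: perp_def subspace_def inner_add_left)

text \<open>A real subspace is not a finite union of proper hyperplanes. A point that is generic for
  \<open>R\<close> is corrected for one further vector by a small-generality shift along a direction
  on which that vector does not vanish.\<close>

lemma generic_point:
  assumes "finite R" "subspace X"
  shows "\<exists>v\<in>X. \<forall>\<beta>\<in>R. v \<bullet> \<beta> = 0 \<longrightarrow> (\<forall>u\<in>X. u \<bullet> \<beta> = 0)"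
  using assms(1)
proof (induction R)
  case empty
  then show ?case using subspace_0[OF assms(2)] by auto
next
  case (insert \<beta> R)
  then obtain v where v: "v \<in> X" "\<And>\<gamma>. \<gamma> \<in> R \<Longrightarrow> v \<bullet> \<gamma> = 0 \<Longrightarrow> (\<forall>u\<in>X. u \<bullet> \<gamma> = 0)" by auto
  show ?case
  proof (cases "v \<bullet> \<beta> = 0 \<longrightarrow> (\<forall>u\<in>X. u \<bullet> \<beta> = 0)")
    case True
    then show ?thesis using v by auto
  next
    case False
    then obtain u where u: "u \<in> X" "u \<bullet> \<beta> \<noteq> 0" "v \<bullet> \<beta> = 0" by auto
    \<comment> \<open>These are the shifts to be avoided: a quotient is the shift that would make a
      nonzero pairing with \<open>\<gamma>\<close> vanish, and 0 would leave the pairing with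
      \<open>\<beta>\<close> zero.\<close>
    have "finite (insert 0 ((\<lambda>\<gamma>. - (v \<bullet> \<gamma>) / (u \<bullet> \<gamma>)) ` R))" using insert by auto
    then obtain e :: real where e: "e \<noteq> 0" "e \<notin> (\<lambda>\<gamma>. - (v \<bullet> \<gamma>) / (u \<bullet> \<gamma>)) ` R"
      using ex_new_if_finite[OF infinite_UNIV_char_0] by blast
    have "v \<bullet> \<gamma> = 0" if "\<gamma> \<in> R" "(v + e *\<^sub>R u) \<bullet> \<gamma> = 0" for \<gamma>
    proof (cases "u \<bullet> \<gamma> = 0")
      case True
      then show ?thesis using that by (simp add: inner_add_left)
    next
      case False
      then have "e = - (v \<bullet> \<gamma>) / (u \<bullet> \<gamma>)"
        using that(2) by (simp add: inner_add_left field_simps)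
      then show ?thesis using e that by auto
    qed
    moreover have "v + e *\<^sub>R u \<in> X"
      using u v assms(2) by (simp add: subspace_add subspace_mul)
    moreover have "(v + e *\<^sub>R u) \<bullet> \<beta> \<noteq> 0" using u e by (simp add: inner_add_left)
    ultimately have "\<forall>\<gamma>\<in>insert \<beta> R. (v + e *\<^sub>R u) \<bullet> \<gamma> = 0 \<longrightarrow> (\<forall>u\<in>X. u \<bullet> \<gamma> = 0)"
      using v(2) by blast
    then show ?thesis using \<open>v + e *\<^sub>R u \<in> X\<close> by blast
  qed
qed

lemma card_orbit_times_stabilizer:
  fixes G :: "('a \<Rightarrow> 'a) set"
  assumes fin: "finite G"
    and comp: "\<And>g h. g \<in> G \<Longrightarrow> h \<in> G \<Longrightarrow> g \<circ> h \<in> G"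
    and inv: "\<And>g. g \<in> G \<Longrightarrow> finv g \<in> G"
    and bij: "\<And>g. g \<in> G \<Longrightarrow> bij g"
  shows "card G = card ((\<lambda>g. g ` X) ` G) * card {g \<in> G. g ` X = X}"
proof -
  have "card {g \<in> G. g ` X = Y} = card {g \<in> G. g ` X = X}" if Y_orbit: "Y \<in> (\<lambda>g. g ` X) ` G" for Y
  proof -
    obtain h where h: "h \<in> G" "Y = h ` X" using Y_orbit by blast
    have hh: "finv h \<circ> h = id" "h \<circ> finv h = id"
      using bij[OF h(1)] by (simp_all add: bij_is_inj bij_is_surj flip: surj_iff)
    have Y: "finv h ` Y = X" using h(2) bij[OF h(1)] by (simp add: bij_is_inj image_inv_f_f)
    have "bij_betw (\<lambda>g. h \<circ> g) {g \<in> G. g ` X = X} {g \<in> G. g ` X = Y}"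
    proof (rule bij_betwI[where g = "\<lambda>g. finv h \<circ> g"])
      show "(\<lambda>g. h \<circ> g) \<in> {g \<in> G. g ` X = X} \<rightarrow> {g \<in> G. g ` X = Y}"
        using comp[OF h(1)] h(2) by (simp only: Pi_iff mem_Collect_eq image_comp[symmetric]) simp
      show "(\<lambda>g. finv h \<circ> g) \<in> {g \<in> G. g ` X = Y} \<rightarrow> {g \<in> G. g ` X = X}"
        using comp[OF inv[OF h(1)]] Y by (simp only: Pi_iff mem_Collect_eq image_comp[symmetric]) simp
    qed (simp_all only: o_assoc hh id_comp)
    from bij_betw_same_card[OF this] show ?thesis by (rule sym)
  qed
  then have "(\<Sum>Y\<in>(\<lambda>g. g ` X) ` G. card {g \<in> G. g ` X = Y}) =
      (\<Sum>Y\<in>(\<lambda>g. g ` X) ` G. card {g \<in> G. g ` X = X})"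
    by (intro sum.cong) auto
  moreover have "card G = (\<Sum>Y\<in>(\<lambda>g. g ` X) ` G. card {g \<in> G. g ` X = Y})"
    using sum.image_gen[OF fin, of "\<lambda>_. 1::nat" "\<lambda>g. g ` X"] by simp
  ultimately show ?thesis by simp
qed

context based_root_system
begin

text \<open>For \<open>K \<subseteq> \<Delta>\<close> this is the parabolic subsystem, the roots in
  the span of \<open>K\<close>, encoded by vanishing of the remaining coefficients.\<close>

definition levi :: "'a set \<Rightarrow> 'a set" where
  "levi K = {\<beta> \<in> \<Phi>. \<forall>\<alpha>\<in>\<Delta> - K. \<beta> \<bullet> dual_basis \<alpha> = 0}"

lemma levi_roots: "levi K \<subseteq> \<Phi>"
  by (auto simp: levi_def)

lemma levi_expansion:
  assumes "K \<subseteq> \<Delta>" "\<beta> \<in> levi K"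
  shows "\<beta> \<bullet> v = (\<Sum>\<alpha>\<in>K. (\<beta> \<bullet> dual_basis \<alpha>) * (\<alpha> \<bullet> v))"
proof -
  have "(\<Sum>\<alpha>\<in>K. (\<beta> \<bullet> dual_basis \<alpha>) * (\<alpha> \<bullet> v)) = (\<Sum>\<alpha>\<in>\<Delta>. (\<beta> \<bullet> dual_basis \<alpha>) * (\<alpha> \<bullet> v))"
    using assms finite_base by (intro sum.mono_neutral_left) (auto simp: levi_def)
  then show ?thesis using inner_expansion[of \<beta> v] by simp
qed

lemma subbase_levi: "K \<subseteq> \<Delta> \<Longrightarrow> K \<subseteq> levi K"
  using base_roots by (auto simp: levi_def inner_base_dual_basis)

lemma levi_base: "K \<subseteq> \<Delta> \<Longrightarrow> \<alpha> \<in> levi K \<Longrightarrow> \<alpha> \<in> \<Delta> \<Longrightarrow> \<alpha> \<in> K"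
  by (auto simp: levi_def inner_base_dual_basis) (metis DiffI zero_neq_one)

text \<open>A concrete point of the open face of \<open>K\<close>. Being dominant with exactly the
  zeros prescribed by \<open>K\<close>, it can stand for the whole face in stabilizer
  arguments.\<close>

definition face_point :: "'a set \<Rightarrow> 'a" where
  "face_point K = (\<Sum>\<alpha>\<in>\<Delta> - K. dual_basis \<alpha>)"

lemma base_inner_face_point: "\<alpha> \<in> \<Delta> \<Longrightarrow> \<alpha> \<bullet> face_point K = (if \<alpha> \<in> K then 0 else 1)"
  by (simp add: face_point_def inner_sum_right inner_base_dual_basis finite_base)

lemma face_point_in: "K \<subseteq> \<Delta> \<Longrightarrow> face_point K \<in> standard_face \<Delta> K"
  by (auto simp: standard_face_def inner_commute[of "face_point K"] base_inner_face_point)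

lemma standard_face_subset_perp: "standard_face \<Delta> K \<subseteq> perp K"
  by (auto simp: standard_face_def perp_def)

lemma standard_face_dominant:
  assumes "v \<in> standard_face \<Delta> K"
  shows "dominant_for \<Delta> v"
  unfolding dominant_for_def
proof
  fix \<alpha> assume "\<alpha> \<in> \<Delta>"
  with assms show "0 \<le> v \<bullet> \<alpha>"
    by (cases "\<alpha> \<in> K") (simp_all add: standard_face_def less_imp_le)
qed

lemma standard_face_zeros:
  assumes "K \<subseteq> \<Delta>" "v \<in> standard_face \<Delta> K"
  shows "{\<alpha> \<in> \<Delta>. v \<bullet> \<alpha> = 0} = K"
proof (intro equalityI subsetI)
  fix \<alpha> assume \<alpha>: "\<alpha> \<in> {\<alpha> \<in> \<Delta>. v \<bullet> \<alpha> = 0}"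
  show "\<alpha> \<in> K"
  proof (rule ccontr)
    assume "\<alpha> \<notin> K"
    then have "\<alpha> \<in> \<Delta> - K" using \<alpha> by simp
    then have "0 < v \<bullet> \<alpha>" using assms(2) by (simp add: standard_face_def)
    then show False using \<alpha> by simp
  qed
qed (use assms in \<open>auto simp: standard_face_def\<close>)

lemma dominant_standard_face: "dominant_for \<Delta> v \<Longrightarrow> v \<in> standard_face \<Delta> {\<alpha> \<in> \<Delta>. v \<bullet> \<alpha> = 0}"
  by (auto simp: standard_face_def dominant_for_def less_le)

text \<open>Each term of the expansion of \<open>x \<bullet> v\<close> in simple roots is
  nonnegative, so a zero sum kills every term.\<close>

lemma pos_inner_zero_coef:
  assumes "\<And>\<alpha>. \<alpha> \<in> \<Delta> \<Longrightarrow> 0 \<le> x \<bullet> dual_basis \<alpha>" "dominant_for \<Delta> v" "x \<bullet> v = 0"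
    "\<alpha> \<in> \<Delta>" "v \<bullet> \<alpha> \<noteq> 0"
  shows "x \<bullet> dual_basis \<alpha> = 0"
proof -
  have "(\<Sum>\<gamma>\<in>\<Delta>. (x \<bullet> dual_basis \<gamma>) * (\<gamma> \<bullet> v)) = 0"
    using assms(3) inner_expansion[of x v] by simp
  then have "(x \<bullet> dual_basis \<alpha>) * (\<alpha> \<bullet> v) = 0"
    using sum_nonneg_eq_0_iff[OF finite_base, of "\<lambda>\<gamma>. (x \<bullet> dual_basis \<gamma>) * (\<gamma> \<bullet> v)"] assms
    by (auto simp: dominant_for_def inner_commute)
  then show ?thesis using assms(5) by (simp add: inner_commute)
qed

text \<open>The converse applies \<open>pos_inner_zero_coef\<close> to whichever of
  \<open>\<beta>\<close> and \<open>- \<beta>\<close> is positive. One point of the open face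
  therefore detects the whole subsystem.\<close>

lemma levi_iff:
  assumes K: "K \<subseteq> \<Delta>" and v: "v \<in> standard_face \<Delta> K" and \<beta>: "\<beta> \<in> \<Phi>"
  shows "\<beta> \<in> levi K \<longleftrightarrow> \<beta> \<bullet> v = 0"
proof
  assume "\<beta> \<in> levi K"
  then have "\<beta> \<bullet> v = (\<Sum>\<alpha>\<in>K. (\<beta> \<bullet> dual_basis \<alpha>) * (\<alpha> \<bullet> v))" by (rule levi_expansion[OF K])
  also have "\<dots> = 0" using v by (intro sum.neutral) (auto simp: standard_face_def inner_commute)
  finally show "\<beta> \<bullet> v = 0" .
next
  assume 0: "\<beta> \<bullet> v = 0"
  have "\<beta> \<bullet> dual_basis \<alpha> = 0" if \<alpha>: "\<alpha> \<in> \<Delta> - K" for \<alpha>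
  proof -
    have nz: "v \<bullet> \<alpha> \<noteq> 0" using \<alpha> v by (force simp: standard_face_def)
    have dom: "dominant_for \<Delta> v" using standard_face_dominant v by blast
    show ?thesis
    proof (cases "\<beta> \<in> pos")
      case True
      then show ?thesis using pos_inner_zero_coef[of \<beta> v \<alpha>] pos_coef dom 0 \<alpha> nz by simp
    next
      case False
      then have "- \<beta> \<in> pos" using \<beta> not_pos_iff by simp
      then show ?thesis using pos_inner_zero_coef[of "- \<beta>" v \<alpha>] pos_coef[of "- \<beta>"] dom 0 \<alpha> nz by simp
    qed
  qed
  then show "\<beta> \<in> levi K" using \<beta> by (auto simp: levi_def)
qed

lemma levi_iff_perp:
  assumes "K \<subseteq> \<Delta>" "\<beta> \<in> \<Phi>"
  shows "\<beta> \<in> levi K \<longleftrightarrow> (\<forall>v\<in>perp K. v \<bullet> \<beta> = 0)"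
proof
  assume *: "\<beta> \<in> levi K"
  show "\<forall>v\<in>perp K. v \<bullet> \<beta> = 0"
    using levi_expansion[OF assms(1) *] by (auto simp: perp_def inner_commute intro!: sum.neutral)
next
  assume "\<forall>v\<in>perp K. v \<bullet> \<beta> = 0"
  then have "\<beta> \<bullet> face_point K = 0"
    using face_point_in[OF assms(1)] standard_face_subset_perp inner_commute by (metis subsetD)
  then show "\<beta> \<in> levi K" using levi_iff face_point_in assms by blast
qed

lemma refl_group_fixes_perp: "g \<in> refl_group K \<Longrightarrow> v \<in> perp K \<Longrightarrow> g v = v"
  by (induction rule: refl_group_induct) (auto simp: perp_def reflection_fixes)

lemma stabilizer_face_point:
  assumes "K \<subseteq> \<Delta>" "v \<in> standard_face \<Delta> K" "w \<in> W" "dominant_for \<Delta> (w v)"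
  shows "w v = v" "w \<in> refl_group K"
  using dominant_unique[OF assms(3) standard_face_dominant[OF assms(2)] assms(4)]
  unfolding standard_face_zeros[OF assms(1,2)] by blast+

text \<open>Fixing the single point \<open>face_point K\<close> already forces an element into the
  parabolic subgroup, by the stabilizer statement for dominant vectors. This makes a parabolic
  subgroup recoverable from its fixed space.\<close>

lemma refl_group_eq_fixer:
  assumes "K \<subseteq> \<Delta>"
  shows "refl_group K = {w \<in> W. \<forall>v\<in>perp K. w v = v}"
proof -
  have "w \<in> refl_group K" if "w \<in> W" "\<forall>v\<in>perp K. w v = v" for w
    using that stabilizer_face_point(2)[OF assms face_point_in[OF assms]]
      standard_face_subset_perp face_point_in[OF assms] standard_face_dominant
    by (metis subsetD)
  then show ?thesis using refl_group_fixes_perp subgroup_W[OF assms] by blast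
qed

text \<open>The group of \<open>K\<close> fixes \<open>face_point K\<close>, and a positive root
  outside the subsystem pairs strictly positively with that point. The pairing is unchanged by
  \<open>g\<close> and determines the sign of \<open>g \<beta>\<close>.\<close>

lemma pos_outside_levi:
  assumes K: "K \<subseteq> \<Delta>" and g: "g \<in> refl_group K" and \<beta>: "\<beta> \<in> pos" "\<beta> \<notin> levi K"
  shows "g \<beta> \<in> pos"
proof -
  let ?v = "face_point K"
  have v: "?v \<in> standard_face \<Delta> K" by (rule face_point_in[OF K])
  then have dom: "dominant_for \<Delta> ?v" by (rule standard_face_dominant)
  have gW: "g \<in> W" using subgroup_W K g by blast
  have "0 \<le> \<beta> \<bullet> ?v" "\<beta> \<bullet> ?v \<noteq> 0"
    using dominant_pos[OF dom \<beta>(1)] levi_iff[OF K v] \<beta> pos_root by auto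
  moreover have "g \<beta> \<bullet> ?v = \<beta> \<bullet> ?v"
    using refl_group_fixes_perp[OF g, of ?v] refl_group_inner[OF g, of \<beta> ?v] v
      standard_face_subset_perp[of K] by auto
  ultimately have "0 < g \<beta> \<bullet> ?v" by simp
  moreover have "0 \<le> - g \<beta> \<bullet> ?v" if "- g \<beta> \<in> pos" using dominant_pos[OF dom that] .
  ultimately show ?thesis using not_pos_iff[of "g \<beta>"] root_image[OF gW] \<beta> pos_root by force
qed

text \<open>The height of \<open>w \<beta>\<close> is a nonnegative combination of the heights of
  the positive roots \<open>w \<alpha>\<close> for \<open>\<alpha>\<close> in \<open>K\<close>, and
  a root never has height 0.\<close>

lemma pos_inside_levi:
  assumes K: "K \<subseteq> \<Delta>" and w: "w \<in> W" "w ` K \<subseteq> pos" and \<beta>: "\<beta> \<in> pos" "\<beta> \<in> levi K"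
  shows "w \<beta> \<in> pos"
proof -
  have "finv w \<rho> \<bullet> \<alpha> = \<rho> \<bullet> w \<alpha>" for \<alpha> using w by (simp add: refl_group_adjoint)
  then have "w \<beta> \<bullet> \<rho> = (\<Sum>\<alpha>\<in>K. (\<beta> \<bullet> dual_basis \<alpha>) * (w \<alpha> \<bullet> \<rho>))"
    using levi_expansion[OF K \<beta>(2), of "finv w \<rho>"] by (simp add: inner_commute)
  also have "\<dots> \<ge> 0"
    using w \<beta> K pos_coef by (intro sum_nonneg mult_nonneg_nonneg) (auto simp: pos_def)
  finally have "0 \<le> w \<beta> \<bullet> \<rho>" .
  moreover have "w \<beta> \<in> \<Phi>" using w \<beta> root_image pos_root by blast
  ultimately show ?thesis using root_height_neq_zero by (force simp: pos_def)
qed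

text \<open>The coefficients are nonnegative integers, so a sum of at most 1 leaves a single
  coefficient equal to 1.\<close>

lemma pos_height_one:
  assumes \<beta>: "\<beta> \<in> pos" "\<beta> \<bullet> \<rho> \<le> 1"
  shows "\<beta> \<in> \<Delta>"
proof -
  have "\<exists>\<alpha>\<in>\<Delta>. \<beta> \<bullet> dual_basis \<alpha> \<noteq> 0"
    using \<beta> by (auto simp: pos_def inner_rho) (metis less_irrefl sum.neutral)
  then obtain \<alpha> where \<alpha>: "\<alpha> \<in> \<Delta>" "\<beta> \<bullet> dual_basis \<alpha> \<noteq> 0" by blast
  obtain k :: int where k: "\<beta> \<bullet> dual_basis \<alpha> = of_int k"
    using coef_int[of \<beta> \<alpha>] \<beta> \<alpha> pos_root by (auto elim!: Ints_cases)
  have "0 \<le> \<beta> \<bullet> dual_basis \<alpha>" using pos_coef \<beta> \<alpha> by blast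
  then have k1: "1 \<le> k" using k \<alpha> by simp
  have "\<beta> \<bullet> \<rho> = of_int k + (\<Sum>\<gamma>\<in>\<Delta> - {\<alpha>}. \<beta> \<bullet> dual_basis \<gamma>)"
    unfolding inner_rho k[symmetric] by (rule sum.remove[OF finite_base \<alpha>(1)])
  moreover have nn: "0 \<le> \<beta> \<bullet> dual_basis \<gamma>" if "\<gamma> \<in> \<Delta> - {\<alpha>}" for \<gamma> using that pos_coef \<beta> by blast
  then have "0 \<le> (\<Sum>\<gamma>\<in>\<Delta> - {\<alpha>}. \<beta> \<bullet> dual_basis \<gamma>)" by (rule sum_nonneg)
  moreover have "1 \<le> real_of_int k" using k1 by simp
  ultimately have "k = 1" "(\<Sum>\<gamma>\<in>\<Delta> - {\<alpha>}. \<beta> \<bullet> dual_basis \<gamma>) = 0" using \<beta>(2) by linarith+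
  then have "\<forall>\<gamma>\<in>\<Delta> - {\<alpha>}. \<beta> \<bullet> dual_basis \<gamma> = 0"
    using nn finite_base by (subst (asm) sum_nonneg_eq_0_iff) auto
  then have "(\<Sum>\<gamma>\<in>\<Delta>. (\<beta> \<bullet> dual_basis \<gamma>) *\<^sub>R \<gamma>) = (\<beta> \<bullet> dual_basis \<alpha>) *\<^sub>R \<alpha>"
    by (subst sum.remove[OF finite_base \<alpha>(1)]) (auto intro!: sum.neutral)
  then have "\<beta> = \<alpha>" using base_expansion[of \<beta>] k \<open>k = 1\<close> by simp
  then show ?thesis using \<alpha> by simp
qed

text \<open>Each \<open>g \<alpha>\<close> with \<open>\<alpha>\<close> in \<open>K\<close> has
  height at least 1, the height of \<open>\<alpha>\<close>, so \<open>g\<close> cannot lower the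
  height of a positive root of the subsystem. If the image is simple, the root itself has height
  1.\<close>

lemma simple_preimage:
  assumes K: "K \<subseteq> \<Delta>" and g: "g \<in> W" "g ` K \<subseteq> pos" and \<delta>: "\<delta> \<in> pos" "\<delta> \<in> levi K" "g \<delta> \<in> \<Delta>"
  shows "\<delta> \<in> K"
proof -
  have "finv g \<rho> \<bullet> \<alpha> = \<rho> \<bullet> g \<alpha>" for \<alpha> using g by (simp add: refl_group_adjoint)
  then have "g \<delta> \<bullet> \<rho> = (\<Sum>\<alpha>\<in>K. (\<delta> \<bullet> dual_basis \<alpha>) * (g \<alpha> \<bullet> \<rho>))"
    using levi_expansion[OF K \<delta>(2), of "finv g \<rho>"] by (simp add: inner_commute)
  also have "\<dots> \<ge> (\<Sum>\<alpha>\<in>K. (\<delta> \<bullet> dual_basis \<alpha>) * (\<alpha> \<bullet> \<rho>))"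
  proof (rule sum_mono, rule mult_left_mono)
    fix \<alpha> assume "\<alpha> \<in> K"
    then show "\<alpha> \<bullet> \<rho> \<le> g \<alpha> \<bullet> \<rho>" "0 \<le> \<delta> \<bullet> dual_basis \<alpha>"
      using K g \<delta> pos_height[of "g \<alpha>"] pos_coef base_inner_rho[of \<alpha>] by (auto simp: subset_iff)
  qed
  finally have "\<delta> \<bullet> \<rho> \<le> g \<delta> \<bullet> \<rho>" using levi_expansion[OF K \<delta>(2), of \<rho>] by simp
  then have "\<delta> \<in> \<Delta>" using \<delta> pos_height_one by (simp add: base_inner_rho)
  then show ?thesis using levi_base K \<delta> by blast
qed

section \<open>Conjugate parabolic subgroups, normalizers and flats\<close>

lemma image_perp:
  assumes "w \<in> W"
  shows "w ` perp R = perp (w ` R)"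
proof -
  have "v \<in> w ` perp R" if "v \<in> perp (w ` R)" for v
  proof (rule image_eqI)
    show "v = w (finv w v)" using assms by simp
    show "finv w v \<in> perp R" using that assms by (auto simp: perp_def refl_group_adjoint)
  qed
  then show ?thesis using assms by (auto simp: perp_def refl_group_inner)
qed

text \<open>Equal flats match the subsystems of \<open>K\<close> and \<open>J\<close> but not
  necessarily their bases. Composing \<open>w\<close> with an element of the group of
  \<open>J\<close>, which acts trivially on \<open>perp J\<close>, makes positive roots of the two
  subsystems correspond; simple roots then correspond by \<open>simple_preimage\<close> in both
  directions.\<close>

lemma conjugate_if_perp_image:
  assumes K: "K \<subseteq> \<Delta>" and J: "J \<subseteq> \<Delta>" and w: "w \<in> W" "w ` perp K = perp J"
  shows "\<exists>g\<in>W. g ` K = J"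
proof -
  \<comment> \<open>\<open>J\<close>-dominance of \<open>g \<rho>\<close>, for the composite
    \<open>g\<close> below, says that a positive root of the subsystem of \<open>J\<close> pulled
    back by \<open>g\<close> has nonnegative height.\<close>
  obtain u where u: "u \<in> refl_group J" "dominant_for J (u (w \<rho>))" using exists_dominant[OF J] by blast
  define g where "g = u \<circ> w"
  have g: "g \<in> W" unfolding g_def using u w subgroup_W[OF J] refl_group_comp by blast
  have "u ` perp J = perp J" using refl_group_fixes_perp[OF u(1)] by force
  then have gperp: "g ` perp K = perp J" unfolding g_def image_comp[symmetric] w(2) .
  have levi_g: "g \<beta> \<in> levi J \<longleftrightarrow> \<beta> \<in> levi K" if "\<beta> \<in> \<Phi>" for \<beta>
  proof -
    have "(\<forall>v\<in>perp J. v \<bullet> g \<beta> = 0) \<longleftrightarrow> (\<forall>v\<in>perp K. g v \<bullet> g \<beta> = 0)"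
      unfolding gperp[symmetric] by blast
    then show ?thesis using that g root_image by (simp add: levi_iff_perp K J refl_group_inner)
  qed
  have pos_inv: "finv g \<gamma> \<in> pos" if "\<gamma> \<in> pos" "\<gamma> \<in> levi J" for \<gamma>
  proof -
    have "\<gamma> \<bullet> g \<rho> = (\<Sum>\<alpha>\<in>J. (\<gamma> \<bullet> dual_basis \<alpha>) * (\<alpha> \<bullet> g \<rho>))" by (rule levi_expansion[OF J that(2)])
    also have "\<dots> \<ge> 0"
      using u J that pos_coef by (intro sum_nonneg mult_nonneg_nonneg) (auto simp: dominant_for_def g_def inner_commute)
    finally have "0 \<le> finv g \<gamma> \<bullet> \<rho>" using g by (simp add: refl_group_adjoint)
    moreover have "finv g \<gamma> \<in> \<Phi>" using g that pos_root root_image refl_group_inv by blast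
    ultimately show ?thesis using root_height_neq_zero by (force simp: pos_def)
  qed
  have gK: "g ` K \<subseteq> pos"
  proof
    fix \<gamma> assume "\<gamma> \<in> g ` K"
    then obtain \<alpha> where \<alpha>: "\<alpha> \<in> K" "\<gamma> = g \<alpha>" by blast
    have r: "\<alpha> \<in> \<Phi>" "\<alpha> \<in> levi K" using \<alpha> K base_roots subbase_levi by blast+
    show "\<gamma> \<in> pos"
    proof (rule ccontr)
      assume "\<gamma> \<notin> pos"
      then have "- \<gamma> \<in> pos" using \<alpha> r root_image[OF g] not_pos_iff by blast
      moreover have "- \<gamma> \<in> levi J" using levi_g[OF r(1)] r(2) \<alpha>(2) by (simp add: levi_def)
      ultimately have "finv g (- \<gamma>) \<in> pos" by (rule pos_inv)
      moreover have "finv g (- \<gamma>) = - \<alpha>"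
        using \<alpha>(2) linear_neg[OF refl_group_linear[OF g], of \<alpha>] refl_group_inverse(2)[OF g, of "- \<alpha>"] by simp
      moreover have "0 < \<alpha> \<bullet> \<rho>" using \<alpha> K base_inner_rho by auto
      ultimately show False by (simp add: pos_def)
    qed
  qed
  have "finv g \<gamma> \<in> K" if "\<gamma> \<in> J" for \<gamma>
  proof (rule simple_preimage[OF K g gK])
    show *: "finv g \<gamma> \<in> pos" using that J base_pos subbase_levi[OF J] by (intro pos_inv) auto
    show "finv g \<gamma> \<in> levi K"
      using levi_g[OF pos_root[OF *]] that subbase_levi[OF J] g by auto
    show "g (finv g \<gamma>) \<in> \<Delta>" using that J g by auto
  qed
  moreover have "g \<alpha> \<in> J" if "\<alpha> \<in> K" for \<alpha>
  proof (rule simple_preimage[OF J refl_group_inv[OF g]])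
    show "finv g ` J \<subseteq> pos" using pos_inv J base_pos subbase_levi[OF J] by auto
    show "g \<alpha> \<in> pos" using gK that by blast
    show "g \<alpha> \<in> levi J" using levi_g[of \<alpha>] that K base_roots subbase_levi[OF K] by blast
    show "finv g (g \<alpha>) \<in> \<Delta>" using that K g by auto
  qed
  ultimately have "g ` K = J" using refl_group_inverse(1)[OF g] by (metis image_eqI image_subsetI subsetI subset_antisym)
  then show ?thesis using g by blast
qed

text \<open>Membership in \<open>\<lambda>(K)\<close> becomes a condition on flats, which allows the
  final summation to be regrouped by flats.\<close>

lemma conjugate_subsets_eq:
  assumes "K \<subseteq> \<Delta>"
  shows "conjugate_subsets \<Phi> \<Delta> K = {J. J \<subseteq> \<Delta> \<and> (\<exists>w\<in>W. w ` perp K = perp J)}"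
  using conjugate_if_perp_image[OF assms]
  by (auto simp: conjugate_subsets_def carrier_weyl_group image_perp)

lemma fixed_space_parabolic: "K \<subseteq> \<Delta> \<Longrightarrow> fixed_space (parabolic \<Phi> K) = perp K"
  unfolding parabolic_eq[OF subbase_roots] perp_def
  by (rule fixed_space_refl_group) (use base_roots zero_not_root in blast)

text \<open>Conjugation by \<open>g\<close> moves the fixed space by \<open>g\<close>, which gives
  one direction. The other holds because the parabolic subgroup is the full pointwise fixer of its
  fixed space.\<close>

lemma normalizer_parabolic:
  assumes K: "K \<subseteq> \<Delta>"
  shows "normalizer (weyl_group \<Phi>) (parabolic \<Phi> K) = {w \<in> W. w ` perp K = perp K}"
proof -
  let ?H = "refl_group K"
  have perp_eq: "perp K = fixed_space ?H"
    unfolding parabolic_eq[OF subbase_roots[OF K], symmetric] fixed_space_parabolic[OF K] ..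
  have fixI: "v \<in> perp K" if "\<And>h. h \<in> ?H \<Longrightarrow> h v = v" for v
    unfolding perp_eq fixed_space_def using that by simp
  have fixD: "h v = v" if "h \<in> ?H" "v \<in> perp K" for h v
    using that by (rule refl_group_fixes_perp)
  have HI: "h \<in> ?H" if "h \<in> W" "\<And>v. v \<in> perp K \<Longrightarrow> h v = v" for h
    unfolding refl_group_eq_fixer[OF K] using that by simp
  have "(\<lambda>h. g \<circ> h \<circ> finv g) ` ?H = ?H \<longleftrightarrow> g ` perp K = perp K" if g: "g \<in> W" for g
  proof
    assume eq: "(\<lambda>h. g \<circ> h \<circ> finv g) ` ?H = ?H"
    have 1: "g v \<in> perp K" if v: "v \<in> perp K" for v
    proof (rule fixI)
      fix h assume "h \<in> ?H"
      then obtain h' where h': "h' \<in> ?H" "h = g \<circ> h' \<circ> finv g" using eq by blast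
      have "h' v = v" using h'(1) v by (rule fixD)
      then show "h (g v) = g v" using g by (simp add: h'(2))
    qed
    have 2: "finv g v \<in> perp K" if v: "v \<in> perp K" for v
    proof (rule fixI)
      fix h assume "h \<in> ?H"
      then have "g \<circ> h \<circ> finv g \<in> ?H" using eq by blast
      then have "(g \<circ> h \<circ> finv g) v = v" using v by (rule fixD)
      then show "h (finv g v) = finv g v" using g by (metis comp_apply refl_group_inverse(2))
    qed
    show "g ` perp K = perp K"
    proof (intro equalityI subsetI)
      fix v assume "v \<in> perp K"
      then show "v \<in> g ` perp K" using 2 g by (intro image_eqI[of _ _ "finv g v"]) auto
    qed (use 1 in blast)
  next
    assume eq: "g ` perp K = perp K"
    have 1: "finv g v \<in> perp K" if v: "v \<in> perp K" for v
    proof -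
      obtain u where "u \<in> perp K" "v = g u" using v eq by blast
      then show ?thesis using g by simp
    qed
    have in1: "g \<circ> h \<circ> finv g \<in> ?H" if "h \<in> ?H" for h
    proof -
      have "g \<circ> h \<circ> finv g \<in> W" using subgroup_W[OF K that] refl_group_inv[OF g] g by (intro refl_group_comp)
      moreover have "(g \<circ> h \<circ> finv g) v = v" if "v \<in> perp K" for v
      proof -
        have "h (finv g v) = finv g v" by (rule fixD[OF \<open>h \<in> ?H\<close> 1[OF that]])
        then show ?thesis using g by simp
      qed
      ultimately show ?thesis by (rule HI)
    qed
    have in2: "finv g \<circ> h \<circ> g \<in> ?H" if "h \<in> ?H" for h
    proof -
      have "finv g \<circ> h \<circ> g \<in> W" using subgroup_W[OF K that] refl_group_inv[OF g] g by (intro refl_group_comp)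
      moreover have "(finv g \<circ> h \<circ> g) v = v" if "v \<in> perp K" for v
      proof -
        have "g v \<in> perp K" using that eq by blast
        then have "h (g v) = g v" by (rule fixD[OF \<open>h \<in> ?H\<close>])
        then show ?thesis using g by simp
      qed
      ultimately show ?thesis by (rule HI)
    qed
    show "(\<lambda>h. g \<circ> h \<circ> finv g) ` ?H = ?H"
    proof (intro equalityI subsetI)
      fix h assume "h \<in> ?H"
      then have "finv g \<circ> h \<circ> g \<in> ?H" by (rule in2)
      moreover have "h = g \<circ> (finv g \<circ> h \<circ> g) \<circ> finv g" using g by (simp add: fun_eq_iff)
      ultimately show "h \<in> (\<lambda>h. g \<circ> h \<circ> finv g) ` ?H" by (intro image_eqI)
    qed (use in1 in blast)
  qed
  then show ?thesis
    unfolding parabolic_eq[OF subbase_roots[OF K]]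
      normalizer_weyl_group[OF refl_group_mono[OF subbase_roots[OF K]]]
    by (simp cong: conj_cong)
qed

text \<open>A generic point of a flat lies on no root hyperplane except those containing the flat.
  Moving it to a dominant point turns these roots into a standard subsystem, which cuts out some
  \<open>perp K\<close>.\<close>

lemma intersection_lattice_eq:
  "intersection_lattice (root_arrangement \<Phi>) = {w ` perp K | w K. w \<in> W \<and> K \<subseteq> \<Delta>}"
proof (intro equalityI subsetI)
  fix X assume "X \<in> {w ` perp K | w K. w \<in> W \<and> K \<subseteq> \<Delta>}"
  then obtain w K where wK: "w \<in> W" "K \<subseteq> \<Delta>" "X = perp (w ` K)" using image_perp by auto
  then have "X = \<Inter>((\<lambda>\<beta>. {v. v \<bullet> \<beta> = 0}) ` w ` K)" by (auto simp: perp_def)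
  moreover have "w ` K \<subseteq> \<Phi>" using wK root_image base_roots by blast
  then have "(\<lambda>\<beta>. {v. v \<bullet> \<beta> = 0}) ` w ` K \<subseteq> root_arrangement \<Phi>"
    unfolding root_arrangement_def by blast
  ultimately show "X \<in> intersection_lattice (root_arrangement \<Phi>)"
    unfolding intersection_lattice_def by blast
next
  fix X assume "X \<in> intersection_lattice (root_arrangement \<Phi>)"
  then obtain B where B: "B \<subseteq> root_arrangement \<Phi>" "X = \<Inter>B" by (auto simp: intersection_lattice_def)
  have X: "X = perp {\<beta> \<in> \<Phi>. {v. v \<bullet> \<beta> = 0} \<in> B}"
    using B(1) by (fastforce simp: B(2) perp_def root_arrangement_def)
  have "subspace X" by (subst X) (rule subspace_perp)
  from generic_point[OF finite_roots this]
  obtain v where v: "v \<in> X" "\<forall>\<beta>\<in>\<Phi>. v \<bullet> \<beta> = 0 \<longrightarrow> (\<forall>u\<in>X. u \<bullet> \<beta> = 0)" by blast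
  have Xv: "X = perp {\<beta> \<in> \<Phi>. v \<bullet> \<beta> = 0}"
  proof (intro equalityI subsetI)
    fix u assume "u \<in> X"
    then show "u \<in> perp {\<beta> \<in> \<Phi>. v \<bullet> \<beta> = 0}" using v(2) by (simp add: perp_def)
  next
    fix u assume u: "u \<in> perp {\<beta> \<in> \<Phi>. v \<bullet> \<beta> = 0}"
    have "v \<bullet> \<beta> = 0" if "\<beta> \<in> \<Phi>" "{v. v \<bullet> \<beta> = 0} \<in> B" for \<beta>
      using that v(1) B(2) by blast
    then have "u \<in> perp {\<beta> \<in> \<Phi>. {v. v \<bullet> \<beta> = 0} \<in> B}" using u by (simp add: perp_def)
    then show "u \<in> X" using X by simp
  qed
  obtain w where w: "w \<in> W" "dominant_for \<Delta> (w v)" using exists_dominant[of \<Delta> v] W_eq by auto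
  define K where "K = {\<alpha> \<in> \<Delta>. w v \<bullet> \<alpha> = 0}"
  have K: "K \<subseteq> \<Delta>" by (auto simp: K_def)
  have wv: "w v \<in> standard_face \<Delta> K" unfolding K_def using w by (intro dominant_standard_face)
  have "w ` {\<beta> \<in> \<Phi>. v \<bullet> \<beta> = 0} = {\<beta> \<in> \<Phi>. w v \<bullet> \<beta> = 0}"
  proof (intro equalityI subsetI)
    fix \<beta> assume \<beta>: "\<beta> \<in> {\<beta> \<in> \<Phi>. w v \<bullet> \<beta> = 0}"
    then have "finv w \<beta> \<in> {\<beta> \<in> \<Phi>. v \<bullet> \<beta> = 0}"
      using w root_image refl_group_inv[OF w(1)] refl_group_adjoint'[OF w(1)] by auto
    then show "\<beta> \<in> w ` {\<beta> \<in> \<Phi>. v \<bullet> \<beta> = 0}" using w by (intro image_eqI[of _ _ "finv w \<beta>"]) auto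
  qed (use root_image[OF w(1)] refl_group_inner[OF w(1)] in auto)
  also have "\<dots> = levi K" using levi_iff[OF K wv] levi_roots by (auto simp: inner_commute)
  finally have "w ` X = perp (levi K)" unfolding Xv image_perp[OF w(1)] by simp
  also have "\<dots> = perp K"
    using subbase_levi[OF K] levi_iff_perp[OF K] levi_roots by (force simp: perp_def)
  finally have "X = finv w ` perp K" using w by (metis image_inv_f_f refl_group_bij bij_is_inj)
  then show "X \<in> {w ` perp K | w K. w \<in> W \<and> K \<subseteq> \<Delta>}" using K w refl_group_inv by blast
qed

lemma dim_perp:
  assumes "K \<subseteq> \<Delta>"
  shows "dim (perp K) = card (\<Delta> - K)"
proof -
  have "perp K = {y \<in> UNIV. \<forall>x\<in>span K. orthogonal x y}"
  proof -
    have "\<forall>x\<in>span K. orthogonal x y" if "y \<in> perp K" for y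
    proof
      fix x assume "x \<in> span K"
      then show "orthogonal x y"
        using that by (induction rule: span_induct_alt)
          (auto simp: perp_def orthogonal_def inner_add_left inner_add_right inner_commute)
    qed
    moreover have "y \<in> perp K" if "\<forall>x\<in>span K. orthogonal x y" for y
      using that span_superset[of K] by (auto simp: perp_def orthogonal_def inner_commute)
    ultimately show ?thesis by blast
  qed
  then have "dim (perp K) + dim (span K) = DIM('a)"
    using dim_subspace_orthogonal_to_vectors[of "span K" UNIV] by (simp add: dim_UNIV)
  moreover have "dim (span K) = card K"
    using assms independent_base by (metis dim_span dim_eq_card_independent independent_mono)
  ultimately show ?thesis
    using assms card_base finite_subbase by (simp add: card_Diff_subset)
qed

lemma dim_image_W: "w \<in> W \<Longrightarrow> dim (w ` X) = dim X"
  by (meson bij_is_inj dim_image_eq inj_on_subset refl_group_bij refl_group_linear subset_UNIV)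

end

section \<open>Moebius inversion\<close>

lemma sum_mobius_interval:
  assumes "finite L" "X \<in> L" "Z \<in> L"
  shows "(\<Sum>Y\<in>{Y \<in> L. Z \<subseteq> Y \<and> Y \<subseteq> X}. mobius L X Y) = (if Z = X then 1 else 0)"
proof (cases "Z \<subset> X")
  case True
  have "{Y \<in> L. Z \<subseteq> Y \<and> Y \<subseteq> X} = insert Z {Y \<in> L. Z \<subset> Y \<and> Y \<subseteq> X}"
    using True assms by auto
  then have "(\<Sum>Y\<in>{Y \<in> L. Z \<subseteq> Y \<and> Y \<subseteq> X}. mobius L X Y) =
      mobius L X Z + (\<Sum>Y\<in>{Y \<in> L. Z \<subset> Y \<and> Y \<subseteq> X}. mobius L X Y)"
    using assms by simp
  moreover have "mobius L X Z = - (\<Sum>Y\<in>{Y \<in> L. Z \<subset> Y \<and> Y \<subseteq> X}. mobius L X Y)"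
    using True assms by (subst mobius.simps) auto
  ultimately show ?thesis using True by auto
next
  case False
  show ?thesis
  proof (cases "Z = X")
    case True
    then have "{Y \<in> L. Z \<subseteq> Y \<and> Y \<subseteq> X} = {X}" using assms by auto
    moreover have "mobius L X X = 1" using assms by (subst mobius.simps) auto
    ultimately show ?thesis using True by simp
  next
    case neq: False
    with False have "{Y \<in> L. Z \<subseteq> Y \<and> Y \<subseteq> X} = {}" by blast
    then show ?thesis using neq by (simp only: sum.empty if_False)
  qed
qed

text \<open>Intended for \<open>f Y\<close> the number of points on a closed stratum and
  \<open>N\<close> the number on an open one; with \<open>f Y\<close> equal to a power with exponent
  \<open>dim Y\<close> the left side is the characteristic polynomial.\<close>

lemma mobius_inversion_below:
  fixes f N :: "'a set \<Rightarrow> real"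
  assumes fin: "finite L" and X: "X \<in> L"
    and f: "\<And>Y. Y \<in> L \<Longrightarrow> f Y = (\<Sum>Z\<in>{Z \<in> L. Z \<subseteq> Y}. N Z)"
  shows "(\<Sum>Y\<in>{Y \<in> L. Y \<subseteq> X}. of_int (mobius L X Y) * f Y) = N X"
proof -
  let ?A = "{Y \<in> L. Y \<subseteq> X}"
  have "(\<Sum>Y\<in>?A. of_int (mobius L X Y) * f Y) =
      (\<Sum>Y\<in>?A. \<Sum>Z\<in>{Z \<in> L. Z \<subseteq> Y}. of_int (mobius L X Y) * N Z)"
    by (intro sum.cong) (auto simp: f sum_distrib_left)
  also have "\<dots> = (\<Sum>Z\<in>L. \<Sum>Y\<in>{Y \<in> ?A. Z \<subseteq> Y}. of_int (mobius L X Y) * N Z)"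
    using fin by (intro sum.swap_restrict) auto
  also have "\<dots> = (\<Sum>Z\<in>L. if Z = X then N Z else 0)"
  proof (intro sum.cong refl)
    fix Z assume Z: "Z \<in> L"
    have "{Y \<in> ?A. Z \<subseteq> Y} = {Y \<in> L. Z \<subseteq> Y \<and> Y \<subseteq> X}" by auto
    then have "(\<Sum>Y\<in>{Y \<in> ?A. Z \<subseteq> Y}. of_int (mobius L X Y) * N Z) =
        of_int (\<Sum>Y\<in>{Y \<in> L. Z \<subseteq> Y \<and> Y \<subseteq> X}. mobius L X Y) * N Z"
      by (simp add: sum_distrib_right)
    also have "\<dots> = (if Z = X then N Z else 0)"
      by (simp add: sum_mobius_interval[OF fin X Z])
    finally show "(\<Sum>Y\<in>{Y \<in> ?A. Z \<subseteq> Y}. of_int (mobius L X Y) * N Z) = (if Z = X then N Z else 0)" .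
  qed
  also have "\<dots> = N X" using fin X by simp
  finally show ?thesis .
qed

lemma in_span_if_perp:
  assumes "\<And>v. v \<in> perp S \<Longrightarrow> v \<bullet> x = 0"
  shows "x \<in> span S"
proof -
  obtain y z where yz: "y \<in> span S" "\<And>w. w \<in> span S \<Longrightarrow> orthogonal z w" "x = y + z"
    using orthogonal_subspace_decomp_exists[of S x] by blast
  have "z \<in> perp S" using yz(2) span_superset[of S] by (auto simp: perp_def orthogonal_def)
  then have "z \<bullet> x = 0" by (rule assms)
  moreover have "z \<bullet> y = 0" using yz by (simp add: orthogonal_def)
  ultimately have "z = 0" using yz(3) by (simp add: inner_add_right)
  then show ?thesis using yz by simp
qed

context based_root_system
begin

section \<open>The highest root\<close>

text \<open>\<open>reflection \<alpha> \<gamma>\<close> is positive, and its coefficient at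
  \<open>\<alpha>\<close> is a negative multiple of
  \<open>\<gamma> \<bullet> \<alpha>\<close>.\<close>

lemma simple_inner_nonpos:
  assumes "\<alpha> \<in> \<Delta>" "\<gamma> \<in> \<Delta>" "\<gamma> \<noteq> \<alpha>"
  shows "\<gamma> \<bullet> \<alpha> \<le> 0"
proof -
  have "reflection \<alpha> \<gamma> \<in> pos" using assms base_pos by (intro simple_reflection_pos) auto
  then have "0 \<le> reflection \<alpha> \<gamma> \<bullet> dual_basis \<alpha>" using pos_coef assms by blast
  also have "\<dots> = - (2 * (\<gamma> \<bullet> \<alpha>) / (\<alpha> \<bullet> \<alpha>))"
    using assms by (simp add: reflection_def inner_diff_left inner_base_dual_basis)
  finally have "2 * (\<gamma> \<bullet> \<alpha>) / (\<alpha> \<bullet> \<alpha>) \<le> 0" by simp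
  moreover have "0 < \<alpha> \<bullet> \<alpha>" using assms base_roots root_neq_zero by auto
  ultimately show ?thesis by (simp add: divide_le_0_iff)
qed

text \<open>Both Cartan integers are positive. If one is 1, the corresponding reflection produces
  the difference up to sign; the remaining case forces the two roots to coincide.\<close>

lemma root_diff:
  assumes "\<alpha> \<in> \<Phi>" "\<beta> \<in> \<Phi>" "0 < \<alpha> \<bullet> \<beta>" "\<alpha> \<noteq> \<beta>"
  shows "\<alpha> - \<beta> \<in> \<Phi>"
proof -
  have pos: "0 < \<alpha> \<bullet> \<alpha>" "0 < \<beta> \<bullet> \<beta>" using assms root_neq_zero by auto
  obtain m where m: "2 * (\<beta> \<bullet> \<alpha>) / (\<alpha> \<bullet> \<alpha>) = of_int m" using cartan_int[OF assms(1,2)] by (auto elim: Ints_cases)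
  obtain n where n: "2 * (\<alpha> \<bullet> \<beta>) / (\<beta> \<bullet> \<beta>) = of_int n" using cartan_int[OF assms(2,1)] by (auto elim: Ints_cases)
  have "0 < real_of_int m" "0 < real_of_int n"
    unfolding m[symmetric] n[symmetric] using pos assms(3) by (auto simp: inner_commute)
  then have mn: "0 < m" "0 < n" by auto
  consider "m = 1" | "n = 1" | "2 \<le> m" "2 \<le> n" using mn by linarith
  then show ?thesis
  proof cases
    case 1
    then have "reflection \<alpha> \<beta> = \<beta> - \<alpha>" unfolding reflection_def m by simp
    then have "- (\<beta> - \<alpha>) \<in> \<Phi>" using root_reflection[OF assms(1,2)] root_uminus by metis
    then show ?thesis by simp
  next
    case 2
    then have "reflection \<beta> \<alpha> = \<alpha> - \<beta>" unfolding reflection_def n by simp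
    then show ?thesis using root_reflection[OF assms(2,1)] by simp
  next
    case 3
    \<comment> \<open>Both squared lengths are then at most
      \<open>\<alpha> \<bullet> \<beta>\<close>, so the difference has squared length at most
      0.\<close>
    then have "2 \<le> 2 * (\<beta> \<bullet> \<alpha>) / (\<alpha> \<bullet> \<alpha>)" "2 \<le> 2 * (\<alpha> \<bullet> \<beta>) / (\<beta> \<bullet> \<beta>)" unfolding m n by simp_all
    then have "\<alpha> \<bullet> \<alpha> \<le> \<alpha> \<bullet> \<beta>" "\<beta> \<bullet> \<beta> \<le> \<alpha> \<bullet> \<beta>" using pos by (simp_all add: field_simps inner_commute)
    then have "(\<alpha> - \<beta>) \<bullet> (\<alpha> - \<beta>) \<le> 0" by (simp add: inner_diff_left inner_diff_right inner_commute)
    then have "(\<alpha> - \<beta>) \<bullet> (\<alpha> - \<beta>) = 0" using inner_ge_zero[of "\<alpha> - \<beta>"] by linarith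
    then have "\<alpha> = \<beta>" by simp
    then show ?thesis using assms(4) by simp
  qed
qed

definition below :: "'a \<Rightarrow> 'a \<Rightarrow> bool" where
  "below x y \<longleftrightarrow> (\<forall>\<alpha>\<in>\<Delta>. x \<bullet> dual_basis \<alpha> \<le> y \<bullet> dual_basis \<alpha>)"

lemma below_trans: "below x y \<Longrightarrow> below y z \<Longrightarrow> below x z"
  unfolding below_def using order_trans by blast

lemma inner_nonneg_dominant:
  assumes "\<And>\<alpha>. \<alpha> \<in> \<Delta> \<Longrightarrow> 0 \<le> x \<bullet> dual_basis \<alpha>" "dominant_for \<Delta> y"
  shows "0 \<le> x \<bullet> y"
  using assms by (subst inner_expansion) (auto simp: dominant_for_def inner_commute intro!: sum_nonneg mult_nonneg_nonneg)

lemma below_dominant: "below x y \<Longrightarrow> dominant_for \<Delta> v \<Longrightarrow> x \<bullet> v \<le> y \<bullet> v"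
  using inner_nonneg_dominant[of "y - x" v] by (simp add: below_def inner_diff_left)

lemma dominant_rho: "dominant_for \<Delta> \<rho>"
  by (simp add: dominant_for_def inner_commute[of \<rho>] base_inner_rho)

text \<open>Choose a root of largest height above \<open>\<beta>\<close>. If it paired negatively
  with a simple root, the simple reflection would add a positive multiple of that root and raise the
  height.\<close>

lemma maximal_root_above:
  assumes "\<beta> \<in> \<Phi>"
  shows "\<exists>\<theta>\<in>\<Phi>. below \<beta> \<theta> \<and> dominant_for \<Delta> \<theta> \<and> (\<forall>\<gamma>\<in>\<Phi>. below \<theta> \<gamma> \<longrightarrow> \<gamma> \<bullet> \<rho> \<le> \<theta> \<bullet> \<rho>)"
proof -
  let ?S = "{\<gamma> \<in> \<Phi>. below \<beta> \<gamma>}"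
  have fin: "finite ((\<lambda>\<gamma>. \<gamma> \<bullet> \<rho>) ` ?S)" using finite_roots by auto
  have "\<beta> \<in> ?S" using assms by (simp add: below_def)
  then have "(\<lambda>\<gamma>. \<gamma> \<bullet> \<rho>) ` ?S \<noteq> {}" by blast
  then obtain \<theta> where \<theta>: "\<theta> \<in> ?S" "\<theta> \<bullet> \<rho> = Max ((\<lambda>\<gamma>. \<gamma> \<bullet> \<rho>) ` ?S)"
    using Max_in[OF fin] by (metis (no_types, lifting) imageE)
  have max: "\<gamma> \<bullet> \<rho> \<le> \<theta> \<bullet> \<rho>" if "\<gamma> \<in> \<Phi>" "below \<theta> \<gamma>" for \<gamma>
  proof -
    have "\<gamma> \<in> ?S" using that \<theta>(1) below_trans by blast
    then show ?thesis unfolding \<theta>(2) using fin by (intro Max_ge) auto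
  qed
  have "0 \<le> \<theta> \<bullet> \<alpha>" if \<alpha>: "\<alpha> \<in> \<Delta>" for \<alpha>
  proof (rule ccontr)
    assume neg: "\<not> 0 \<le> \<theta> \<bullet> \<alpha>"
    have "0 < \<alpha> \<bullet> \<alpha>" using \<alpha> base_roots root_neq_zero by auto
    then have c: "2 * (\<theta> \<bullet> \<alpha>) / (\<alpha> \<bullet> \<alpha>) < 0" using neg by (simp add: divide_neg_pos)
    have "below \<theta> (reflection \<alpha> \<theta>)"
      using c \<alpha> by (auto simp: below_def reflection_def inner_diff_left inner_base_dual_basis)
    moreover have "reflection \<alpha> \<theta> \<in> \<Phi>" using \<alpha> \<theta> base_roots root_reflection by blast
    ultimately have "reflection \<alpha> \<theta> \<bullet> \<rho> \<le> \<theta> \<bullet> \<rho>" using max by blast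
    then show False using c \<alpha> by (simp add: reflection_def inner_diff_left base_inner_rho)
  qed
  then show ?thesis using \<theta>(1) max by (auto simp: dominant_for_def)
qed

text \<open>Let \<open>S\<close> be the support. For a simple root outside \<open>S\<close>, pairing
  with \<open>\<theta>\<close> is nonnegative by dominance but a sum of nonpositive terms; hence
  \<open>S\<close> is orthogonal to the other simple roots, and if there were any, the whole root
  system would split.\<close>

lemma dominant_root_full_support:
  assumes irr: "irreducible_root_system \<Phi>"
    and \<theta>: "\<theta> \<in> pos" "dominant_for \<Delta> \<theta>" and \<alpha>: "\<alpha> \<in> \<Delta>"
  shows "0 < \<theta> \<bullet> dual_basis \<alpha>"
proof (rule ccontr)
  assume "\<not> 0 < \<theta> \<bullet> dual_basis \<alpha>"
  define S where "S = {\<gamma> \<in> \<Delta>. 0 < \<theta> \<bullet> dual_basis \<gamma>}"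
  have notS: "\<theta> \<bullet> dual_basis \<gamma> = 0" if "\<gamma> \<in> \<Delta> - S" for \<gamma>
    using that pos_coef[OF \<theta>(1), of \<gamma>] by (auto simp: S_def)
  have S: "S \<subseteq> \<Delta>" and \<alpha>S: "\<alpha> \<in> \<Delta> - S"
    using \<alpha> \<open>\<not> 0 < \<theta> \<bullet> dual_basis \<alpha>\<close> by (auto simp: S_def)
  have orth: "\<gamma> \<bullet> \<delta> = 0" if \<gamma>: "\<gamma> \<in> S" and \<delta>: "\<delta> \<in> \<Delta> - S" for \<gamma> \<delta>
  proof -
    have le: "(\<theta> \<bullet> dual_basis \<eta>) * (\<eta> \<bullet> \<delta>) \<le> 0" if "\<eta> \<in> S" for \<eta>
      using that \<delta> S simple_inner_nonpos[of \<delta> \<eta>] by (auto simp: S_def mult_le_0_iff)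
    have "\<theta> \<bullet> \<delta> = (\<Sum>\<eta>\<in>S. (\<theta> \<bullet> dual_basis \<eta>) * (\<eta> \<bullet> \<delta>))"
      using notS S by (subst inner_expansion) (auto intro!: sum.mono_neutral_right simp: finite_base)
    moreover have "0 \<le> \<theta> \<bullet> \<delta>" using \<theta> \<delta> by (auto simp: dominant_for_def)
    ultimately have "(\<Sum>\<eta>\<in>S. - ((\<theta> \<bullet> dual_basis \<eta>) * (\<eta> \<bullet> \<delta>))) = 0"
      using sum_nonpos[of S "\<lambda>\<eta>. (\<theta> \<bullet> dual_basis \<eta>) * (\<eta> \<bullet> \<delta>)"] le by (simp add: sum_negf)
    then have "\<forall>\<eta>\<in>S. - ((\<theta> \<bullet> dual_basis \<eta>) * (\<eta> \<bullet> \<delta>)) = 0"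
      using le finite_subbase[OF S] by (subst (asm) sum_nonneg_eq_0_iff) auto
    then show ?thesis using \<gamma> by (auto simp: S_def)
  qed
  have orth_S: "\<beta> \<bullet> \<delta> = 0" if "\<beta> \<in> levi S" "\<delta> \<in> \<Delta> - S" for \<beta> \<delta>
    using levi_expansion[OF S that(1), of \<delta>] orth that(2) by simp
  have orth_S': "\<beta> \<bullet> \<delta> = 0" if "\<beta> \<in> levi (\<Delta> - S)" "\<delta> \<in> S" for \<beta> \<delta>
  proof -
    have "\<beta> \<bullet> \<delta> = (\<Sum>\<alpha>\<in>\<Delta> - S. (\<beta> \<bullet> dual_basis \<alpha>) * (\<alpha> \<bullet> \<delta>))"
      by (rule levi_expansion) (use that in auto)
    also have "\<dots> = 0" by (intro sum.neutral) (simp add: inner_commute[of _ \<delta>] orth[OF that(2)])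
    finally show ?thesis .
  qed
  have levi_refl: "reflection \<gamma> \<beta> \<in> levi J" if "J \<subseteq> \<Delta>" "\<gamma> \<in> J" "\<beta> \<in> levi J" for \<gamma> \<beta> J
  proof -
    have "reflection \<gamma> \<beta> \<in> \<Phi>" using that base_roots levi_roots by (blast intro: root_reflection)
    then show ?thesis
      using that by (auto simp: levi_def reflection_def inner_diff_left inner_base_dual_basis)
  qed
  have refl_closed: "reflection \<gamma> \<beta> \<in> levi S \<union> levi (\<Delta> - S)"
    if \<gamma>: "\<gamma> \<in> \<Delta>" and \<beta>: "\<beta> \<in> levi S \<union> levi (\<Delta> - S)" for \<gamma> \<beta>
  proof (cases "\<gamma> \<in> S")
    case True
    then show ?thesis
      using \<beta> orth_S'[of \<beta> \<gamma>] levi_refl[OF S, of \<gamma> \<beta>] reflection_fixes[of \<beta> \<gamma>] by auto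
  next
    case False
    then have "\<gamma> \<in> \<Delta> - S" using \<gamma> by simp
    then show ?thesis
      using \<beta> orth_S[of \<beta> \<gamma>] levi_refl[of "\<Delta> - S" \<gamma> \<beta>] reflection_fixes[of \<beta> \<gamma>] by auto
  qed
  \<comment> \<open>The splitting of the base spreads to all roots: simple reflections preserve the
    union of the two subsystems, and every root is an image of a simple one.\<close>
  have orbit: "g \<gamma> \<in> levi S \<union> levi (\<Delta> - S)" if "g \<in> refl_group \<Delta>" "\<gamma> \<in> \<Delta>" for g \<gamma>
    using that
  proof (induction rule: refl_group_induct)
    case id
    then show ?case using subbase_levi[OF S] subbase_levi[of "\<Delta> - S"] by auto
  next
    case (step \<alpha> h)
    then show ?case using refl_closed[of \<alpha> "h \<gamma>"] by simp
  qed
  have cover: "levi S \<union> levi (\<Delta> - S) = \<Phi>"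
  proof
    show "\<Phi> \<subseteq> levi S \<union> levi (\<Delta> - S)"
    proof
      fix \<beta> assume "\<beta> \<in> \<Phi>"
      then obtain g \<gamma> where "g \<in> refl_group \<Delta>" "\<gamma> \<in> \<Delta>" "\<beta> = g \<gamma>" using root_orbit by blast
      then show "\<beta> \<in> levi S \<union> levi (\<Delta> - S)" using orbit by simp
    qed
  qed (use levi_roots in blast)
  have "\<beta> \<bullet> \<delta> = 0" if "\<beta> \<in> levi S" "\<delta> \<in> levi (\<Delta> - S)" for \<beta> \<delta>
  proof -
    have "\<beta> \<bullet> \<delta> = (\<Sum>\<alpha>\<in>S. (\<beta> \<bullet> dual_basis \<alpha>) * (\<alpha> \<bullet> \<delta>))" by (rule levi_expansion[OF S that(1)])
    also have "\<dots> = 0" using orth_S'[OF that(2)] by (intro sum.neutral) (simp add: inner_commute)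
    finally show ?thesis .
  qed
  moreover have "\<theta> \<in> levi S" using notS \<theta>(1) pos_root by (auto simp: levi_def)
  moreover have "\<alpha> \<in> levi (\<Delta> - S)" using subbase_levi[of "\<Delta> - S"] \<alpha>S by auto
  moreover have "levi S \<inter> levi (\<Delta> - S) = {}"
  proof (rule equals0I)
    fix \<beta> assume "\<beta> \<in> levi S \<inter> levi (\<Delta> - S)"
    then have "\<beta> \<bullet> \<beta> = 0" "\<beta> \<in> \<Phi>" using calculation(1)[of \<beta> \<beta>] levi_roots by auto
    then show False using root_neq_zero by simp
  qed
  ultimately have "levi S \<noteq> {} \<and> levi (\<Delta> - S) \<noteq> {} \<and> levi S \<inter> levi (\<Delta> - S) = {} \<and>
      levi S \<union> levi (\<Delta> - S) = \<Phi> \<and> (\<forall>\<alpha>\<in>levi S. \<forall>\<beta>\<in>levi (\<Delta> - S). \<alpha> \<bullet> \<beta> = 0)"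
    using cover by blast
  then show False using irr unfolding irreducible_root_system_def by blast
qed

text \<open>Fix a maximal dominant positive \<open>\<theta>\<close> and compare it with a dominant
  root \<open>\<eta>\<close> above the given \<open>\<beta>\<close>. Full support makes their inner
  product positive, so they are equal or differ by a root; maximality of \<open>\<theta>\<close>
  makes that difference positive.\<close>

lemma highest_root:
  assumes irr: "irreducible_root_system \<Phi>"
  shows "\<exists>\<theta>\<in>\<Phi>. (\<forall>\<alpha>\<in>\<Delta>. 0 < \<theta> \<bullet> dual_basis \<alpha>) \<and> (\<forall>\<beta>\<in>\<Phi>. below \<beta> \<theta>)"
proof -
  obtain \<beta>\<^sub>0 where "\<beta>\<^sub>0 \<in> \<Phi>" using irr by (auto simp: irreducible_root_system_def)
  then obtain \<beta>\<^sub>1 where b1: "\<beta>\<^sub>1 \<in> pos" using not_pos_iff by blast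
  then obtain \<theta> where \<theta>: "\<theta> \<in> \<Phi>" "below \<beta>\<^sub>1 \<theta>" "dominant_for \<Delta> \<theta>"
      and max: "\<And>\<gamma>. \<gamma> \<in> \<Phi> \<Longrightarrow> below \<theta> \<gamma> \<Longrightarrow> \<gamma> \<bullet> \<rho> \<le> \<theta> \<bullet> \<rho>"
    using maximal_root_above[OF pos_root] by blast
  have \<theta>pos: "\<theta> \<in> pos"
    using below_dominant[OF \<theta>(2) dominant_rho] b1 \<theta>(1) by (simp add: pos_def)
  have supp: "0 < \<theta> \<bullet> dual_basis \<alpha>" if "\<alpha> \<in> \<Delta>" for \<alpha>
    using dominant_root_full_support[OF irr \<theta>pos \<theta>(3) that] .
  have "below \<beta> \<theta>" if \<beta>: "\<beta> \<in> \<Phi>" for \<beta>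
  proof -
    obtain \<eta> where \<eta>: "\<eta> \<in> \<Phi>" "below \<beta> \<eta>" "dominant_for \<Delta> \<eta>"
      using maximal_root_above[OF \<beta>] by blast
    \<comment> \<open>Since \<open>\<theta>\<close> has only positive coefficients, a zero product
      with the dominant \<open>\<eta>\<close> would make \<open>\<eta>\<close> orthogonal to every
      simple root and hence zero.\<close>
    have "\<theta> \<bullet> \<eta> \<noteq> 0"
    proof
      assume "\<theta> \<bullet> \<eta> = 0"
      have "\<eta> \<bullet> \<alpha> = 0" if "\<alpha> \<in> \<Delta>" for \<alpha>
      proof (rule ccontr)
        assume "\<eta> \<bullet> \<alpha> \<noteq> 0"
        then have "\<theta> \<bullet> dual_basis \<alpha> = 0"
          using that supp \<open>\<theta> \<bullet> \<eta> = 0\<close> \<eta>(3) less_imp_le by (intro pos_inner_zero_coef[of \<theta> \<eta> \<alpha>]) blast+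
        then show False using supp[OF that] by simp
      qed
      then have "\<eta> \<bullet> \<eta> = 0" by (subst inner_expansion) (simp add: inner_commute)
      then show False using root_neq_zero[OF \<eta>(1)] by simp
    qed
    moreover have "0 \<le> \<theta> \<bullet> \<eta>" using dominant_pos[OF \<eta>(3) \<theta>pos] .
    ultimately have pos': "0 < \<theta> \<bullet> \<eta>" by simp
    show ?thesis
    proof (cases "\<theta> = \<eta>")
      case True
      then show ?thesis using \<eta>(2) by simp
    next
      case False
      have d: "\<theta> - \<eta> \<in> \<Phi>" using root_diff[OF \<theta>(1) \<eta>(1) pos' False] .
      have "\<theta> - \<eta> \<in> pos"
      proof (rule ccontr)
        assume "\<theta> - \<eta> \<notin> pos"
        then have *: "\<eta> - \<theta> \<in> pos" using not_pos_iff[OF d] by simp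
        then have "below \<theta> \<eta>" using pos_coef[OF *] by (simp add: below_def inner_diff_left)
        then have "\<eta> \<bullet> \<rho> \<le> \<theta> \<bullet> \<rho>" using max \<eta> by blast
        then show False using * by (simp add: pos_def inner_diff_left)
      qed
      from pos_coef[OF this] have "below \<eta> \<theta>" by (simp add: below_def inner_diff_left)
      then show ?thesis using \<eta>(2) below_trans by blast
    qed
  qed
  then show ?thesis using \<theta>(1) supp by blast
qed

end

lemma floor_mod_eq_iff:
  fixes a b :: real and p :: int
  assumes "a \<in> \<int>" "b \<in> \<int>" "0 < p"
  shows "\<lfloor>a\<rfloor> mod p = \<lfloor>b\<rfloor> mod p \<longleftrightarrow> (a - b) / of_int p \<in> \<int>"
proof -
  obtain m n where mn: "a = of_int m" "b = of_int n" using assms by (auto elim!: Ints_cases)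
  have "(a - b) / of_int p \<in> \<int> \<longleftrightarrow> p dvd m - n"
  proof
    assume "(a - b) / of_int p \<in> \<int>"
    then obtain k where "(a - b) / of_int p = of_int k" by (auto elim!: Ints_cases)
    then have "real_of_int (m - n) = real_of_int (p * k)"
      using assms(3) mn by (simp add: field_simps)
    then show "p dvd m - n" by (metis dvd_triv_left of_int_eq_iff)
  next
    assume "p dvd m - n"
    then obtain k where "m - n = p * k" by blast
    then have "a - b = of_int p * of_int k" using mn by (metis of_int_diff of_int_mult)
    then show "(a - b) / of_int p \<in> \<int>" using assms(3) by simp
  qed
  then show ?thesis using mn by (simp add: mod_eq_dvd_iff)
qed

context based_root_system
begin

section \<open>Good primes\<close>

text \<open>The lattice dual to the root lattice. It has the fundamental coweights as a basis, so
  any integer values on \<open>\<Delta>\<close> are realised.\<close>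

definition coweights :: "'a set" where
  "coweights = {y. \<forall>\<beta>\<in>\<Phi>. y \<bullet> \<beta> \<in> \<int>}"

lemma coweight_int: "y \<in> coweights \<Longrightarrow> \<beta> \<in> \<Phi> \<Longrightarrow> y \<bullet> \<beta> \<in> \<int>"
  by (simp add: coweights_def)

definition vanishing :: "nat \<Rightarrow> 'a \<Rightarrow> 'a set" where
  "vanishing p y = {\<beta> \<in> \<Phi>. (y \<bullet> \<beta>) / p \<in> \<int>}"

text \<open>Let \<open>\<theta>\<close> be the highest root. If \<open>y \<bullet> \<theta> = p\<close>, then every \<open>\<beta>\<close> in the span of the roots vanishing
  mod \<open>p\<close> has, on the simple roots not orthogonal to \<open>y\<close>, the coefficients of \<open>(y \<bullet> \<beta> / p) \<theta>\<close>.\<close>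

lemma good_prime_closed_dominant:
  assumes irr: "irreducible_root_system \<Phi>" and good: "good_prime \<Phi> \<Delta> p"
    and y: "y \<in> coweights" "dominant_for \<Delta> y" "\<And>\<beta>. \<beta> \<in> \<Phi> \<Longrightarrow> \<bar>y \<bullet> \<beta>\<bar> \<le> p"
    and \<gamma>: "\<gamma> \<in> \<Phi>" "\<gamma> \<in> span (vanishing p y)"
  shows "\<gamma> \<in> vanishing p y"
proof -
  have p: "prime p" using good by (simp add: good_prime_def)
  have p0: "0 < real p" using prime_gt_0_nat[OF p] by simp
  obtain \<theta> where \<theta>: "\<theta> \<in> \<Phi>" "\<And>\<alpha>. \<alpha> \<in> \<Delta> \<Longrightarrow> 0 < \<theta> \<bullet> dual_basis \<alpha>" "\<And>\<beta>. \<beta> \<in> \<Phi> \<Longrightarrow> below \<beta> \<theta>"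
    using highest_root[OF irr] by blast
  have le\<theta>: "\<bar>y \<bullet> \<beta>\<bar> \<le> y \<bullet> \<theta>" if "\<beta> \<in> \<Phi>" for \<beta>
    using below_dominant[OF \<theta>(3)[OF that] y(2)] below_dominant[OF \<theta>(3)[of "- \<beta>"] y(2)] that
    by (simp add: inner_commute)
  show ?thesis
  proof (cases "y \<bullet> \<theta> = p")
    case False
    \<comment> \<open>All values lie strictly between -p and p, so vanishing modulo p means
      vanishing outright, a condition that is linear and passes to spans.\<close>
    then have lt: "\<bar>y \<bullet> \<beta>\<bar> < p" if "\<beta> \<in> \<Phi>" for \<beta> using le\<theta>[OF that] y(3)[OF \<theta>(1)] by linarith
    have "y \<bullet> \<beta> = 0" if "\<beta> \<in> vanishing p y" for \<beta>
    proof -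
      have \<beta>: "\<beta> \<in> \<Phi>" "y \<bullet> \<beta> / p \<in> \<int>" using that by (auto simp: vanishing_def)
      then obtain k where "y \<bullet> \<beta> / p = of_int k" by (auto elim!: Ints_cases)
      moreover have "\<bar>y \<bullet> \<beta> / p\<bar> < 1" using lt[OF \<beta>(1)] p0 by (simp add: field_simps)
      ultimately have "\<bar>k\<bar> < 1" by linarith
      then show ?thesis using \<open>y \<bullet> \<beta> / p = of_int k\<close> p0 by simp
    qed
    then have "span (vanishing p y) \<subseteq> {x. y \<bullet> x = 0}"
      by (intro span_minimal) (auto simp: subspace_hyperplane)
    then show ?thesis using \<gamma> by (auto simp: vanishing_def)
  next
    case True
    define T where "T = {x. \<forall>\<alpha>\<in>\<Delta>. y \<bullet> \<alpha> \<noteq> 0 \<longrightarrow> x \<bullet> dual_basis \<alpha> = (y \<bullet> x) / p * (\<theta> \<bullet> dual_basis \<alpha>)}"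
    have "subspace T"
      by (auto simp: T_def subspace_def inner_add_left inner_add_right distrib_right add_divide_distrib)
    have uminus_T: "x \<in> T" if "- x \<in> T" for x using that by (simp add: T_def)
    have pT: "\<beta> \<in> T" if \<beta>: "\<beta> \<in> \<Phi>" "y \<bullet> \<beta> = p" for \<beta>
    proof -
      \<comment> \<open>The difference has nonnegative coefficients, since \<open>\<theta>\<close>
        is highest, and pairs to 0 with the dominant \<open>y\<close>.\<close>
      have "(\<theta> - \<beta>) \<bullet> dual_basis \<alpha> = 0" if "\<alpha> \<in> \<Delta>" "y \<bullet> \<alpha> \<noteq> 0" for \<alpha>
      proof (rule pos_inner_zero_coef[OF _ y(2) _ that])
        show "0 \<le> (\<theta> - \<beta>) \<bullet> dual_basis \<alpha>" if "\<alpha> \<in> \<Delta>" for \<alpha>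
          using \<theta>(3)[OF \<beta>(1)] that by (simp add: below_def inner_diff_left)
        show "(\<theta> - \<beta>) \<bullet> y = 0" using True \<beta> by (simp add: inner_diff_right inner_commute[of _ y])
      qed
      then show ?thesis using \<beta> p0 by (simp add: T_def inner_diff_left)
    qed
    have zT: "\<beta> \<in> T" if \<beta>: "\<beta> \<in> pos" "y \<bullet> \<beta> = 0" for \<beta>
      using pos_inner_zero_coef[OF pos_coef[OF \<beta>(1)] y(2)] \<beta>(2) by (simp add: T_def inner_commute)
    have "vanishing p y \<subseteq> T"
    proof
      fix \<beta> assume "\<beta> \<in> vanishing p y"
      then have \<beta>: "\<beta> \<in> \<Phi>" "y \<bullet> \<beta> / p \<in> \<int>" by (auto simp: vanishing_def)
      then obtain k where k: "y \<bullet> \<beta> / p = of_int k" by (auto elim!: Ints_cases)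
      have "\<bar>y \<bullet> \<beta> / p\<bar> \<le> 1" using y(3)[OF \<beta>(1)] p0 by (simp add: field_simps)
      then have "\<bar>k\<bar> \<le> 1" using k by linarith
      then consider "k = 0" | "k = 1" | "k = -1" by linarith
      then show "\<beta> \<in> T"
      proof cases
        case 1
        then have 0: "y \<bullet> \<beta> = 0" using k p0 by simp
        show ?thesis
        proof (cases "\<beta> \<in> pos")
          case True
          then show ?thesis using zT 0 by blast
        next
          case False
          then have "- \<beta> \<in> T" using not_pos_iff[OF \<beta>(1)] 0 by (intro zT) auto
          then show ?thesis by (rule uminus_T)
        qed
      next
        case 2
        then show ?thesis using k p0 \<beta> by (intro pT) (auto simp: field_simps)
      next
        case 3
        then have "- \<beta> \<in> T" using k p0 \<beta> by (intro pT) (auto simp: field_simps)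
        then show ?thesis by (rule uminus_T)
      qed
    qed
    then have "span (vanishing p y) \<subseteq> T" using \<open>subspace T\<close> by (rule span_minimal)
    then have \<gamma>T: "\<gamma> \<in> T" using \<gamma>(2) by blast
    have "\<exists>\<alpha>\<in>\<Delta>. y \<bullet> \<alpha> \<noteq> 0"
    proof (rule ccontr)
      assume "\<not> ?thesis"
      then have "\<theta> \<bullet> y = 0" by (subst inner_expansion) (simp add: inner_commute)
      then show False using True p0 by (simp add: inner_commute)
    qed
    then obtain \<alpha> where \<alpha>: "\<alpha> \<in> \<Delta>" "y \<bullet> \<alpha> \<noteq> 0" by blast
    obtain m where m: "y \<bullet> \<gamma> = of_int m" using coweight_int[OF y(1) \<gamma>(1)] by (auto elim!: Ints_cases)
    obtain k where k: "\<gamma> \<bullet> dual_basis \<alpha> = of_int k" using coef_int[OF \<gamma>(1) \<alpha>(1)] by (auto elim!: Ints_cases)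
    obtain N where N: "\<theta> \<bullet> dual_basis \<alpha> = of_int N" using coef_int[OF \<theta>(1) \<alpha>(1)] by (auto elim!: Ints_cases)
    \<comment> \<open>Clearing denominators gives p * k = m * N. Goodness is applied to the nonzero
      coefficient \<open>N\<close> of the highest root, so p must divide \<open>m\<close>, the value
      of \<open>y\<close> on \<open>\<gamma>\<close>.\<close>
    have "of_int k = of_int m / p * real_of_int N"
      using \<gamma>T \<alpha> unfolding T_def k[symmetric] m[symmetric] N[symmetric] by blast
    then have "real_of_int (int p * k) = real_of_int (m * N)" using p0 by (simp add: field_simps)
    then have "int p * k = m * N" by (simp only: of_int_eq_iff)
    then have "int p dvd m * N" by (metis dvd_triv_left)
    moreover have "prime (int p)" using p by simp
    ultimately have "int p dvd m \<or> int p dvd N" by (simp add: prime_dvd_mult_iff)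
    moreover have "\<not> int p dvd N"
    proof
      assume "int p dvd N"
      moreover have "N \<noteq> 0" using \<theta>(2)[OF \<alpha>(1)] N by auto
      moreover have "representation \<Delta> \<theta> \<alpha> = of_int N" using N by (simp add: inner_dual_basis)
      ultimately have "bad_prime \<Phi> \<Delta> p"
        using p \<theta>(1) \<alpha>(1) unfolding bad_prime_def by blast
      then show False using good by (simp add: good_prime_def)
    qed
    ultimately obtain j where "m = int p * j" by blast
    then have "y \<bullet> \<gamma> / p = of_int j" using m p0 by simp
    then show ?thesis using \<gamma>(1) by (simp add: vanishing_def)
  qed
qed

text \<open>A quadratic form invariant under the Weyl group and integer-valued on coweights, so that
  strict decrease cannot continue forever.\<close>

definition energy :: "'a \<Rightarrow> real" where
  "energy y = (\<Sum>\<beta>\<in>\<Phi>. (y \<bullet> \<beta>)\<^sup>2)"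

lemma energy_int: "y \<in> coweights \<Longrightarrow> energy y \<in> \<int>"
  unfolding energy_def by (intro Ints_sum Ints_power coweight_int)

lemma energy_nonneg: "0 \<le> energy y"
  unfolding energy_def by (intro sum_nonneg) simp

text \<open>Along the line through \<open>y\<close> in the direction of the coroot of
  \<open>\<gamma>\<close>, the energy is a quadratic polynomial in the shift with positive leading
  coefficient. By invariance it agrees at shift 0 and at shift \<open>y \<bullet> \<gamma>\<close>,
  where the reflection is reached, so it is strictly smaller in between.\<close>

lemma energy_shift:
  assumes \<gamma>: "\<gamma> \<in> \<Phi>" and q: "0 < q" "q < y \<bullet> \<gamma>"
  shows "energy (y - (2 * q / (\<gamma> \<bullet> \<gamma>)) *\<^sub>R \<gamma>) < energy y"
proof -
  define g where "g \<beta> = 2 * (\<gamma> \<bullet> \<beta>) / (\<gamma> \<bullet> \<gamma>)" for \<beta>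
  define A where "A = (\<Sum>\<beta>\<in>\<Phi>. (y \<bullet> \<beta>) * g \<beta>)"
  define B where "B = (\<Sum>\<beta>\<in>\<Phi>. (g \<beta>)\<^sup>2)"
  have gg: "0 < \<gamma> \<bullet> \<gamma>" using \<gamma> root_neq_zero by auto
  have expand: "energy (y - (2 * t / (\<gamma> \<bullet> \<gamma>)) *\<^sub>R \<gamma>) = energy y - 2 * t * A + t\<^sup>2 * B" for t
  proof -
    have "energy (y - (2 * t / (\<gamma> \<bullet> \<gamma>)) *\<^sub>R \<gamma>) = (\<Sum>\<beta>\<in>\<Phi>. (y \<bullet> \<beta>)\<^sup>2 - 2 * t * ((y \<bullet> \<beta>) * g \<beta>) + t\<^sup>2 * (g \<beta>)\<^sup>2)"
      unfolding energy_def
      by (intro sum.cong refl) (simp add: g_def inner_diff_left power2_eq_square algebra_simps)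
    also have "\<dots> = energy y - 2 * t * A + t\<^sup>2 * B"
      by (simp add: sum.distrib sum_subtractf energy_def A_def B_def sum_distrib_left)
    finally show ?thesis .
  qed
  have "energy (reflection \<gamma> y) = energy y"
  proof -
    have "energy (reflection \<gamma> y) = (\<Sum>\<beta>\<in>\<Phi>. (y \<bullet> reflection \<gamma> \<beta>)\<^sup>2)"
      by (simp add: energy_def reflection_adjoint)
    also have "\<dots> = (\<Sum>\<beta>\<in>reflection \<gamma> ` \<Phi>. (y \<bullet> \<beta>)\<^sup>2)"
      using bij_reflection[of \<gamma>] by (subst sum.reindex) (auto intro: inj_on_subset simp: bij_def)
    finally show ?thesis by (simp add: reflection_image_roots[OF \<gamma>] energy_def)
  qed
  moreover have "reflection \<gamma> y = y - (2 * (y \<bullet> \<gamma>) / (\<gamma> \<bullet> \<gamma>)) *\<^sub>R \<gamma>" by (simp add: reflection_def)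
  ultimately have "(y \<bullet> \<gamma>) * (2 * A) = (y \<bullet> \<gamma>) * ((y \<bullet> \<gamma>) * B)"
    using expand[of "y \<bullet> \<gamma>"] by (simp add: power2_eq_square algebra_simps)
  then have A: "2 * A = (y \<bullet> \<gamma>) * B" using q by simp
  have "(g \<gamma>)\<^sup>2 \<le> B" unfolding B_def using \<gamma> finite_roots by (intro member_le_sum) auto
  moreover have "g \<gamma> = 2" using gg by (simp add: g_def)
  ultimately have "0 < B" by simp
  have "energy (y - (2 * q / (\<gamma> \<bullet> \<gamma>)) *\<^sub>R \<gamma>) = energy y - q * (2 * A) + q\<^sup>2 * B"
    using expand[of q] by simp
  also have "\<dots> = energy y - q * (y \<bullet> \<gamma> - q) * B"
    unfolding A by (simp add: power2_eq_square algebra_simps)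
  also have "\<dots> < energy y" using q \<open>0 < B\<close> by simp
  finally show ?thesis .
qed

text \<open>Descent on the energy: a value above p permits a shift by p that lowers the energy
  within the residue class. When no value exceeds p, the lower bound -p follows by passing to
  negative roots.\<close>

lemma small_representative:
  assumes "y \<in> coweights" "0 < p"
  shows "\<exists>z\<in>coweights. (\<forall>\<beta>\<in>\<Phi>. (z \<bullet> \<beta> - y \<bullet> \<beta>) / real p \<in> \<int>) \<and> (\<forall>\<beta>\<in>\<Phi>. \<bar>z \<bullet> \<beta>\<bar> \<le> p)"
  using assms(1)
proof (induction "nat \<lfloor>energy y\<rfloor>" arbitrary: y rule: less_induct)
  case less
  show ?case
  proof (cases "\<forall>\<beta>\<in>\<Phi>. y \<bullet> \<beta> \<le> p")
    case True
    have "\<bar>y \<bullet> \<beta>\<bar> \<le> p" if "\<beta> \<in> \<Phi>" for \<beta>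
      using bspec[OF True that] bspec[OF True root_uminus[OF that]] by (simp add: abs_le_iff)
    then show ?thesis using less.prems by (intro bexI[of _ y]) auto
  next
    case False
    then obtain \<gamma> where \<gamma>: "\<gamma> \<in> \<Phi>" "real p < y \<bullet> \<gamma>" by auto
    \<comment> \<open>The subtracted vector is p times the coroot of \<open>\<gamma>\<close>;
      integrality of the Cartan numbers makes every root value change by a multiple of p.\<close>
    define z where "z = y - (2 * real p / (\<gamma> \<bullet> \<gamma>)) *\<^sub>R \<gamma>"
    have z: "z \<bullet> \<beta> - y \<bullet> \<beta> = - (real p * (2 * (\<beta> \<bullet> \<gamma>) / (\<gamma> \<bullet> \<gamma>)))" for \<beta>
      by (simp add: z_def inner_diff_left inner_commute[of \<gamma> \<beta>])
    have zy: "(z \<bullet> \<beta> - y \<bullet> \<beta>) / real p \<in> \<int>" if "\<beta> \<in> \<Phi>" for \<beta>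
      unfolding z using cartan_int[OF \<gamma>(1) that] assms(2) by simp
    have zc: "z \<in> coweights"
      unfolding coweights_def
    proof (intro CollectI ballI)
      fix \<beta> assume \<beta>: "\<beta> \<in> \<Phi>"
      have "z \<bullet> \<beta> = y \<bullet> \<beta> - real p * (2 * (\<beta> \<bullet> \<gamma>) / (\<gamma> \<bullet> \<gamma>))" using z[of \<beta>] by simp
      also have "\<dots> \<in> \<int>"
        by (intro Ints_diff Ints_mult Ints_of_nat cartan_int \<gamma>(1) \<beta> coweight_int[OF less.prems])
      finally show "z \<bullet> \<beta> \<in> \<int>" .
    qed
    have lt: "energy z < energy y"
      unfolding z_def using \<gamma> assms(2) by (intro energy_shift) auto
    obtain a b where ab: "energy z = of_int a" "energy y = of_int b"
      using energy_int[OF zc] energy_int[OF less.prems] by (auto elim!: Ints_cases)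
    have "nat \<lfloor>energy z\<rfloor> < nat \<lfloor>energy y\<rfloor>"
      using lt energy_nonneg[of z] unfolding ab by simp
    from less.hyps[OF this zc] obtain x where x: "x \<in> coweights"
        "\<And>\<beta>. \<beta> \<in> \<Phi> \<Longrightarrow> (x \<bullet> \<beta> - z \<bullet> \<beta>) / real p \<in> \<int>" "\<forall>\<beta>\<in>\<Phi>. \<bar>x \<bullet> \<beta>\<bar> \<le> p" by blast
    have "(x \<bullet> \<beta> - y \<bullet> \<beta>) / real p \<in> \<int>" if "\<beta> \<in> \<Phi>" for \<beta>
    proof -
      have "(x \<bullet> \<beta> - y \<bullet> \<beta>) / real p = (x \<bullet> \<beta> - z \<bullet> \<beta>) / real p + (z \<bullet> \<beta> - y \<bullet> \<beta>) / real p"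
        by (simp add: diff_divide_distrib)
      then show ?thesis using x(2)[OF that] zy[OF that] by simp
    qed
    then show ?thesis using x by blast
  qed
qed

lemma coweights_image: "w \<in> W \<Longrightarrow> y \<in> coweights \<Longrightarrow> w y \<in> coweights"
  by (simp add: coweights_def refl_group_adjoint' root_image refl_group_inv)

lemma vanishing_image:
  assumes "w \<in> W"
  shows "vanishing p (w y) = w ` vanishing p y"
proof (intro equalityI subsetI)
  fix \<beta> assume \<beta>: "\<beta> \<in> vanishing p (w y)"
  then have "finv w \<beta> \<in> vanishing p y"
    using assms by (simp add: vanishing_def refl_group_adjoint' root_image refl_group_inv)
  then show "\<beta> \<in> w ` vanishing p y" using assms by (intro image_eqI[of _ _ "finv w \<beta>"]) auto
qed (use assms in \<open>auto simp: vanishing_def root_image refl_group_inner[OF assms]\<close>)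

text \<open>The set of roots vanishing modulo p depends only on the residue class and is carried
  along by the Weyl group, and the same holds for its span. This permits replacing \<open>y\<close>
  by a small dominant coweight.\<close>

theorem good_prime_closed:
  assumes irr: "irreducible_root_system \<Phi>" and good: "good_prime \<Phi> \<Delta> p"
    and y: "y \<in> coweights" and \<gamma>: "\<gamma> \<in> \<Phi>" "\<gamma> \<in> span (vanishing p y)"
  shows "\<gamma> \<in> vanishing p y"
proof -
  have p0: "0 < p" using good prime_gt_0_nat by (simp add: good_prime_def)
  obtain z where z: "z \<in> coweights" "\<And>\<beta>. \<beta> \<in> \<Phi> \<Longrightarrow> (z \<bullet> \<beta> - y \<bullet> \<beta>) / real p \<in> \<int>"
      "\<And>\<beta>. \<beta> \<in> \<Phi> \<Longrightarrow> \<bar>z \<bullet> \<beta>\<bar> \<le> p"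
    using small_representative[OF y p0] by blast
  have "z \<bullet> \<beta> / p \<in> \<int> \<longleftrightarrow> y \<bullet> \<beta> / p \<in> \<int>" if "\<beta> \<in> \<Phi>" for \<beta>
  proof -
    have "z \<bullet> \<beta> / p = (z \<bullet> \<beta> - y \<bullet> \<beta>) / p + y \<bullet> \<beta> / p"
      "y \<bullet> \<beta> / p = z \<bullet> \<beta> / p - (z \<bullet> \<beta> - y \<bullet> \<beta>) / p" by (simp_all add: diff_divide_distrib)
    then show ?thesis using z(2)[OF that] Ints_add Ints_diff by metis
  qed
  then have eq: "vanishing p z = vanishing p y" by (auto simp: vanishing_def)
  obtain w where w: "w \<in> W" "dominant_for \<Delta> (w z)" using exists_dominant[of \<Delta> z] W_eq by auto
  have "w \<gamma> \<in> vanishing p (w z)"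
  proof (rule good_prime_closed_dominant[OF irr good coweights_image[OF w(1) z(1)] w(2)])
    show "\<bar>w z \<bullet> \<beta>\<bar> \<le> p" if "\<beta> \<in> \<Phi>" for \<beta>
      using z(3) root_image[OF refl_group_inv[OF w(1)] that] refl_group_adjoint'[OF w(1)] by simp
    show "w \<gamma> \<in> \<Phi>" using root_image w \<gamma> by blast
    show "w \<gamma> \<in> span (vanishing p (w z))"
      using \<gamma>(2) by (simp add: vanishing_image[OF w(1)] linear_span_image[OF refl_group_linear[OF w(1)]] eq)
  qed
  then have "\<gamma> \<in> vanishing p z" using \<gamma>(1) by (simp add: vanishing_def refl_group_inner[OF w(1)])
  then show ?thesis unfolding eq .
qed

end

context based_root_system
begin

section \<open>Counting points modulo a prime\<close>

text \<open>A residue class is recorded by its values on all roots, not just simple ones, so that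
  the Weyl group acts by precomposition. The value 0 off \<open>\<Phi>\<close> makes equality of
  classes equality of functions; on coweights the floor changes nothing.\<close>

definition residues :: "nat \<Rightarrow> 'a \<Rightarrow> 'a \<Rightarrow> int" where
  "residues p y = (\<lambda>\<beta>. if \<beta> \<in> \<Phi> then \<lfloor>y \<bullet> \<beta>\<rfloor> mod int p else 0)"

definition points_vanishing_on :: "nat \<Rightarrow> 'a set \<Rightarrow> ('a \<Rightarrow> int) set" where
  "points_vanishing_on p R = {c \<in> residues p ` coweights. \<forall>\<beta>\<in>R. c \<beta> = 0}"

lemma residues_eq_iff:
  assumes "0 < p" "y \<in> coweights" "z \<in> coweights" "\<beta> \<in> \<Phi>"
  shows "residues p y \<beta> = residues p z \<beta> \<longleftrightarrow> (y - z) \<bullet> \<beta> / p \<in> \<int>"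
  using floor_mod_eq_iff[of "y \<bullet> \<beta>" "z \<bullet> \<beta>" "int p"] assms coweight_int
  by (simp add: residues_def inner_diff_left)

lemma residues_eq_0_iff:
  assumes "0 < p" "y \<in> coweights" "\<beta> \<in> \<Phi>"
  shows "residues p y \<beta> = 0 \<longleftrightarrow> \<beta> \<in> vanishing p y"
  using floor_mod_eq_iff[of "y \<bullet> \<beta>" 0 "int p"] assms coweight_int
  by (simp add: residues_def vanishing_def)

lemma int_on_levi:
  assumes "K \<subseteq> \<Delta>" "\<And>\<alpha>. \<alpha> \<in> K \<Longrightarrow> (\<alpha> \<bullet> y) / p \<in> \<int>" "\<beta> \<in> levi K"
  shows "(\<beta> \<bullet> y) / p \<in> \<int>"
proof -
  have "(\<beta> \<bullet> y) / p = (\<Sum>\<alpha>\<in>K. (\<beta> \<bullet> dual_basis \<alpha>) * ((\<alpha> \<bullet> y) / p))"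
    using levi_expansion[OF assms(1,3), of y] by (simp add: sum_divide_distrib)
  also have "\<dots> \<in> \<int>"
    using assms levi_roots by (intro Ints_sum Ints_mult coef_int) auto
  finally show ?thesis .
qed

lemma levi_all: "levi \<Delta> = \<Phi>"
  by (auto simp: levi_def)

lemma residues_ext:
  assumes "0 < p" "y \<in> coweights" "z \<in> coweights" "\<And>\<alpha>. \<alpha> \<in> \<Delta> \<Longrightarrow> residues p y \<alpha> = residues p z \<alpha>"
  shows "residues p y = residues p z"
proof
  fix \<beta>
  have "(\<alpha> \<bullet> (y - z)) / p \<in> \<int>" if "\<alpha> \<in> \<Delta>" for \<alpha>
    using assms residues_eq_iff[of p y z \<alpha>] that base_roots by (auto simp: inner_commute)
  then have "(\<beta> \<bullet> (y - z)) / p \<in> \<int>" if "\<beta> \<in> \<Phi>"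
    using int_on_levi[of \<Delta> "y - z" "real p" \<beta>] that levi_all by auto
  then show "residues p y \<beta> = residues p z \<beta>"
    using residues_eq_iff[OF assms(1-3), of \<beta>] by (cases "\<beta> \<in> \<Phi>") (auto simp: inner_commute residues_def)
qed

lemma coweightsI: "(\<And>\<alpha>. \<alpha> \<in> \<Delta> \<Longrightarrow> y \<bullet> \<alpha> \<in> \<int>) \<Longrightarrow> y \<in> coweights"
  using int_on_levi[of \<Delta> y 1] levi_all by (simp add: coweights_def inner_commute)

text \<open>A class is determined by its values on the simple roots, and the remaining ones outside
  \<open>K\<close> are free: the combination of fundamental coweights with prescribed integer
  coefficients realises them.\<close>

lemma card_points_vanishing_on_base:
  assumes p: "0 < p" and K: "K \<subseteq> \<Delta>"
  shows "card (points_vanishing_on p K) = p ^ card (\<Delta> - K)"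
proof -
  let ?r = "\<lambda>c. restrict c (\<Delta> - K)"
  have "bij_betw ?r (points_vanishing_on p K) (\<Delta> - K \<rightarrow>\<^sub>E {0..<int p})"
  proof (rule bij_betw_imageI)
    show "inj_on ?r (points_vanishing_on p K)"
    proof (rule inj_onI)
      fix c d assume cd: "c \<in> points_vanishing_on p K" "d \<in> points_vanishing_on p K" "?r c = ?r d"
      obtain y z where yz: "y \<in> coweights" "z \<in> coweights" "c = residues p y" "d = residues p z"
        using cd(1,2) by (auto simp: points_vanishing_on_def)
      have "c \<alpha> = d \<alpha>" if "\<alpha> \<in> \<Delta>" for \<alpha>
      proof (cases "\<alpha> \<in> K")
        case True
        then show ?thesis using cd(1,2) by (simp add: points_vanishing_on_def)
      next
        case False
        then show ?thesis using fun_cong[OF cd(3), of \<alpha>] that by simp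
      qed
      then show "c = d" unfolding yz using residues_ext[OF p yz(1,2)] yz(3,4) by blast
    qed
    show "?r ` points_vanishing_on p K = (\<Delta> - K \<rightarrow>\<^sub>E {0..<int p})"
    proof (intro equalityI subsetI)
      fix f assume "f \<in> ?r ` points_vanishing_on p K"
      then obtain y where f: "f = ?r (residues p y)" unfolding points_vanishing_on_def by blast
      have "residues p y \<alpha> \<in> {0..<int p}" for \<alpha> using p by (simp add: residues_def)
      then show "f \<in> (\<Delta> - K \<rightarrow>\<^sub>E {0..<int p})" unfolding f by (intro restrict_PiE_iff[THEN iffD2] ballI)
    next
      fix f assume f: "f \<in> (\<Delta> - K \<rightarrow>\<^sub>E {0..<int p})"
      define y where "y = (\<Sum>\<alpha>\<in>\<Delta> - K. of_int (f \<alpha>) *\<^sub>R dual_basis \<alpha>)"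
      have y\<alpha>: "y \<bullet> \<alpha> = (if \<alpha> \<in> K then 0 else of_int (f \<alpha>))" if "\<alpha> \<in> \<Delta>" for \<alpha>
      proof -
        have "y \<bullet> \<alpha> = (\<Sum>\<gamma>\<in>\<Delta> - K. if \<gamma> = \<alpha> then of_int (f \<gamma>) else 0)"
          unfolding y_def inner_sum_left
          by (intro sum.cong refl) (simp add: inner_commute[of _ \<alpha>] inner_base_dual_basis[OF that])
        also have "\<dots> = (if \<alpha> \<in> K then 0 else of_int (f \<alpha>))" using that finite_base by simp
        finally show ?thesis .
      qed
      then have yc: "y \<in> coweights" by (intro coweightsI) auto
      have res: "residues p y \<alpha> = (if \<alpha> \<in> K then 0 else f \<alpha>)" if "\<alpha> \<in> \<Delta>" for \<alpha>
      proof -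
        have "\<alpha> \<in> \<Phi>" using that base_roots by blast
        moreover have "f \<alpha> mod int p = f \<alpha>" if "\<alpha> \<notin> K"
          using PiE_mem[OF f, of \<alpha>] that \<open>\<alpha> \<in> \<Delta>\<close> by simp
        ultimately show ?thesis using y\<alpha>[OF that] by (simp add: residues_def)
      qed
      have "residues p y \<in> points_vanishing_on p K"
        using yc K res unfolding points_vanishing_on_def by auto
      moreover have "f = ?r (residues p y)"
        by (rule PiE_ext[OF f]) (use res f in \<open>auto simp: PiE_iff\<close>)
      ultimately show "f \<in> ?r ` points_vanishing_on p K" by blast
    qed
  qed
  then have "card (points_vanishing_on p K) = card (\<Delta> - K \<rightarrow>\<^sub>E {0..<int p})"
    by (rule bij_betw_same_card)
  also have "\<dots> = p ^ card (\<Delta> - K)" using finite_base by (simp add: card_PiE)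
  finally show ?thesis .
qed

text \<open>Roots of the subsystem are integer combinations of \<open>K\<close>, so divisibility by
  p passes from \<open>K\<close> to all of them.\<close>

lemma points_vanishing_on_levi:
  assumes "0 < p" "K \<subseteq> \<Delta>"
  shows "points_vanishing_on p (levi K) = points_vanishing_on p K"
proof -
  have "residues p y \<beta> = 0" if "y \<in> coweights" "\<forall>\<alpha>\<in>K. residues p y \<alpha> = 0" "\<beta> \<in> levi K" for y \<beta>
  proof -
    have "(\<alpha> \<bullet> y) / p \<in> \<int>" if "\<alpha> \<in> K" for \<alpha>
    proof -
      have "\<alpha> \<in> \<Phi>" using that assms(2) base_roots by blast
      then show ?thesis
        using residues_eq_0_iff[OF assms(1) \<open>y \<in> coweights\<close>, of \<alpha>] that \<open>\<forall>\<alpha>\<in>K. residues p y \<alpha> = 0\<close>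
        by (simp add: vanishing_def inner_commute)
    qed
    then have "(\<beta> \<bullet> y) / p \<in> \<int>" using int_on_levi[OF assms(2)] that(3) by blast
    moreover have "\<beta> \<in> \<Phi>" using that(3) levi_roots by blast
    ultimately show ?thesis
      using residues_eq_0_iff[OF assms(1) that(1)] by (simp add: vanishing_def inner_commute)
  qed
  then show ?thesis using subbase_levi[OF assms(2)] by (auto simp: points_vanishing_on_def)
qed

lemma residues_comp:
  assumes "w \<in> W"
  shows "residues p y \<circ> w = residues p (finv w y)"
proof
  fix \<beta>
  have "finv w y \<bullet> \<beta> = y \<bullet> w \<beta>" by (rule refl_group_adjoint[OF assms])
  then show "(residues p y \<circ> w) \<beta> = residues p (finv w y) \<beta>"
    by (simp add: residues_def root_image_iff[OF assms])
qed

lemma residues_comp_image: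
  "c \<in> residues p ` coweights \<Longrightarrow> w \<in> W \<Longrightarrow> c \<circ> w \<in> residues p ` coweights"
  using residues_comp[of w p] coweights_image[OF refl_group_inv[of w]] by auto

lemma card_points_vanishing_on_image:
  assumes w: "w \<in> W"
  shows "card (points_vanishing_on p (w ` R)) = card (points_vanishing_on p R)"
proof -
  have "bij_betw (\<lambda>c. c \<circ> w) (points_vanishing_on p (w ` R)) (points_vanishing_on p R)"
  proof (rule bij_betwI[where g = "\<lambda>c. c \<circ> finv w"])
    show "(\<lambda>c. c \<circ> w) \<in> points_vanishing_on p (w ` R) \<rightarrow> points_vanishing_on p R"
    proof
      fix c assume "c \<in> points_vanishing_on p (w ` R)"
      then show "c \<circ> w \<in> points_vanishing_on p R"
        using residues_comp_image[of c p w] w unfolding points_vanishing_on_def by simp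
    qed
    show "(\<lambda>c. c \<circ> finv w) \<in> points_vanishing_on p R \<rightarrow> points_vanishing_on p (w ` R)"
    proof
      fix c assume "c \<in> points_vanishing_on p R"
      then show "c \<circ> finv w \<in> points_vanishing_on p (w ` R)"
        using residues_comp_image[of c p "finv w"] w refl_group_inv[OF w] unfolding points_vanishing_on_def by simp
    qed
  qed (use w in \<open>auto simp: fun_eq_iff\<close>)
  then show ?thesis by (rule bij_betw_same_card)
qed

lemma perp_lattice:
  assumes "R \<subseteq> \<Phi>"
  shows "perp R \<in> intersection_lattice (root_arrangement \<Phi>)"
proof -
  have "perp R = \<Inter>((\<lambda>\<beta>. {v. v \<bullet> \<beta> = 0}) ` R)" by (auto simp: perp_def)
  moreover have "(\<lambda>\<beta>. {v. v \<bullet> \<beta> = 0}) ` R \<subseteq> root_arrangement \<Phi>"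
    using assms unfolding root_arrangement_def by blast
  ultimately show ?thesis unfolding intersection_lattice_def by blast
qed

lemma root_arrangement_image: "root_arrangement \<Phi> = (\<lambda>\<alpha>. {v. v \<bullet> \<alpha> = 0}) ` \<Phi>"
  by (auto simp: root_arrangement_def)

lemma finite_arrangement: "finite (root_arrangement \<Phi>)"
  using finite_roots by (simp add: root_arrangement_image)

lemma finite_lattice: "finite (intersection_lattice (root_arrangement \<Phi>))"
proof -
  have "intersection_lattice (root_arrangement \<Phi>) = Inter ` Pow (root_arrangement \<Phi>)"
    by (auto simp: intersection_lattice_def)
  then show ?thesis using finite_arrangement by simp
qed

text \<open>The open stratum of a flat modulo p: its classes are those whose vanishing roots cut out
  exactly that flat over the reals.\<close>

definition stratum_count :: "nat \<Rightarrow> 'a set \<Rightarrow> real" where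
  "stratum_count p X = real (card {c \<in> residues p ` coweights. perp {\<beta> \<in> \<Phi>. c \<beta> = 0} = X})"

lemma finite_points:
  assumes "0 < p"
  shows "finite (residues p ` coweights)"
proof -
  have "card (points_vanishing_on p {}) > 0"
    using card_points_vanishing_on_base[OF assms, of "{}"] assms by simp
  then have "finite (points_vanishing_on p {})" using card_ge_0_finite by blast
  then show ?thesis by (simp add: points_vanishing_on_def)
qed

text \<open>The finite field method. The open strata below \<open>X\<close> partition a closed
  stratum, which becomes countable once it is described by vanishing on the roots orthogonal to
  \<open>X\<close>.\<close>

lemma sum_stratum_count:
  assumes irr: "irreducible_root_system \<Phi>" and good: "good_prime \<Phi> \<Delta> p"
    and X: "X \<in> intersection_lattice (root_arrangement \<Phi>)"
  shows "(\<Sum>Y\<in>{Y \<in> intersection_lattice (root_arrangement \<Phi>). Y \<subseteq> X}. stratum_count p Y) = real p ^ dim X"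
proof -
  let ?L = "intersection_lattice (root_arrangement \<Phi>)"
  let ?P = "residues p ` coweights"
  let ?z = "\<lambda>c::'a \<Rightarrow> int. perp {\<beta> \<in> \<Phi>. c \<beta> = 0}"
  have p: "0 < p" using good prime_gt_0_nat by (simp add: good_prime_def)
  obtain w K where wK: "w \<in> W" "K \<subseteq> \<Delta>" "X = w ` perp K" using X intersection_lattice_eq by auto
  have fin: "finite ?P" by (rule finite_points[OF p])
  have zL: "?z c \<in> ?L" for c by (intro perp_lattice) auto
  \<comment> \<open>The forward direction is where goodness is used: a root orthogonal to
    \<open>X\<close> is then in the real span of the vanishing roots, but must itself vanish modulo
    p.\<close>
  have iff: "?z c \<subseteq> X \<longleftrightarrow> (\<forall>\<beta>\<in>w ` levi K. c \<beta> = 0)" if c: "c \<in> ?P" for c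
  proof
    assume sub: "?z c \<subseteq> X"
    obtain y where y: "y \<in> coweights" "c = residues p y" using c by blast
    have zy: "{\<beta> \<in> \<Phi>. c \<beta> = 0} = vanishing p y"
      using residues_eq_0_iff[OF p y(1)] by (auto simp: y(2) vanishing_def)
    show "\<forall>\<beta>\<in>w ` levi K. c \<beta> = 0"
    proof
      fix \<beta> assume \<beta>: "\<beta> \<in> w ` levi K"
      then obtain \<delta> where \<delta>: "\<delta> \<in> levi K" "\<beta> = w \<delta>" by blast
      have \<beta>\<Phi>: "\<beta> \<in> \<Phi>" using \<delta> levi_roots root_image wK(1) by blast
      have "v \<bullet> \<beta> = 0" if v: "v \<in> perp (vanishing p y)" for v
      proof -
        have "v \<in> w ` perp K" using v sub zy wK(3) by auto
        then obtain u where "u \<in> perp K" "v = w u" by blast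
        moreover have "u \<bullet> \<delta> = 0" if "u \<in> perp K" for u
          using \<delta>(1) levi_iff_perp[OF wK(2), of \<delta>] levi_roots that by blast
        ultimately show ?thesis using \<delta>(2) by (simp add: refl_group_inner[OF wK(1)])
      qed
      then have "\<beta> \<in> span (vanishing p y)" by (rule in_span_if_perp)
      then have "\<beta> \<in> vanishing p y" using good_prime_closed[OF irr good y(1) \<beta>\<Phi>] by blast
      then show "c \<beta> = 0" using residues_eq_0_iff[OF p y(1) \<beta>\<Phi>] y(2) by simp
    qed
  next
    assume "\<forall>\<beta>\<in>w ` levi K. c \<beta> = 0"
    moreover have "w ` K \<subseteq> w ` levi K" using subbase_levi[OF wK(2)] by blast
    moreover have "w ` K \<subseteq> \<Phi>" using wK root_image base_roots by blast
    ultimately have "w ` K \<subseteq> {\<beta> \<in> \<Phi>. c \<beta> = 0}" by blast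
    then show "?z c \<subseteq> X" unfolding wK(3) image_perp[OF wK(1)] by (auto simp: perp_def)
  qed
  have "(\<Sum>Y\<in>{Y \<in> ?L. Y \<subseteq> X}. card {c \<in> ?P. ?z c = Y}) = card (\<Union>Y\<in>{Y \<in> ?L. Y \<subseteq> X}. {c \<in> ?P. ?z c = Y})"
    by (rule card_UN_disjoint[symmetric]) (use finite_lattice fin in auto)
  also have "(\<Union>Y\<in>{Y \<in> ?L. Y \<subseteq> X}. {c \<in> ?P. ?z c = Y}) = {c \<in> ?P. ?z c \<subseteq> X}"
    using zL by auto
  also have "\<dots> = points_vanishing_on p (w ` levi K)"
    unfolding points_vanishing_on_def using iff by auto
  also have "card \<dots> = p ^ dim X"
    using card_points_vanishing_on_image[OF wK(1)] points_vanishing_on_levi[OF p wK(2)]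
      card_points_vanishing_on_base[OF p wK(2)] dim_perp[OF wK(2)] dim_image_W[OF wK(1)] wK(3) by simp
  finally show ?thesis unfolding stratum_count_def of_nat_sum[symmetric] of_nat_power[symmetric] by simp
qed

lemma upper_char_poly_eq_stratum_count:
  assumes "irreducible_root_system \<Phi>" "good_prime \<Phi> \<Delta> p"
    and "X \<in> intersection_lattice (root_arrangement \<Phi>)"
  shows "upper_char_poly (intersection_lattice (root_arrangement \<Phi>)) X (real p) = stratum_count p X"
  unfolding upper_char_poly_def
  by (rule mobius_inversion_below[OF finite_lattice assms(3)]) (simp add: sum_stratum_count[OF assms(1,2)])

lemma sum_upper_char_poly:
  assumes irr: "irreducible_root_system \<Phi>" and good: "good_prime \<Phi> \<Delta> p"
  shows "(\<Sum>X\<in>intersection_lattice (root_arrangement \<Phi>).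
    upper_char_poly (intersection_lattice (root_arrangement \<Phi>)) X (real p)) = real p ^ DIM('a)"
proof -
  have "UNIV \<in> intersection_lattice (root_arrangement \<Phi>)"
    using perp_lattice[of "{}"] by (simp add: perp_def)
  from sum_stratum_count[OF irr good this] show ?thesis
    by (simp add: upper_char_poly_eq_stratum_count[OF irr good])
qed

end

section \<open>Faces and chambers\<close>

lemma open_half_spaces_hyperplane:
  fixes \<alpha> :: "'a::euclidean_space"
  assumes "\<alpha> \<noteq> 0"
  shows "open_half_spaces {v. v \<bullet> \<alpha> = 0} = {{v. 0 < v \<bullet> \<alpha>}, {v. v \<bullet> \<alpha> < 0}}"
proof (intro equalityI subsetI)
  fix S assume "S \<in> open_half_spaces {v. v \<bullet> \<alpha> = 0}"
  then obtain a where a: "a \<noteq> 0" "{v. v \<bullet> \<alpha> = 0} = {v. v \<bullet> a = 0}" "S = {v. 0 < v \<bullet> a}"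
    by (auto simp: open_half_spaces_def)
  \<comment> \<open>The coefficient of the projection of \<open>a\<close> onto
    \<open>\<alpha>\<close>. The remainder lies in the common hyperplane, hence is orthogonal to
    \<open>\<alpha>\<close> and to \<open>a\<close>, and so to itself.\<close>
  define c where "c = (a \<bullet> \<alpha>) / (\<alpha> \<bullet> \<alpha>)"
  have "(a - c *\<^sub>R \<alpha>) \<bullet> \<alpha> = 0" using assms by (simp add: c_def inner_diff_left)
  moreover from this have "(a - c *\<^sub>R \<alpha>) \<bullet> a = 0" using a(2) by blast
  ultimately have "(a - c *\<^sub>R \<alpha>) \<bullet> (a - c *\<^sub>R \<alpha>) = 0" by (simp only: inner_diff_right inner_scaleR_right)
  then have ac: "a = c *\<^sub>R \<alpha>" by simp
  then have "c > 0 \<or> c < 0" using a(1) by (cases "c = 0") auto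
  then show "S \<in> {{v. 0 < v \<bullet> \<alpha>}, {v. v \<bullet> \<alpha> < 0}}"
    unfolding a(3) ac by (auto simp: zero_less_mult_iff)
next
  fix S assume "S \<in> {{v. 0 < v \<bullet> \<alpha>}, {v. v \<bullet> \<alpha> < 0}}"
  then consider "S = {v. 0 < v \<bullet> \<alpha>}" | "S = {v. 0 < v \<bullet> (- \<alpha>)}" by auto
  then show "S \<in> open_half_spaces {v. v \<bullet> \<alpha> = 0}"
  proof cases
    case 1
    then show ?thesis unfolding open_half_spaces_def using assms by blast
  next
    case 2
    moreover have "{v. v \<bullet> \<alpha> = 0} = {v. v \<bullet> (- \<alpha>) = 0}" by simp
    moreover have "- \<alpha> \<noteq> 0" using assms by simp
    ultimately show ?thesis unfolding open_half_spaces_def by blast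
  qed
qed

definition same_side :: "'a::euclidean_space \<Rightarrow> 'a \<Rightarrow> 'a set" where
  "same_side \<alpha> v = {u. sgn (u \<bullet> \<alpha>) = sgn (v \<bullet> \<alpha>)}"

lemma same_side_cases:
  assumes "\<alpha> \<noteq> 0"
  shows "same_side \<alpha> v = {u. u \<bullet> \<alpha> = 0} \<or> same_side \<alpha> v \<in> open_half_spaces {u. u \<bullet> \<alpha> = 0}"
  unfolding open_half_spaces_hyperplane[OF assms] same_side_def
  by (cases "v \<bullet> \<alpha>" "0::real" rule: linorder_cases) (auto simp: sgn_1_pos sgn_1_neg sgn_0_0)

lemma same_side_unique:
  assumes "\<alpha> \<noteq> 0" "v \<in> S" "S = {u. u \<bullet> \<alpha> = 0} \<or> S \<in> open_half_spaces {u. u \<bullet> \<alpha> = 0}"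
  shows "S = same_side \<alpha> v"
  using assms unfolding open_half_spaces_hyperplane[OF assms(1)] same_side_def
  by (auto simp: sgn_1_pos sgn_1_neg sgn_0_0)

context based_root_system
begin

text \<open>The face through \<open>v\<close>, described by its sign vector on the roots instead of
  a choice function on hyperplanes.\<close>

definition sign_class :: "'a \<Rightarrow> 'a set" where
  "sign_class v = {u. \<forall>\<beta>\<in>\<Phi>. sgn (u \<bullet> \<beta>) = sgn (v \<bullet> \<beta>)}"

lemma sign_class_self: "v \<in> sign_class v"
  by (simp add: sign_class_def)

lemma arrangement_faces_eq_sign_class: "arrangement_faces (root_arrangement \<Phi>) = range sign_class"
proof (intro equalityI subsetI)
  fix F assume "F \<in> arrangement_faces (root_arrangement \<Phi>)"
  then obtain \<sigma> v where \<sigma>: "\<forall>H\<in>root_arrangement \<Phi>. \<sigma> H = H \<or> \<sigma> H \<in> open_half_spaces H"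
      "F = (\<Inter>H\<in>root_arrangement \<Phi>. \<sigma> H)" "v \<in> F"
    unfolding arrangement_faces_def by blast
  have "\<sigma> {u. u \<bullet> \<beta> = 0} = same_side \<beta> v" if "\<beta> \<in> \<Phi>" for \<beta>
  proof (rule same_side_unique[OF root_neq_zero[OF that]])
    have H: "{u. u \<bullet> \<beta> = 0} \<in> root_arrangement \<Phi>" using that unfolding root_arrangement_image by (rule imageI)
    show "v \<in> \<sigma> {u. u \<bullet> \<beta> = 0}" using \<sigma>(3) H unfolding \<sigma>(2) by (rule INT_D)
    show "\<sigma> {u. u \<bullet> \<beta> = 0} = {u. u \<bullet> \<beta> = 0} \<or> \<sigma> {u. u \<bullet> \<beta> = 0} \<in> open_half_spaces {u. u \<bullet> \<beta> = 0}"
      by (rule bspec[OF \<sigma>(1) H])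
  qed
  moreover have "(\<Inter>H\<in>root_arrangement \<Phi>. \<sigma> H) = (\<Inter>\<beta>\<in>\<Phi>. \<sigma> {u. u \<bullet> \<beta> = 0})"
    by (simp add: root_arrangement_image image_image)
  ultimately have "F = sign_class v" unfolding \<sigma>(2) sign_class_def same_side_def by auto
  then show "F \<in> range sign_class" by blast
next
  fix F assume "F \<in> range sign_class"
  then obtain v where F: "F = sign_class v" by blast
  \<comment> \<open>The choice must be a function of the hyperplane, while each hyperplane comes
    from two opposite roots; defining it by the piece that contains \<open>v\<close> avoids
    selecting one of them.\<close>
  define \<sigma> where "\<sigma> H = (THE S. v \<in> S \<and> (S = H \<or> S \<in> open_half_spaces H))" for H :: "'a set"
  have \<sigma>: "\<sigma> {u. u \<bullet> \<beta> = 0} = same_side \<beta> v" if "\<beta> \<in> \<Phi>" for \<beta>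
    unfolding \<sigma>_def
  proof (rule the_equality)
    show "v \<in> same_side \<beta> v \<and> (same_side \<beta> v = {u. u \<bullet> \<beta> = 0} \<or> same_side \<beta> v \<in> open_half_spaces {u. u \<bullet> \<beta> = 0})"
      using same_side_cases[OF root_neq_zero[OF that]] by (simp add: same_side_def)
    show "S = same_side \<beta> v"
      if "v \<in> S \<and> (S = {u. u \<bullet> \<beta> = 0} \<or> S \<in> open_half_spaces {u. u \<bullet> \<beta> = 0})" for S
      using same_side_unique[OF root_neq_zero[OF \<open>\<beta> \<in> \<Phi>\<close>], of v S] that by simp
  qed
  have "\<forall>H\<in>root_arrangement \<Phi>. \<sigma> H = H \<or> \<sigma> H \<in> open_half_spaces H"
  proof
    fix H assume "H \<in> root_arrangement \<Phi>"
    then obtain \<beta> where \<beta>: "\<beta> \<in> \<Phi>" "H = {u. u \<bullet> \<beta> = 0}" unfolding root_arrangement_image by blast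
    show "\<sigma> H = H \<or> \<sigma> H \<in> open_half_spaces H"
      unfolding \<beta>(2) \<sigma>[OF \<beta>(1)] by (rule same_side_cases[OF root_neq_zero[OF \<beta>(1)]])
  qed
  moreover have "(\<Inter>H\<in>root_arrangement \<Phi>. \<sigma> H) = (\<Inter>\<beta>\<in>\<Phi>. same_side \<beta> v)"
    using \<sigma> by (simp add: root_arrangement_image image_image)
  then have "F = (\<Inter>H\<in>root_arrangement \<Phi>. \<sigma> H)"
    unfolding F sign_class_def same_side_def by auto
  moreover have "F \<noteq> {}" using F sign_class_self by blast
  ultimately show "F \<in> arrangement_faces (root_arrangement \<Phi>)"
    unfolding arrangement_faces_def by blast
qed

lemma image_sign_class:
  assumes "w \<in> W"
  shows "w ` sign_class v = sign_class (w v)"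
proof -
  have sub: "g ` sign_class x \<subseteq> sign_class (g x)" if g: "g \<in> W" for g x
    using root_image[OF refl_group_inv[OF g]] by (auto simp: sign_class_def refl_group_adjoint'[OF g])
  have "sign_class (w v) \<subseteq> w ` sign_class v"
  proof
    fix u assume u: "u \<in> sign_class (w v)"
    have "finv w u \<in> sign_class v"
      using sub[OF refl_group_inv[OF assms], of "w v"] u assms by auto
    then show "u \<in> w ` sign_class v" using assms by (intro image_eqI[of _ _ "finv w u"]) auto
  qed
  then show ?thesis using sub[OF assms] by blast
qed

text \<open>Signs on simple roots determine the signs on all roots: a positive root pairs to 0 with
  the face exactly when it lies in the subsystem of \<open>K\<close>, and otherwise
  positively.\<close>

lemma sign_class_standard:
  assumes K: "K \<subseteq> \<Delta>" and v: "v \<in> standard_face \<Delta> K"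
  shows "sign_class v = standard_face \<Delta> K"
proof (intro equalityI subsetI)
  fix u assume u: "u \<in> sign_class v"
  have sgn_eq: "sgn (u \<bullet> \<alpha>) = sgn (v \<bullet> \<alpha>)" if "\<alpha> \<in> \<Delta>" for \<alpha>
    using u that base_roots by (auto simp: sign_class_def)
  have "u \<bullet> \<alpha> = 0" if "\<alpha> \<in> K" for \<alpha>
  proof -
    have "v \<bullet> \<alpha> = 0" "\<alpha> \<in> \<Delta>" using v that K by (auto simp: standard_face_def)
    then show ?thesis using sgn_eq[of \<alpha>] by (simp add: sgn_0_0)
  qed
  moreover have "0 < u \<bullet> \<alpha>" if "\<alpha> \<in> \<Delta> - K" for \<alpha>
  proof -
    have "0 < v \<bullet> \<alpha>" "\<alpha> \<in> \<Delta>" using v that by (auto simp: standard_face_def)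
    then show ?thesis using sgn_eq[of \<alpha>] by (simp add: sgn_1_pos)
  qed
  ultimately show "u \<in> standard_face \<Delta> K" by (simp add: standard_face_def)
next
  fix u assume u: "u \<in> standard_face \<Delta> K"
  have eq: "sgn (u \<bullet> \<beta>) = sgn (v \<bullet> \<beta>)" if \<beta>: "\<beta> \<in> pos" for \<beta>
  proof (cases "\<beta> \<in> levi K")
    case True
    then have "\<beta> \<bullet> u = 0" "\<beta> \<bullet> v = 0" using levi_iff[OF K] u v \<beta> pos_root by blast+
    then show ?thesis by (simp add: inner_commute)
  next
    case False
    then have "\<beta> \<bullet> u \<noteq> 0" "\<beta> \<bullet> v \<noteq> 0" using levi_iff[OF K] u v \<beta> pos_root by blast+
    moreover have "0 \<le> \<beta> \<bullet> u" "0 \<le> \<beta> \<bullet> v"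
      using dominant_pos[OF standard_face_dominant \<beta>] u v by blast+
    ultimately show ?thesis by (simp add: inner_commute)
  qed
  have "sgn (u \<bullet> \<beta>) = sgn (v \<bullet> \<beta>)" if \<beta>: "\<beta> \<in> \<Phi>" for \<beta>
  proof (cases "\<beta> \<in> pos")
    case True
    then show ?thesis by (rule eq)
  next
    case False
    then have "- \<beta> \<in> pos" using not_pos_iff[OF \<beta>] by blast
    from eq[OF this] show ?thesis by (simp add: sgn_minus)
  qed
  then show "u \<in> sign_class v" by (simp add: sign_class_def)
qed

lemma sign_class_eq_standard:
  "\<exists>w\<in>W. \<exists>K. K \<subseteq> \<Delta> \<and> w v \<in> standard_face \<Delta> K \<and> sign_class v = finv w ` standard_face \<Delta> K"
proof -
  obtain w where w: "w \<in> W" "dominant_for \<Delta> (w v)" using exists_dominant[of \<Delta> v] W_eq by auto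
  let ?K = "{\<alpha> \<in> \<Delta>. w v \<bullet> \<alpha> = 0}"
  have wv: "w v \<in> standard_face \<Delta> ?K" using w(2) by (rule dominant_standard_face)
  have "finv w ` standard_face \<Delta> ?K = finv w ` sign_class (w v)"
    using sign_class_standard[OF _ wv] by auto
  also have "\<dots> = sign_class v" using image_sign_class[OF refl_group_inv[OF w(1)], of "w v"] w(1) by simp
  finally show ?thesis using w wv by (intro bexI[of _ w] exI[of _ ?K]) auto
qed

lemma arrangement_faces_eq:
  "arrangement_faces (root_arrangement \<Phi>) = {w ` standard_face \<Delta> K | w K. w \<in> W \<and> K \<subseteq> \<Delta>}"
  unfolding arrangement_faces_eq_sign_class
proof (intro equalityI subsetI)
  fix F assume "F \<in> range sign_class"
  then show "F \<in> {w ` standard_face \<Delta> K | w K. w \<in> W \<and> K \<subseteq> \<Delta>}"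
    using sign_class_eq_standard refl_group_inv by blast
next
  fix F assume "F \<in> {w ` standard_face \<Delta> K | w K. w \<in> W \<and> K \<subseteq> \<Delta>}"
  then obtain w K where wK: "w \<in> W" "K \<subseteq> \<Delta>" "F = w ` standard_face \<Delta> K" by blast
  then have "F = sign_class (w (face_point K))"
    using image_sign_class[OF wK(1)] sign_class_standard[OF wK(2) face_point_in[OF wK(2)]] by metis
  then show "F \<in> range sign_class" by blast
qed

text \<open>Pulled back to standard position, a common point gives two dominant vectors in one
  orbit. These coincide, their zeros recover \<open>K\<close>, and the connecting element lies in
  the stabilizer; so faces correspond to cosets.\<close>

lemma standard_face_image_eq:
  assumes w: "w \<in> W" "w' \<in> W" and K: "K \<subseteq> \<Delta>" "J \<subseteq> \<Delta>"
    and eq: "w ` standard_face \<Delta> K = w' ` standard_face \<Delta> J"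
  shows "K = J" "finv w' \<circ> w \<in> refl_group K"
proof -
  let ?x = "face_point K" and ?g = "finv w' \<circ> w"
  have x: "?x \<in> standard_face \<Delta> K" by (rule face_point_in[OF K(1)])
  then have "w ?x \<in> w' ` standard_face \<Delta> J" using eq by blast
  then obtain y where y: "y \<in> standard_face \<Delta> J" "w ?x = w' y" by blast
  have g: "?g \<in> W" using w by (intro refl_group_comp refl_group_inv)
  have gx: "?g ?x = y" using y(2) w(2) by simp
  have dom: "dominant_for \<Delta> (?g ?x)" unfolding gx by (rule standard_face_dominant[OF y(1)])
  have "?g ?x = ?x" by (rule stabilizer_face_point(1)[OF K(1) x g dom])
  then have "?x = y" using gx by simp
  then show "K = J" using standard_face_zeros[OF K(1) x] standard_face_zeros[OF K(2) y(1)] by simp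
  show "?g \<in> refl_group K" by (rule stabilizer_face_point(2)[OF K(1) x g dom])
qed

lemma refl_group_fixes_standard_face: "g \<in> refl_group K \<Longrightarrow> g ` standard_face \<Delta> K = standard_face \<Delta> K"
proof -
  assume g: "g \<in> refl_group K"
  have "g x = x" if "x \<in> standard_face \<Delta> K" for x
    using refl_group_fixes_perp[OF g] that standard_face_subset_perp by blast
  then show ?thesis by simp
qed

lemma standard_face_stabilizer:
  assumes "K \<subseteq> \<Delta>"
  shows "{w \<in> W. w ` standard_face \<Delta> K = standard_face \<Delta> K} = refl_group K"
proof (intro equalityI subsetI)
  fix w assume "w \<in> {w \<in> W. w ` standard_face \<Delta> K = standard_face \<Delta> K}"
  then have "w \<in> W" "w ` standard_face \<Delta> K = id ` standard_face \<Delta> K" by auto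
  from standard_face_image_eq(2)[OF this(1) refl_group_id assms assms this(2)]
  show "w \<in> refl_group K" by simp
next
  fix w assume w: "w \<in> refl_group K"
  then show "w \<in> {w \<in> W. w ` standard_face \<Delta> K = standard_face \<Delta> K}"
    using subgroup_W[OF assms w] refl_group_fixes_standard_face[OF w] by simp
qed

section \<open>Chambers as images of the fundamental chamber\<close>

lemma refl_group_empty: "refl_group {} = {id}"
  by (simp add: refl_group_def)

lemma fundamental_chamber_eq: "fundamental_chamber \<Delta> = standard_face \<Delta> {}"
  by (simp add: fundamental_chamber_def standard_face_def)

lemma chamber_image_inj:
  assumes "w \<in> W" "u \<in> W" "w ` fundamental_chamber \<Delta> = u ` fundamental_chamber \<Delta>"
  shows "w = u"
proof -
  have "finv u \<circ> w = id"
    using standard_face_image_eq(2)[OF assms(1,2) empty_subsetI empty_subsetI] assms(3)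
    by (simp add: fundamental_chamber_eq refl_group_empty)
  show ?thesis
  proof
    fix v
    have "u ((finv u \<circ> w) v) = u v" unfolding \<open>finv u \<circ> w = id\<close> by simp
    then show "w v = u v" using assms(2) by simp
  qed
qed

lemma rho_in_chamber: "\<rho> \<in> standard_face \<Delta> {}"
  by (simp add: standard_face_def inner_commute[of \<rho>] base_inner_rho)

lemma chamber_eq_sign_class: "w \<in> W \<Longrightarrow> w ` fundamental_chamber \<Delta> = sign_class (w \<rho>)"
  using sign_class_standard[OF empty_subsetI rho_in_chamber] image_sign_class[of w \<rho>]
  by (simp add: fundamental_chamber_eq)

lemma convex_sign_class: "convex (sign_class v)"
proof -
  have "sign_class v = (\<Inter>\<beta>\<in>\<Phi>. same_side \<beta> v)" by (auto simp: sign_class_def same_side_def)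
  moreover have "convex (same_side \<beta> v)" if \<beta>: "\<beta> \<in> \<Phi>" for \<beta>
  proof -
    consider "same_side \<beta> v = {u. \<beta> \<bullet> u = 0}" | "same_side \<beta> v = {u. \<beta> \<bullet> u > 0}"
      | "same_side \<beta> v = {u. \<beta> \<bullet> u < 0}"
      using same_side_cases[OF root_neq_zero[OF \<beta>], of v]
      unfolding open_half_spaces_hyperplane[OF root_neq_zero[OF \<beta>]] by (auto simp: inner_commute)
    then show ?thesis
      by cases (simp_all add: convex_hyperplane convex_halfspace_gt convex_halfspace_lt)
  qed
  ultimately show ?thesis by (auto intro: convex_INT)
qed

lemma complement_arrangement: "- \<Union>(root_arrangement \<Phi>) = {v. \<forall>\<beta>\<in>\<Phi>. v \<bullet> \<beta> \<noteq> 0}"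
  unfolding root_arrangement_def by auto

text \<open>Sign classes are convex, hence connected; conversely a connected set that avoids a
  hyperplane cannot meet both of its sides.\<close>

lemma component_eq_sign_class:
  assumes v: "\<forall>\<beta>\<in>\<Phi>. v \<bullet> \<beta> \<noteq> 0"
  shows "connected_component_set (- \<Union>(root_arrangement \<Phi>)) v = sign_class v"
proof
  have "sign_class v \<subseteq> - \<Union>(root_arrangement \<Phi>)"
    unfolding complement_arrangement sign_class_def using v by (auto simp: sgn_0_0)
  then show "sign_class v \<subseteq> connected_component_set (- \<Union>(root_arrangement \<Phi>)) v"
    by (intro connected_component_maximal sign_class_self convex_connected convex_sign_class)
  show "connected_component_set (- \<Union>(root_arrangement \<Phi>)) v \<subseteq> sign_class v"
  proof
    fix u assume "u \<in> connected_component_set (- \<Union>(root_arrangement \<Phi>)) v"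
    then obtain T where T: "connected T" "T \<subseteq> - \<Union>(root_arrangement \<Phi>)" "v \<in> T" "u \<in> T"
      by (auto simp: connected_component_def)
    have "sgn (u \<bullet> \<beta>) = sgn (v \<bullet> \<beta>)" if "\<beta> \<in> \<Phi>" for \<beta>
    proof -
      have nz: "\<beta> \<bullet> x \<noteq> 0" if "x \<in> T" for x
        using T(2) that \<open>\<beta> \<in> \<Phi>\<close> unfolding complement_arrangement by (auto simp: inner_commute)
      have "\<not> (\<beta> \<bullet> x \<le> 0 \<and> 0 \<le> \<beta> \<bullet> y)" if "x \<in> T" "y \<in> T" for x y
        using connected_ivt_hyperplane[OF T(1) that] nz by blast
      from this[OF T(3,4)] this[OF T(4,3)] nz[OF T(3)] nz[OF T(4)]
      show ?thesis by (auto simp: sgn_if inner_commute)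
    qed
    then show "u \<in> sign_class v" by (simp add: sign_class_def)
  qed
qed

lemma chambers_eq: "chambers (root_arrangement \<Phi>) = {w ` fundamental_chamber \<Delta> | w. w \<in> W}"
proof (intro equalityI subsetI)
  fix D assume "D \<in> chambers (root_arrangement \<Phi>)"
  then obtain v where v: "\<forall>\<beta>\<in>\<Phi>. v \<bullet> \<beta> \<noteq> 0" "D = sign_class v"
    unfolding chambers_def components_def using component_eq_sign_class complement_arrangement by auto
  obtain w K where w: "w \<in> W" "K \<subseteq> \<Delta>" "w v \<in> standard_face \<Delta> K" "sign_class v = finv w ` standard_face \<Delta> K"
    using sign_class_eq_standard by blast
  have "K = {}"
  proof (rule ccontr)
    assume "K \<noteq> {}"
    then obtain \<alpha> where \<alpha>: "\<alpha> \<in> K" by blast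
    then have "w v \<bullet> \<alpha> = 0" using w(3) by (simp add: standard_face_def)
    then have "v \<bullet> finv w \<alpha> = 0" using refl_group_adjoint'[OF w(1)] by simp
    moreover have "finv w \<alpha> \<in> \<Phi>" using \<alpha> w base_roots root_image refl_group_inv by blast
    ultimately show False using v by blast
  qed
  then show "D \<in> {w ` fundamental_chamber \<Delta> | w. w \<in> W}"
    using w v refl_group_inv[OF w(1)] unfolding fundamental_chamber_eq by blast
next
  fix D assume "D \<in> {w ` fundamental_chamber \<Delta> | w. w \<in> W}"
  then obtain w where w: "w \<in> W" "D = sign_class (w \<rho>)" using chamber_eq_sign_class by blast
  have "\<forall>\<beta>\<in>\<Phi>. w \<rho> \<bullet> \<beta> \<noteq> 0"
  proof
    fix \<beta> assume "\<beta> \<in> \<Phi>"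
    then have "finv w \<beta> \<in> \<Phi>" using w root_image refl_group_inv by blast
    then show "w \<rho> \<bullet> \<beta> \<noteq> 0"
      using root_height_neq_zero refl_group_adjoint'[OF w(1), of \<rho> \<beta>] by (metis inner_commute)
  qed
  then show "D \<in> chambers (root_arrangement \<Phi>)"
    unfolding chambers_def components_def using component_eq_sign_class[of "w \<rho>"] w(2)
    by (auto simp: complement_arrangement)
qed

text \<open>If the closure contains the face, pulling \<open>face_point K\<close> back to the
  fundamental chamber leaves it dominant, which places the connecting element in its stabilizer.
  Conversely, points of the face become chamber points after an arbitrarily small shift along
  \<open>\<rho>\<close>.\<close>

lemma standard_face_subset_closure:
  assumes w: "w \<in> W" and u: "u \<in> W" and K: "K \<subseteq> \<Delta>"
  shows "w ` standard_face \<Delta> K \<subseteq> closure (u ` fundamental_chamber \<Delta>) \<longleftrightarrow> finv u \<circ> w \<in> refl_group K"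
proof
  let ?g = "finv u \<circ> w" and ?x = "face_point K"
  have g: "?g \<in> W" using w u by (intro refl_group_comp refl_group_inv)
  have x: "?x \<in> standard_face \<Delta> K" by (rule face_point_in[OF K])
  assume "w ` standard_face \<Delta> K \<subseteq> closure (u ` fundamental_chamber \<Delta>)"
  then have "w ?x \<in> closure (u ` fundamental_chamber \<Delta>)" using x by blast
  moreover have "closure (u ` fundamental_chamber \<Delta>) \<subseteq> (\<Inter>\<alpha>\<in>\<Delta>. {y. 0 \<le> u \<alpha> \<bullet> y})"
  proof (rule closure_minimal)
    show "u ` fundamental_chamber \<Delta> \<subseteq> (\<Inter>\<alpha>\<in>\<Delta>. {y. 0 \<le> u \<alpha> \<bullet> y})"
      by (auto simp: fundamental_chamber_def refl_group_inner[OF u] inner_commute less_imp_le)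
    show "closed (\<Inter>\<alpha>\<in>\<Delta>. {y. 0 \<le> u \<alpha> \<bullet> y})"
      using closed_halfspace_ge[of 0] by (intro closed_INT ballI) auto
  qed
  ultimately have "\<forall>\<alpha>\<in>\<Delta>. 0 \<le> u \<alpha> \<bullet> w ?x" by blast
  then have "dominant_for \<Delta> (?g ?x)"
    by (simp add: dominant_for_def refl_group_adjoint[OF u] inner_commute[of "w ?x"])
  then show "?g \<in> refl_group K" by (rule stabilizer_face_point(2)[OF K x g])
next
  assume g: "finv u \<circ> w \<in> refl_group K"
  show "w ` standard_face \<Delta> K \<subseteq> closure (u ` fundamental_chamber \<Delta>)"
  proof
    fix y assume "y \<in> w ` standard_face \<Delta> K"
    then obtain x where x: "x \<in> standard_face \<Delta> K" "y = w x" by blast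
    have "(finv u \<circ> w) x = x"
      using refl_group_fixes_perp[OF g] x(1) standard_face_subset_perp by blast
    then have "u ((finv u \<circ> w) x) = u x" by simp
    then have y: "y = u x" using x(2) u by simp
    have "\<exists>z\<in>u ` fundamental_chamber \<Delta>. dist z y < e" if "0 < e" for e
    proof -
      \<comment> \<open>The summand 1 keeps the denominator positive and the displacement
        \<open>t * norm \<rho>\<close> strictly below \<open>e\<close>.\<close>
      define t where "t = e / (norm \<rho> + 1)"
      have t: "0 < t" using that by (simp add: t_def add_nonneg_pos)
      have "x + t *\<^sub>R \<rho> \<in> fundamental_chamber \<Delta>"
        using standard_face_dominant[OF x(1)] t
        by (auto simp: fundamental_chamber_def dominant_for_def inner_add_left inner_commute[of \<rho>]
            base_inner_rho intro: add_nonneg_pos)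
      moreover have "dist (u (x + t *\<^sub>R \<rho>)) y < e"
      proof -
        have lin: "linear u" by (rule refl_group_linear[OF u])
        have "dist (u (x + t *\<^sub>R \<rho>)) y = norm (u (t *\<^sub>R \<rho>))"
          by (simp add: y dist_norm linear_add[OF lin])
        also have "\<dots> = t * norm \<rho>" using t by (simp add: norm_eq_sqrt_inner refl_group_inner[OF u] real_sqrt_mult)
        also have "\<dots> < t * (norm \<rho> + 1)" using t by simp
        also have "\<dots> = e"
        proof -
          have "norm \<rho> + 1 \<noteq> 0" using norm_ge_zero[of \<rho>] by linarith
          then show ?thesis by (simp add: t_def)
        qed
        finally show ?thesis .
      qed
      ultimately show ?thesis by blast
    qed
    then show "y \<in> closure (u ` fundamental_chamber \<Delta>)" by (simp add: closure_approachable)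
  qed
qed

text \<open>The point \<open>\<rho>\<close> represents the fundamental chamber, and
  \<open>u \<rho> \<bullet> \<beta>\<close> is the height of the pullback of \<open>\<beta>\<close>
  by \<open>u\<close>; its sign tells on which side the image chamber lies.\<close>

lemma separates_iff:
  assumes u: "u \<in> W" and \<beta>: "\<beta> \<in> pos"
  shows "separates {v. v \<bullet> \<beta> = 0} (fundamental_chamber \<Delta>) (u ` fundamental_chamber \<Delta>) \<longleftrightarrow>
    \<beta> \<in> inversions (finv u)"
proof -
  have r: "\<beta> \<in> \<Phi>" and fu: "finv u \<in> W" using \<beta> pos_root u refl_group_inv by auto
  have rho: "0 < \<rho> \<bullet> \<beta>" using \<beta> by (simp add: pos_def inner_commute)
  have inv: "\<beta> \<in> inversions (finv u) \<longleftrightarrow> u \<rho> \<bullet> \<beta> < 0"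
  proof -
    have "finv u \<beta> \<in> \<Phi>" using root_image[OF fu r] .
    then have "finv u \<beta> \<notin> pos \<longleftrightarrow> finv u \<beta> \<bullet> \<rho> < 0" using root_height_neq_zero by (force simp: pos_def)
    moreover have "finv u \<beta> \<bullet> \<rho> = u \<rho> \<bullet> \<beta>"
      using refl_group_adjoint[OF u, of \<beta> \<rho>] inner_commute[of \<beta> "u \<rho>"] by simp
    ultimately show ?thesis using \<beta> by (simp add: inversions_def)
  qed
  have C: "fundamental_chamber \<Delta> = sign_class \<rho>"
    using chamber_eq_sign_class[OF refl_group_id] by simp
  have uC: "u ` sign_class \<rho> = sign_class (u \<rho>)" by (rule image_sign_class[OF u])
  show ?thesis
    unfolding inv
  proof
    assume "separates {v. v \<bullet> \<beta> = 0} (fundamental_chamber \<Delta>) (u ` fundamental_chamber \<Delta>)"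
    then obtain S T where ST: "S \<in> {{v. 0 < v \<bullet> \<beta>}, {v. v \<bullet> \<beta> < 0}}" "T \<in> {{v. 0 < v \<bullet> \<beta>}, {v. v \<bullet> \<beta> < 0}}"
        "S \<noteq> T" "sign_class \<rho> \<subseteq> S" "sign_class (u \<rho>) \<subseteq> T"
      unfolding separates_def open_half_spaces_hyperplane[OF root_neq_zero[OF r]] C uC
      by (elim bexE conjE) (rule that; assumption)
    have "\<rho> \<in> S" "u \<rho> \<in> T" using ST(4,5) sign_class_self by blast+
    with ST(1-3) show "u \<rho> \<bullet> \<beta> < 0" using rho by auto
  next
    assume neg: "u \<rho> \<bullet> \<beta> < 0"
    have "sign_class \<rho> \<subseteq> {v. 0 < v \<bullet> \<beta>}"
    proof
      fix v assume "v \<in> sign_class \<rho>"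
      then have "sgn (v \<bullet> \<beta>) = sgn (\<rho> \<bullet> \<beta>)" using r by (simp add: sign_class_def)
      then show "v \<in> {v. 0 < v \<bullet> \<beta>}" using rho by (simp add: sgn_1_pos)
    qed
    moreover have "sign_class (u \<rho>) \<subseteq> {v. v \<bullet> \<beta> < 0}"
    proof
      fix v assume "v \<in> sign_class (u \<rho>)"
      then have "sgn (v \<bullet> \<beta>) = sgn (u \<rho> \<bullet> \<beta>)" using r by (simp add: sign_class_def)
      then show "v \<in> {v. v \<bullet> \<beta> < 0}" using neg by (simp add: sgn_1_neg)
    qed
    moreover have "{v. 0 < v \<bullet> \<beta>} \<noteq> {v. v \<bullet> \<beta> < 0}"
    proof -
      have "\<rho> \<in> {v. 0 < v \<bullet> \<beta>}" "\<rho> \<notin> {v. v \<bullet> \<beta> < 0}" using rho by auto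
      then show ?thesis by metis
    qed
    ultimately show "separates {v. v \<bullet> \<beta> = 0} (fundamental_chamber \<Delta>) (u ` fundamental_chamber \<Delta>)"
      unfolding separates_def open_half_spaces_hyperplane[OF root_neq_zero[OF r]] C uC
      by (intro bexI[of _ "{v. 0 < v \<bullet> \<beta>}"] bexI[of _ "{v. v \<bullet> \<beta> < 0}"] conjI) simp_all
  qed
qed

section \<open>Distances from the fundamental chamber and nearest chambers\<close>

definition separating :: "('a \<Rightarrow> 'a) \<Rightarrow> 'a set set" where
  "separating u = {H \<in> root_arrangement \<Phi>. separates H (fundamental_chamber \<Delta>) (u ` fundamental_chamber \<Delta>)}"

lemma root_arrangement_pos: "root_arrangement \<Phi> = (\<lambda>\<beta>. {v. v \<bullet> \<beta> = 0}) ` pos"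
proof (intro equalityI subsetI)
  fix H assume "H \<in> root_arrangement \<Phi>"
  then obtain \<beta> where \<beta>: "\<beta> \<in> \<Phi>" "H = {v. v \<bullet> \<beta> = 0}" unfolding root_arrangement_def by blast
  then have "H = {v. v \<bullet> (- \<beta>) = 0}" "\<beta> \<in> pos \<or> - \<beta> \<in> pos" using not_pos_iff by auto
  then show "H \<in> (\<lambda>\<beta>. {v. v \<bullet> \<beta> = 0}) ` pos" using \<beta>(2) by blast
qed (use pos_root in \<open>auto simp: root_arrangement_def\<close>)

text \<open>Keeping \<open>K\<close> positive makes \<open>w\<close> shortest in its coset. A
  hyperplane already separating gives a positive root, the negated pullback by \<open>w\<close>,
  outside the subsystem of \<open>K\<close>; the inverse of \<open>g\<close> keeps that root
  positive, so the hyperplane stays separating.\<close>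

lemma card_separating_less:
  assumes K: "K \<subseteq> \<Delta>" and w: "w \<in> W" "w ` K \<subseteq> pos" and g: "g \<in> refl_group K" "g \<noteq> id"
  shows "card (separating w) < card (separating (w \<circ> g))"
proof (rule psubset_card_mono)
  have gW: "g \<in> W" by (rule subgroup_W[OF K g(1)])
  have wg: "w \<circ> g \<in> W" using w gW by (intro refl_group_comp)
  have fwg: "finv (w \<circ> g) v = finv g (finv w v)" for v
    using refl_group_bij[OF w(1)] refl_group_bij[OF gW] by (simp add: o_inv_distrib)
  have sep_iff: "{v. v \<bullet> \<beta> = 0} \<in> separating u \<longleftrightarrow> \<beta> \<in> inversions (finv u)" if "u \<in> W" "\<beta> \<in> pos" for u \<beta>
    using separates_iff[OF that] that(2) root_arrangement_pos by (auto simp: separating_def)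
  show "finite (separating (w \<circ> g))" using finite_arrangement by (simp add: separating_def)
  show "separating w \<subset> separating (w \<circ> g)"
  proof
    show "separating w \<subseteq> separating (w \<circ> g)"
    proof
      fix H assume H: "H \<in> separating w"
      then obtain \<beta> where \<beta>: "\<beta> \<in> pos" "H = {v. v \<bullet> \<beta> = 0}"
        using root_arrangement_pos by (auto simp: separating_def)
      have r: "finv w \<beta> \<in> \<Phi>" using root_image[OF refl_group_inv[OF w(1)]] \<beta> pos_root by blast
      have "\<beta> \<in> inversions (finv w)" using sep_iff[OF w(1) \<beta>(1)] H \<beta>(2) by simp
      then have "finv w \<beta> \<notin> pos" by (simp add: inversions_def)
      then have \<gamma>: "- finv w \<beta> \<in> pos" using not_pos_iff[OF r] by blast
      have "- finv w \<beta> \<notin> levi K"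
      proof
        assume "- finv w \<beta> \<in> levi K"
        then have "w (- finv w \<beta>) \<in> pos" using pos_inside_levi[OF K w \<gamma>] by blast
        moreover have "w (- finv w \<beta>) = - \<beta>"
          using linear_neg[OF refl_group_linear[OF w(1)]] w(1) by simp
        ultimately show False using not_pos_iff[of \<beta>] \<beta> pos_root by auto
      qed
      then have "finv g (- finv w \<beta>) \<in> pos"
        using pos_outside_levi[OF K refl_group_inv[OF g(1)] \<gamma>] by blast
      then have "- finv g (finv w \<beta>) \<in> pos"
        using linear_neg[OF refl_group_linear[OF refl_group_inv[OF g(1)]]] by simp
      then have "finv (w \<circ> g) \<beta> \<notin> pos"
        using not_pos_iff[OF root_image[OF refl_group_inv[OF gW] r]] fwg by simp
      then have "\<beta> \<in> inversions (finv (w \<circ> g))" using \<beta>(1) by (simp add: inversions_def)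
      then show "H \<in> separating (w \<circ> g)" using sep_iff[OF wg \<beta>(1)] \<beta>(2) by simp
    qed
    \<comment> \<open>Strictness: a simple root made negative by the inverse of \<open>g\<close>
      must lie in the subsystem of \<open>K\<close>, and its image under \<open>w\<close> gives a
      hyperplane that is newly separating.\<close>
    have "finv g \<noteq> id"
    proof
      assume "finv g = id"
      then have "g v = v" for v using refl_group_inverse(1)[OF g(1), of v] by simp
      then show False using g(2) by auto
    qed
    then obtain \<alpha> where \<alpha>: "\<alpha> \<in> \<Delta>" "finv g \<alpha> \<notin> pos"
      using exists_simple_to_negative[OF refl_group_inv[OF gW]] by blast
    have \<alpha>pos: "\<alpha> \<in> pos" using \<alpha> base_pos by blast
    have "\<alpha> \<in> levi K" using pos_outside_levi[OF K refl_group_inv[OF g(1)] \<alpha>pos] \<alpha>(2) by blast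
    then have \<beta>: "w \<alpha> \<in> pos" using pos_inside_levi[OF K w \<alpha>pos] by blast
    have "{v. v \<bullet> w \<alpha> = 0} \<in> separating (w \<circ> g)"
      using sep_iff[OF wg \<beta>] \<beta> \<alpha>(2) fwg w(1) by (simp add: inversions_def)
    moreover have "{v. v \<bullet> w \<alpha> = 0} \<notin> separating w"
      using sep_iff[OF w(1) \<beta>] \<alpha>pos w(1) by (simp add: inversions_def)
    ultimately show "separating w \<noteq> separating (w \<circ> g)" by blast
  qed
qed

text \<open>The chambers adjacent to the face correspond to the elements of one coset, and every
  element other than \<open>w\<close> has strictly more separating hyperplanes. Strictness provides
  the uniqueness required by \<open>nearest_chamber\<close>.\<close>

lemma nearest_chamber_eq:
  assumes K: "K \<subseteq> \<Delta>" and w: "w \<in> W" "w ` K \<subseteq> pos"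
  shows "nearest_chamber (root_arrangement \<Phi>) (w ` standard_face \<Delta> K) (fundamental_chamber \<Delta>) =
    w ` fundamental_chamber \<Delta>"
proof -
  let ?C = "fundamental_chamber \<Delta>"
  let ?P = "\<lambda>D. D \<in> chambers (root_arrangement \<Phi>) \<and> w ` standard_face \<Delta> K \<subseteq> closure D"
  let ?f = "\<lambda>D. card {H \<in> root_arrangement \<Phi>. separates H ?C D}"
  have f: "?f (u ` ?C) = card (separating u)" for u by (simp add: separating_def)
  have P: "?P (w ` ?C)"
  proof -
    have "finv w \<circ> w = id" using w(1) by (simp add: fun_eq_iff)
    then show ?thesis
      using w(1) chambers_eq standard_face_subset_closure[OF w(1) w(1) K] refl_group_id by auto
  qed
  have other: "D = w ` ?C \<or> ?f (w ` ?C) < ?f D" if PD: "?P D" for D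
  proof -
    obtain u where u: "u \<in> W" "D = u ` ?C" using PD chambers_eq by auto
    define h where "h = finv u \<circ> w"
    have h: "h \<in> refl_group K" unfolding h_def
      using PD u standard_face_subset_closure[OF w(1) u(1) K] by simp
    have "u (h v) = w v" for v using u(1) by (simp add: h_def)
    then have "w (finv h v) = u v" for v using refl_group_inverse(1)[OF h, of v] by metis
    then have uw: "u = w \<circ> finv h" by (simp add: fun_eq_iff)
    show ?thesis
    proof (cases "finv h = id")
      case True
      then show ?thesis using uw u(2) by simp
    next
      case False
      have "card (separating w) < card (separating u)"
        unfolding uw by (rule card_separating_less[OF K w refl_group_inv[OF h] False])
      then show ?thesis unfolding u(2) f by (rule disjI2)
    qed
  qed
  show ?thesis
    unfolding nearest_chamber_def
  proof (rule the_equality)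
    show "is_arg_min ?f ?P (w ` ?C)"
    proof -
      have "\<not> ?f D < ?f (w ` ?C)" if "?P D" for D using other[OF that] by auto
      then show ?thesis unfolding is_arg_min_def using P by simp
    qed
    show "D = w ` ?C" if min: "is_arg_min ?f ?P D" for D
    proof -
      have "?P D" using min unfolding is_arg_min_def by (rule conjunct1)
      moreover have "\<not> ?f (w ` ?C) < ?f D" using min P unfolding is_arg_min_def by simp
      ultimately show ?thesis using other by auto
    qed
  qed
qed

text \<open>Choose \<open>g\<close> in the group of \<open>K\<close> making the pullback of
  \<open>\<rho>\<close> by \<open>w\<close> dominant for \<open>K\<close>. For \<open>u\<close> the
  composite of \<open>w\<close> with the inverse of \<open>g\<close>, the height of
  \<open>u \<alpha>\<close> is a pairing of \<open>\<alpha>\<close> with that dominant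
  vector.\<close>

lemma minimal_representative:
  assumes K: "K \<subseteq> \<Delta>" and w: "w \<in> W"
  shows "\<exists>u\<in>W. u ` K \<subseteq> pos \<and> u ` standard_face \<Delta> K = w ` standard_face \<Delta> K"
proof -
  obtain g where g: "g \<in> refl_group K" "dominant_for K (g (finv w \<rho>))"
    using exists_dominant[OF K] by blast
  let ?u = "w \<circ> finv g"
  have gW: "g \<in> W" by (rule subgroup_W[OF K g(1)])
  have u: "?u \<in> W" using w gW by (intro refl_group_comp refl_group_inv)
  have "?u \<alpha> \<in> pos" if "\<alpha> \<in> K" for \<alpha>
  proof -
    have "?u \<alpha> \<bullet> \<rho> = \<alpha> \<bullet> g (finv w \<rho>)"
      by (simp add: refl_group_adjoint'[OF w] refl_group_adjoint[OF gW])
    then have "0 \<le> ?u \<alpha> \<bullet> \<rho>" using g(2) that by (simp add: dominant_for_def inner_commute)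
    moreover have "?u \<alpha> \<in> \<Phi>" using root_image[OF u] that K base_roots by blast
    ultimately show ?thesis using root_height_neq_zero by (force simp: pos_def)
  qed
  moreover have "?u ` standard_face \<Delta> K = w ` standard_face \<Delta> K"
    using refl_group_fixes_standard_face[OF refl_group_inv[OF g(1)]] by (metis image_comp)
  ultimately show ?thesis using u by blast
qed

end

context based_root_system
begin

section \<open>The face weights\<close>

text \<open>Precomposition with Weyl group elements permutes the residue classes and moves their
  vanishing flats accordingly, so the count is constant on orbits of flats.\<close>

lemma stratum_count_image:
  assumes w: "w \<in> W"
  shows "stratum_count p (w ` X) = stratum_count p X"
proof -
  let ?P = "residues p ` coweights"
  let ?z = "\<lambda>c::'a \<Rightarrow> int. perp {\<beta> \<in> \<Phi>. c \<beta> = 0}"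
  have z: "?z (c \<circ> g) = finv g ` ?z c" if g: "g \<in> W" for c g
  proof -
    have "{\<beta> \<in> \<Phi>. (c \<circ> g) \<beta> = 0} = finv g ` {\<beta> \<in> \<Phi>. c \<beta> = 0}"
    proof (intro equalityI subsetI)
      fix \<beta> assume "\<beta> \<in> {\<beta> \<in> \<Phi>. (c \<circ> g) \<beta> = 0}"
      then show "\<beta> \<in> finv g ` {\<beta> \<in> \<Phi>. c \<beta> = 0}"
        using g root_image by (intro image_eqI[of _ _ "g \<beta>"]) auto
    qed (use g root_image[OF refl_group_inv[OF g]] in auto)
    then show ?thesis by (simp only: image_perp[OF refl_group_inv[OF g]])
  qed
  have finv_finv: "finv (finv w) = w" using refl_group_bij[OF w] by (rule inv_inv_eq)
  have "bij_betw (\<lambda>c. c \<circ> w) {c \<in> ?P. ?z c = w ` X} {c \<in> ?P. ?z c = X}"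
  proof (rule bij_betwI[where g = "\<lambda>c. c \<circ> finv w"])
    show "(\<lambda>c. c \<circ> w) \<in> {c \<in> ?P. ?z c = w ` X} \<rightarrow> {c \<in> ?P. ?z c = X}"
    proof
      fix c assume c: "c \<in> {c \<in> ?P. ?z c = w ` X}"
      have "?z (c \<circ> w) = finv w ` w ` X" using c z[OF w] by simp
      also have "\<dots> = X" using refl_group_inverse(2)[OF w] by (simp add: image_image)
      finally have "?z (c \<circ> w) = X" .
      moreover have "c \<circ> w \<in> ?P" using c w residues_comp_image by blast
      ultimately show "c \<circ> w \<in> {c \<in> ?P. ?z c = X}" by blast
    qed
    show "(\<lambda>c. c \<circ> finv w) \<in> {c \<in> ?P. ?z c = X} \<rightarrow> {c \<in> ?P. ?z c = w ` X}"
    proof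
      fix c assume c: "c \<in> {c \<in> ?P. ?z c = X}"
      have "?z (c \<circ> finv w) = w ` X" using c z[OF refl_group_inv[OF w]] finv_finv by simp
      moreover have "c \<circ> finv w \<in> ?P" using c refl_group_inv[OF w] residues_comp_image by blast
      ultimately show "c \<circ> finv w \<in> {c \<in> ?P. ?z c = w ` X}" by blast
    qed
  qed (use w in \<open>auto simp: fun_eq_iff\<close>)
  from bij_betw_same_card[OF this] show ?thesis unfolding stratum_count_def by (rule arg_cong)
qed

lemma face_weight_standard:
  assumes w: "w \<in> W" and K: "K \<subseteq> \<Delta>"
  shows "face_weight \<Phi> \<Delta> x (w ` standard_face \<Delta> K) = coset_weight \<Phi> \<Delta> x K"
proof -
  have "(THE J. J \<subseteq> \<Delta> \<and> (\<exists>u\<in>carrier (weyl_group \<Phi>). w ` standard_face \<Delta> K = u ` standard_face \<Delta> J)) = K"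
  proof (rule the_equality)
    fix J assume "J \<subseteq> \<Delta> \<and> (\<exists>u\<in>carrier (weyl_group \<Phi>). w ` standard_face \<Delta> K = u ` standard_face \<Delta> J)"
    then obtain u where "J \<subseteq> \<Delta>" "u \<in> W" "w ` standard_face \<Delta> K = u ` standard_face \<Delta> J"
      unfolding carrier_weyl_group by blast
    then show "J = K" using standard_face_image_eq(1)[OF w _ K] by blast
  qed (use w K in \<open>auto simp: carrier_weyl_group\<close>)
  then show ?thesis by (simp add: face_weight_def)
qed

lemma perp_in_lattice: "K \<subseteq> \<Delta> \<Longrightarrow> perp K \<in> intersection_lattice (root_arrangement \<Phi>)"
  using base_roots by (intro perp_lattice) auto

lemma perp_image_in_lattice:
  "w \<in> W \<Longrightarrow> K \<subseteq> \<Delta> \<Longrightarrow> w ` perp K \<in> intersection_lattice (root_arrangement \<Phi>)"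
  unfolding intersection_lattice_eq by blast

lemma finite_W_subset: "S \<subseteq> W \<Longrightarrow> finite S"
  using finite_W finite_subset by blast

lemma coset_weight_eq:
  assumes "irreducible_root_system \<Phi>" "good_prime \<Phi> \<Delta> p" "K \<subseteq> \<Delta>"
  shows "coset_weight \<Phi> \<Delta> (real p) K = real (card (refl_group K)) * stratum_count p (perp K) /
    (real p ^ DIM('a) * real (card {w \<in> W. w ` perp K = perp K}) * real (card (conjugate_subsets \<Phi> \<Delta> K)))"
  unfolding coset_weight_def fixed_space_parabolic[OF assms(3)] normalizer_parabolic[OF assms(3)]
    upper_char_poly_eq_stratum_count[OF assms(1,2) perp_in_lattice[OF assms(3)]]
  unfolding parabolic_eq[OF subbase_roots[OF assms(3)]] ..

lemma coset_weight_nonneg: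
  assumes "irreducible_root_system \<Phi>" "good_prime \<Phi> \<Delta> p" "K \<subseteq> \<Delta>"
  shows "0 \<le> coset_weight \<Phi> \<Delta> (real p) K"
  by (simp add: coset_weight_eq[OF assms] stratum_count_def)

text \<open>Faces are grouped into orbits, one for each \<open>K\<close>; each orbit sum is
  rewritten as a sum over an orbit of flats, and exchanging the order of summation leaves each open
  stratum counted exactly once.\<close>

lemma sum_face_weight:
  assumes irr: "irreducible_root_system \<Phi>" and good: "good_prime \<Phi> \<Delta> p"
  shows "(\<Sum>F\<in>arrangement_faces (root_arrangement \<Phi>). face_weight \<Phi> \<Delta> (real p) F) = 1"
proof -
  let ?L = "intersection_lattice (root_arrangement \<Phi>)"
  let ?c = "\<lambda>K. real (card (conjugate_subsets \<Phi> \<Delta> K))"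
  let ?F = "\<lambda>K. (\<lambda>w. w ` standard_face \<Delta> K) ` W"
  let ?X = "\<lambda>K. (\<lambda>w. w ` perp K) ` W"
  have p: "0 < real p" using good prime_gt_0_nat by (simp add: good_prime_def)
  have orbit: "card W = card ((\<lambda>w. w ` S) ` W) * card {w \<in> W. w ` S = S}" for S
    by (rule card_orbit_times_stabilizer[OF finite_W]) (rule refl_group_comp refl_group_inv refl_group_bij; assumption)+
  have orbit_sum: "(\<Sum>F\<in>?F K. face_weight \<Phi> \<Delta> (real p) F) = (\<Sum>X\<in>?X K. stratum_count p X / ?c K) / real p ^ DIM('a)"
    if K: "K \<subseteq> \<Delta>" for K
  proof -
    let ?s = "card {w \<in> W. w ` perp K = perp K}"
    have "id \<in> {w \<in> W. w ` perp K = perp K}" using refl_group_id by simp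
    then have s: "0 < ?s" using finite_W_subset[of "{w \<in> W. w ` perp K = perp K}"] by (auto simp: card_gt_0_iff)
    \<comment> \<open>Both products equal the order of the Weyl group: a face has the parabolic
      subgroup as stabilizer, its flat has the normalizer.\<close>
    have nat_cards: "card (?F K) * card (refl_group K) = card (?X K) * ?s"
      using orbit[of "standard_face \<Delta> K"] orbit[of "perp K"] by (simp add: standard_face_stabilizer[OF K])
    have cards: "real (card (?F K)) * real (card (refl_group K)) = real (card (?X K)) * real ?s"
      using arg_cong[OF nat_cards, of real] by (simp only: of_nat_mult)
    have "(\<Sum>F\<in>?F K. face_weight \<Phi> \<Delta> (real p) F) = (\<Sum>F\<in>?F K. coset_weight \<Phi> \<Delta> (real p) K)"
      using face_weight_standard[OF _ K] by (intro sum.cong) auto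
    also have "\<dots> = (real (card (?F K)) * real (card (refl_group K))) * stratum_count p (perp K) /
        (real p ^ DIM('a) * real ?s * ?c K)"
      by (simp add: coset_weight_eq[OF irr good K])
    also have "\<dots> = real (card (?X K)) * (stratum_count p (perp K) / ?c K) / real p ^ DIM('a)"
      unfolding cards using s p by (simp add: field_simps)
    also have "real (card (?X K)) * (stratum_count p (perp K) / ?c K) = (\<Sum>X\<in>?X K. stratum_count p X / ?c K)"
      using stratum_count_image by (subst sum.cong[of "?X K" "?X K" _ "\<lambda>_. stratum_count p (perp K) / ?c K"]) auto
    finally show ?thesis .
  qed
  have faces: "arrangement_faces (root_arrangement \<Phi>) = (\<Union>K\<in>Pow \<Delta>. ?F K)"
    unfolding arrangement_faces_eq by blast
  have disj: "?F K \<inter> ?F J = {}" if KJ: "K \<in> Pow \<Delta>" "J \<in> Pow \<Delta>" "K \<noteq> J" for K J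
  proof (rule equals0I)
    fix F assume "F \<in> ?F K \<inter> ?F J"
    then obtain w u where "w \<in> W" "u \<in> W" "w ` standard_face \<Delta> K = u ` standard_face \<Delta> J" by blast
    then show False using standard_face_image_eq(1)[of w u K J] KJ by blast
  qed
  \<comment> \<open>A flat occurs in the orbits of exactly the members of
    \<open>\<lambda>(K)\<close>, so division by the size of \<open>\<lambda>(K)\<close> cancels its
    repeated occurrence.\<close>
  have conj: "conjugate_subsets \<Phi> \<Delta> K = {J \<in> Pow \<Delta>. X \<in> ?X J}" if K: "K \<subseteq> \<Delta>" and X: "X \<in> ?X K" for K X
  proof -
    obtain u where u: "u \<in> W" "X = u ` perp K" using X by blast
    have "(\<exists>w\<in>W. w ` perp K = perp J) \<longleftrightarrow> X \<in> ?X J" for J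
    proof
      assume "\<exists>w\<in>W. w ` perp K = perp J"
      then obtain w where w: "w \<in> W" "w ` perp K = perp J" by blast
      have "(u \<circ> finv w) ` perp J = X"
        unfolding u(2) w(2)[symmetric] using refl_group_inverse(2)[OF w(1)] by (simp add: image_image)
      moreover have "u \<circ> finv w \<in> W" using u w by (intro refl_group_comp refl_group_inv)
      ultimately show "X \<in> ?X J" by (intro image_eqI[of _ _ "u \<circ> finv w"]) simp_all
    next
      assume "X \<in> ?X J"
      then obtain w where w: "w \<in> W" "X = w ` perp J" by blast
      have "(finv w \<circ> u) ` perp K = finv w ` X" unfolding u(2) by (rule image_comp[symmetric])
      also have "\<dots> = perp J" unfolding w(2) using refl_group_inverse(2)[OF w(1)] by (simp add: image_image)
      finally have "(finv w \<circ> u) ` perp K = perp J" .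
      moreover have "finv w \<circ> u \<in> W" using u w by (intro refl_group_comp refl_group_inv)
      ultimately show "\<exists>w\<in>W. w ` perp K = perp J" by (rule bexI)
    qed
    then show ?thesis unfolding conjugate_subsets_eq[OF K] by auto
  qed
  have lattice: "{X \<in> ?L. X \<in> ?X K} = ?X K" if "K \<in> Pow \<Delta>" for K
    using that perp_image_in_lattice by blast
  have "(\<Sum>F\<in>arrangement_faces (root_arrangement \<Phi>). face_weight \<Phi> \<Delta> (real p) F) =
      (\<Sum>K\<in>Pow \<Delta>. \<Sum>F\<in>?F K. face_weight \<Phi> \<Delta> (real p) F)"
    unfolding faces using finite_base finite_W disj by (intro sum.UNION_disjoint) auto
  also have "\<dots> = (\<Sum>K\<in>Pow \<Delta>. \<Sum>X\<in>?X K. stratum_count p X / ?c K) / real p ^ DIM('a)"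
    using orbit_sum by (simp add: sum_divide_distrib)
  also have "(\<Sum>K\<in>Pow \<Delta>. \<Sum>X\<in>?X K. stratum_count p X / ?c K) =
      (\<Sum>K\<in>Pow \<Delta>. \<Sum>X\<in>{X \<in> ?L. X \<in> ?X K}. stratum_count p X / ?c K)"
    using lattice by (intro sum.cong) auto
  also have "\<dots> = (\<Sum>X\<in>?L. \<Sum>K\<in>{K \<in> Pow \<Delta>. X \<in> ?X K}. stratum_count p X / ?c K)"
    using finite_base finite_lattice by (intro sum.swap_restrict) auto
  also have "\<dots> = (\<Sum>X\<in>?L. stratum_count p X)"
  proof (intro sum.cong refl)
    fix X assume "X \<in> ?L"
    let ?T = "{K \<in> Pow \<Delta>. X \<in> ?X K}"
    have "?T \<noteq> {}" using \<open>X \<in> ?L\<close> unfolding intersection_lattice_eq by blast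
    then have T: "0 < card ?T" using finite_base by (simp add: card_gt_0_iff)
    have "(\<Sum>K\<in>?T. stratum_count p X / ?c K) = (\<Sum>K\<in>?T. stratum_count p X / real (card ?T))"
    proof (intro sum.cong refl)
      fix K assume "K \<in> ?T"
      then have "conjugate_subsets \<Phi> \<Delta> K = ?T" by (intro conj) blast+
      then show "stratum_count p X / ?c K = stratum_count p X / real (card ?T)" by (rule arg_cong)
    qed
    also have "\<dots> = stratum_count p X" using T by simp
    finally show "(\<Sum>K\<in>?T. stratum_count p X / ?c K) = stratum_count p X" .
  qed
  also have "\<dots> = real p ^ DIM('a)"
    using sum_upper_char_poly[OF irr good] by (simp add: upper_char_poly_eq_stratum_count[OF irr good])
  finally show ?thesis using p by simp
qed

lemma finite_faces: "finite (arrangement_faces (root_arrangement \<Phi>))"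
proof -
  have "arrangement_faces (root_arrangement \<Phi>) = (\<Union>K\<in>Pow \<Delta>. (\<lambda>w. w ` standard_face \<Delta> K) ` W)"
    unfolding arrangement_faces_eq by blast
  then show ?thesis using finite_base finite_W by simp
qed

lemma face_weights_face_weight:
  assumes "irreducible_root_system \<Phi>" "good_prime \<Phi> \<Delta> p"
  shows "face_weights (root_arrangement \<Phi>) (face_weight \<Phi> \<Delta> (real p))"
proof -
  have "0 \<le> face_weight \<Phi> \<Delta> (real p) F" if F: "F \<in> arrangement_faces (root_arrangement \<Phi>)" for F
  proof -
    obtain w K where "w \<in> W" "K \<subseteq> \<Delta>" "F = w ` standard_face \<Delta> K"
      using F unfolding arrangement_faces_eq by blast
    then show ?thesis using face_weight_standard coset_weight_nonneg[OF assms] by simp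
  qed
  then show ?thesis unfolding face_weights_def using sum_face_weight[OF assms] by blast
qed

text \<open>Write a face with a representative \<open>u\<close> that keeps \<open>K\<close>
  positive. Its nearest chamber is the image under \<open>u\<close>, which equals the image under
  \<open>w\<close> only for \<open>u = w\<close>; positivity of \<open>K\<close> then says that
  \<open>K\<close> avoids the descents of \<open>w\<close>.\<close>

lemma nearest_chamber_preimage:
  assumes w: "w \<in> W"
  shows "{F \<in> arrangement_faces (root_arrangement \<Phi>).
      nearest_chamber (root_arrangement \<Phi>) F (fundamental_chamber \<Delta>) = w ` fundamental_chamber \<Delta>} =
    (\<lambda>K. w ` standard_face \<Delta> K) ` Pow (\<Delta> - Des \<Phi> \<Delta> w)"
proof -
  have Des_iff: "K \<subseteq> \<Delta> - Des \<Phi> \<Delta> w \<longleftrightarrow> K \<subseteq> \<Delta> \<and> w ` K \<subseteq> pos" for K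
    using root_image[OF w] base_roots by (auto simp: Des_def negative_roots_eq subset_iff)
  show ?thesis
  proof (intro equalityI subsetI)
    fix F assume F: "F \<in> {F \<in> arrangement_faces (root_arrangement \<Phi>).
      nearest_chamber (root_arrangement \<Phi>) F (fundamental_chamber \<Delta>) = w ` fundamental_chamber \<Delta>}"
    then obtain v K where vK: "v \<in> W" "K \<subseteq> \<Delta>" "F = v ` standard_face \<Delta> K"
      unfolding arrangement_faces_eq by blast
    obtain u where u: "u \<in> W" "u ` K \<subseteq> pos" "F = u ` standard_face \<Delta> K"
      using minimal_representative[OF vK(2,1)] vK(3) by metis
    have "u ` fundamental_chamber \<Delta> = w ` fundamental_chamber \<Delta>"
      using F nearest_chamber_eq[OF vK(2) u(1,2)] u(3) by simp
    then have "u = w" by (rule chamber_image_inj[OF u(1) w])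
    then show "F \<in> (\<lambda>K. w ` standard_face \<Delta> K) ` Pow (\<Delta> - Des \<Phi> \<Delta> w)"
      using u vK(2) Des_iff by blast
  next
    fix F assume "F \<in> (\<lambda>K. w ` standard_face \<Delta> K) ` Pow (\<Delta> - Des \<Phi> \<Delta> w)"
    then obtain K where "K \<in> Pow (\<Delta> - Des \<Phi> \<Delta> w)" and F: "F = w ` standard_face \<Delta> K"
      by (elim imageE)
    then have K: "K \<subseteq> \<Delta>" "w ` K \<subseteq> pos" using Des_iff by simp_all
    have "F \<in> arrangement_faces (root_arrangement \<Phi>)"
      unfolding arrangement_faces_eq F using K(1) w by blast
    then show "F \<in> {F \<in> arrangement_faces (root_arrangement \<Phi>).
      nearest_chamber (root_arrangement \<Phi>) F (fundamental_chamber \<Delta>) = w ` fundamental_chamber \<Delta>}"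
      using nearest_chamber_eq[OF K(1) w K(2)] F by simp
  qed
qed

lemma sum_nearest_chamber_preimage:
  assumes w: "w \<in> W"
  shows "(\<Sum>F\<in>{F \<in> arrangement_faces (root_arrangement \<Phi>).
      nearest_chamber (root_arrangement \<Phi>) F (fundamental_chamber \<Delta>) = w ` fundamental_chamber \<Delta>}.
      face_weight \<Phi> \<Delta> x F) = H_measure \<Phi> \<Delta> x w"
proof -
  have "inj_on (\<lambda>K. w ` standard_face \<Delta> K) (Pow (\<Delta> - Des \<Phi> \<Delta> w))"
  proof (rule inj_onI)
    fix K J assume "K \<in> Pow (\<Delta> - Des \<Phi> \<Delta> w)" "J \<in> Pow (\<Delta> - Des \<Phi> \<Delta> w)"
      "w ` standard_face \<Delta> K = w ` standard_face \<Delta> J"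
    then show "K = J" using standard_face_image_eq(1)[OF w w, of K J] by blast
  qed
  then show ?thesis
    unfolding nearest_chamber_preimage[OF w] H_measure_def
    by (subst sum.reindex) (auto intro!: sum.cong face_weight_standard[OF w])
qed

end

section \<open>The one-step law of the walk\<close>

lemma pmf_face_pmf:
  assumes "finite (arrangement_faces A)" "face_weights A v"
  shows "pmf (face_pmf A v) F = (if F \<in> arrangement_faces A then v F else 0)"
  unfolding face_pmf_def
proof (rule pmf_embed_pmf)
  let ?f = "\<lambda>F. if F \<in> arrangement_faces A then v F else 0"
  have "(\<integral>\<^sup>+F. ennreal (?f F) \<partial>count_space UNIV) = (\<Sum>F\<in>arrangement_faces A. ennreal (?f F))"
    by (rule nn_integral_count_space'[OF assms(1)]) auto
  also have "\<dots> = ennreal (\<Sum>F\<in>arrangement_faces A. v F)"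
    using assms(2) by (simp add: face_weights_def sum_ennreal)
  also have "\<dots> = 1" using assms(2) by (simp add: face_weights_def)
  finally show "(\<integral>\<^sup>+F. ennreal (?f F) \<partial>count_space UNIV) = 1" .
qed (use assms(2) in \<open>simp add: face_weights_def\<close>)

lemma pmf_bhr_walk_one:
  assumes fin: "finite (arrangement_faces A)" and v: "face_weights A v"
  shows "pmf (bhr_walk A v C 1) D = (\<Sum>F\<in>{F \<in> arrangement_faces A. nearest_chamber A F C = D}. v F)"
proof -
  let ?M = "face_pmf A v" and ?g = "\<lambda>F. nearest_chamber A F C"
  let ?S = "{F \<in> arrangement_faces A. ?g F = D}"
  have set: "set_pmf ?M \<subseteq> arrangement_faces A"
    using pmf_face_pmf[OF fin v] by (auto simp: set_pmf_iff split: if_splits)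
  have "pmf (bhr_walk A v C 1) D = measure ?M (?g -` {D})"
    by (simp add: bind_return_pmf pmf_map)
  also have "\<dots> = measure ?M (?g -` {D} \<inter> set_pmf ?M)" by (rule measure_Int_set_pmf[symmetric])
  \<comment> \<open>The preimage also contains sets that are not faces, on which
    \<open>nearest_chamber\<close> has no meaning; intersecting with the support discards
    them.\<close>
  also have "?g -` {D} \<inter> set_pmf ?M = ?S \<inter> set_pmf ?M" using set by blast
  also have "measure ?M (?S \<inter> set_pmf ?M) = measure ?M ?S" by (rule measure_Int_set_pmf)
  also have "\<dots> = (\<Sum>F\<in>?S. pmf ?M F)" using fin by (intro measure_measure_pmf_finite) simp
  also have "\<dots> = (\<Sum>F\<in>?S. v F)" by (intro sum.cong) (auto simp: pmf_face_pmf[OF fin v])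
  finally show ?thesis .
qed

theorem proposition5:
  fixes \<Phi> \<Delta> :: "'a::euclidean_space set" and p :: nat
  assumes "crystallographic_root_system \<Phi>"
    and "irreducible_root_system \<Phi>"
    and "root_base \<Phi> \<Delta>"
    and "good_prime \<Phi> \<Delta> p"
  shows "(\<forall>w\<in>carrier (weyl_group \<Phi>). \<forall>K\<subseteq>\<Delta>.
            face_weight \<Phi> \<Delta> (real p) (w ` standard_face \<Delta> K) = coset_weight \<Phi> \<Delta> (real p) K) \<and>
         face_weights (root_arrangement \<Phi>) (face_weight \<Phi> \<Delta> (real p)) \<and>
         (\<forall>w\<in>carrier (weyl_group \<Phi>).
            pmf (bhr_walk (root_arrangement \<Phi>) (face_weight \<Phi> \<Delta> (real p)) (fundamental_chamber \<Delta>) 1)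
                (w ` fundamental_chamber \<Delta>) = H_measure \<Phi> \<Delta> (real p) w) \<and>
         (\<forall>w\<in>carrier (weyl_group \<Phi>). 0 \<le> H_measure \<Phi> \<Delta> (real p) w)"
proof -
  interpret based_root_system \<Phi> \<Delta> using assms by unfold_locales
  have weights: "face_weights (root_arrangement \<Phi>) (face_weight \<Phi> \<Delta> (real p))"
    by (rule face_weights_face_weight[OF assms(2,4)])
  have walk: "pmf (bhr_walk (root_arrangement \<Phi>) (face_weight \<Phi> \<Delta> (real p)) (fundamental_chamber \<Delta>) 1)
      (w ` fundamental_chamber \<Delta>) = H_measure \<Phi> \<Delta> (real p) w" if "w \<in> W" for w
    unfolding pmf_bhr_walk_one[OF finite_faces weights] by (rule sum_nearest_chamber_preimage[OF that])
  moreover have "0 \<le> H_measure \<Phi> \<Delta> (real p) w" if "w \<in> W" for w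
    unfolding walk[OF that, symmetric] by (rule pmf_nonneg)
  ultimately show ?thesis
    unfolding carrier_weyl_group using face_weight_standard weights by blast
qed

end
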